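(* (1) The elements $\omega^{\bm e}$ with $\bm0\le\bm e<\bm{q-1}$ form an integral basis of $A_0[\zeta]$ over $A[\zeta]$ (i.e. a basis of $A_0[\zeta]$ as an $A[\zeta]$-module). (2) For all $n>0$, the elements $(\omega^{(n)})^{\bm e}$ with $\bm0\le\bm e\le\bm{q-1}$ form an integral basis of $A_n[\zeta]$ over $A_{n-1}[\zeta]$. (3) Hence, for all $n\ge0$, the products $\prod_{j=0}^n(\omega^{(j)})^{\bm e_j}$ with $\bm0\le\bm e_0<\bm{q-1}$ and $\bm0\le\bm e_j\le\bm{q-1}$ for $j=1,\dots,n$ form an integral basis of $A_n[\zeta]$ over $A[\zeta]$.
   Context: Let $q$ be a prime power, $A=\mathbb{F}_q[\theta]$, $K=\mathbb{F}_q(\theta)$, $\mathbb{C}_\infty$ the completion of an algebraic closure of $\mathbb{F}_q((1/\theta))$ with $|\theta|=q$. For $a\in A$, $\mathfrak{c}_a$ is the image of $a$ under the $\mathbb{F}_q$-algebra map $A\to A\{\tau\}$ (twisted polynomials), $\theta\mapsto\tau+\theta$, acting on $\mathbb{C}_\infty$ by $\tau(x)=x^q$ (Carlitz module); $C[a]$ is its set of roots in $\mathbb{C}_\infty$. Fix $\lambda_\theta$ with $\lambda_\theta^{q-1}=-\theta$, let $\omega(t)=\lambda_\theta\prod_{j\ge0}(1-t/\theta^{q^j})^{-1}$ (the Anderson–Thakur function, converging for $|t|<q$), with hyperderivatives defined by $\omega(t+X)=\sum_n\omega^{(n)}(t)X^n$ ($\omega^{(0)}=\omega$). Let $\mathfrak{p}\in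 A$ be monic irreducible of degree $d$, $\zeta$ a root of $\mathfrak{p}$ in the algebraic closure of $\mathbb{F}_q$ in $\mathbb{C}_\infty$, $\zeta_i=\zeta^{q^{i-1}}$ ($i=1,\dots,d$). For $n\ge0$, $K_n=K(C[\mathfrak{p}^{n+1}])$, $A_n$ is the integral closure of $A$ in $K_n$, and $A_n[\zeta]$ the ring generated by $A_n$ and $\zeta$. Multi-indices $\bm e=(e_1,\dots,e_d)$ of nonnegative integers: $\bm f\le\bm e$ means $f_i\le e_i$ for all $i$, $\bm f<\bm e$ means $\bm f\le\bm e$ and $\bm f\ne\bm e$; $\bm0=(0,\dots,0)$, $\bm{q-1}=(q-1,\dots,q-1)$; $(\omega^{(n)})^{\bm e}:=\prod_{i=1}^d\omega^{(n)}(\zeta_i)^{e_i}$ and $\omega^{\bm e}:=(\omega^{(0)})^{\bm e}$. *)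

theory Defs
  imports
    "HOL-Algebra.Algebraic_Closure_Type"
    "HOL-Analysis.Analysis"
    "HOL-Computational_Algebra.Computational_Algebra"
begin

section \<open>Complete non-archimedean fields and the field \<open>C\<^sub>\<infinity>\<close>\<close>

text \<open>
  Fields with a non-archimedean absolute value \<open>x \<mapsto> dist x 0\<close>.  The library's class
  of real normed fields cannot be used, since it forces characteristic 0.
\<close>

class nonarch_field = field + metric_space +
  assumes dist_add_right_eq: "dist (x + z) (y + z) = dist x y"
    and dist_mult_zero: "dist (x * y) 0 = dist x 0 * dist y 0"
    and dist_ultrametric: "dist x z \<le> max (dist x y) (dist y z)"

definition vabs :: "'c::nonarch_field \<Rightarrow> real" where
  "vabs x = dist x 0"

text \<open>
  \<open>\<bbbF>\<^sub>q\<close> is a finite field type \<open>'a\<close> with \<open>q = CARD('a)\<close>, and \<open>\<bbbF>\<^sub>q((1/\<theta>))\<close> is the type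
  \<open>'a fls\<close>, whose variable \<open>fls_X\<close> stands for \<open>1/\<theta>\<close>.  The complete field \<open>'c\<close>, with
  \<open>\<iota>\<close>, is a completion of the algebraic closure of \<open>\<bbbF>\<^sub>q((1/\<theta>))\<close> for the extension
  of the absolute value with \<open>|\<theta>| = q\<close> (this extension is unique, hence so are \<open>'c\<close> and \<open>\<iota>\<close>
  up to isometric isomorphism).
\<close>

locale C_infinity =
  fixes \<iota> :: "'a::{field,finite} fls alg_closure \<Rightarrow> 'c::{nonarch_field,complete_space}"
  assumes hom_one: "\<iota> 1 = 1"
    and hom_add: "\<iota> (x + y) = \<iota> x + \<iota> y"
    and hom_mult: "\<iota> (x * y) = \<iota> x * \<iota> y"
    and vabs_fls: "f \<noteq> 0 \<Longrightarrow> vabs (\<iota> (to_ac f)) = real CARD('a) powi (- fls_subdegree f)"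
    and dense: "closure (range \<iota>) = UNIV"

definition Fq_emb :: "('a::{field,finite} fls alg_closure \<Rightarrow> 'c::nonarch_field) \<Rightarrow> 'a \<Rightarrow> 'c" where
  "Fq_emb \<iota> c = \<iota> (to_ac (fls_const c))"

definition theta :: "('a::{field,finite} fls alg_closure \<Rightarrow> 'c::nonarch_field) \<Rightarrow> 'c" where
  "theta \<iota> = \<iota> (to_ac fls_X_inv)"

text \<open>\<open>A = \<bbbF>\<^sub>q[\<theta>]\<close> is \<open>'a poly\<close>, embedded into \<open>'c\<close> as follows.\<close>

definition A_emb :: "('a::{field,finite} fls alg_closure \<Rightarrow> 'c::nonarch_field) \<Rightarrow> 'a poly \<Rightarrow> 'c" where
  "A_emb \<iota> a = poly (map_poly (Fq_emb \<iota>) a) (theta \<iota>)"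

section \<open>The Carlitz module\<close>

text \<open>
  A twisted polynomial \<open>\<Sum> a\<^sub>i \<tau>\<^sup>i\<close> in \<open>A{\<tau>}\<close> is represented by the ordinary polynomial over
  \<open>A = 'a poly\<close> with the same coefficients; only the product differs, by \<open>\<tau> a = a\<^sup>q \<tau>\<close>.
\<close>

definition twisted_mult :: "'a::{field,finite} poly poly \<Rightarrow> 'a poly poly \<Rightarrow> 'a poly poly" where
  "twisted_mult P Q = (\<Sum>i\<le>degree P. \<Sum>j\<le>degree Q.
     monom (coeff P i * coeff Q j ^ (CARD('a) ^ i)) (i + j))"

definition twisted_power :: "'a::{field,finite} poly poly \<Rightarrow> nat \<Rightarrow> 'a poly poly" where
  "twisted_power P k = (twisted_mult P ^^ k) 1"

definition carlitz :: "'a::{field,finite} poly \<Rightarrow> 'a poly poly" where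
  "carlitz a = (\<Sum>k\<le>degree a. smult [:coeff a k:] (twisted_power [:[:0, 1:], 1:] k))"

definition twisted_eval ::
  "('a::{field,finite} fls alg_closure \<Rightarrow> 'c::nonarch_field) \<Rightarrow> 'a poly poly \<Rightarrow> 'c \<Rightarrow> 'c" where
  "twisted_eval \<iota> P x = (\<Sum>i\<le>degree P. A_emb \<iota> (coeff P i) * x ^ (CARD('a) ^ i))"

definition carlitz_torsion ::
  "('a::{field,finite} fls alg_closure \<Rightarrow> 'c::nonarch_field) \<Rightarrow> 'a poly \<Rightarrow> 'c set" where
  "carlitz_torsion \<iota> a = {x. twisted_eval \<iota> (carlitz a) x = 0}"

section \<open>Rings and fields inside \<open>C\<^sub>\<infinity>\<close>\<close>

definition is_subring :: "'c::comm_ring_1 set \<Rightarrow> bool" where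
  "is_subring R \<longleftrightarrow> 0 \<in> R \<and> 1 \<in> R \<and>
     (\<forall>x\<in>R. \<forall>y\<in>R. x + y \<in> R \<and> x * y \<in> R) \<and> (\<forall>x\<in>R. - x \<in> R)"

definition is_subfield :: "'c::field set \<Rightarrow> bool" where
  "is_subfield F \<longleftrightarrow> is_subring F \<and> (\<forall>x\<in>F. inverse x \<in> F)"

definition adjoin :: "'c::comm_ring_1 set \<Rightarrow> 'c \<Rightarrow> 'c set" where
  "adjoin R z = is_subring hull (R \<union> {z})"

definition integral_closure :: "'c::comm_ring_1 set \<Rightarrow> 'c set \<Rightarrow> 'c set" where
  "integral_closure R F =
     {x \<in> F. \<exists>p. lead_coeff p = 1 \<and> (\<forall>i. coeff p i \<in> R) \<and> poly p x = 0}"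

definition K_field :: "('a::{field,finite} fls alg_closure \<Rightarrow> 'c::nonarch_field) \<Rightarrow> 'c set" where
  "K_field \<iota> = is_subfield hull (range (A_emb \<iota>))"

definition K_ext ::
  "('a::{field,finite} fls alg_closure \<Rightarrow> 'c::nonarch_field) \<Rightarrow> 'a poly \<Rightarrow> nat \<Rightarrow> 'c set" where
  "K_ext \<iota> \<pp> n = is_subfield hull (K_field \<iota> \<union> carlitz_torsion \<iota> (\<pp> ^ (n + 1)))"

definition A_ext ::
  "('a::{field,finite} fls alg_closure \<Rightarrow> 'c::nonarch_field) \<Rightarrow> 'a poly \<Rightarrow> nat \<Rightarrow> 'c set" where
  "A_ext \<iota> \<pp> n = integral_closure (range (A_emb \<iota>)) (K_ext \<iota> \<pp> n)"

text \<open>The family \<open>b\<close>, indexed by the finite set \<open>I\<close>, is a basis of \<open>M\<close> as an \<open>R\<close>-module.\<close>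

definition integral_basis :: "'c::comm_ring_1 set \<Rightarrow> 'c set \<Rightarrow> 'i set \<Rightarrow> ('i \<Rightarrow> 'c) \<Rightarrow> bool" where
  "integral_basis R M I b \<longleftrightarrow> finite I \<and>
     M = {\<Sum>i\<in>I. r i * b i |r. \<forall>i\<in>I. r i \<in> R} \<and>
     (\<forall>r. (\<forall>i\<in>I. r i \<in> R) \<longrightarrow> (\<Sum>i\<in>I. r i * b i) = 0 \<longrightarrow> (\<forall>i\<in>I. r i = 0))"

section \<open>The Anderson-Thakur function\<close>

definition omega ::
  "('a::{field,finite} fls alg_closure \<Rightarrow> 'c::nonarch_field) \<Rightarrow> 'c \<Rightarrow> 'c \<Rightarrow> 'c" where
  "omega \<iota> lam t = lam * (\<Prod>j. inverse (1 - t / theta \<iota> ^ (CARD('a) ^ j)))"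

text \<open>
  \<open>hyperderiv n f t\<close> is the coefficient of \<open>X\<^sup>n\<close> in the (unique) power series that
  represents \<open>f (t + X)\<close> for all small \<open>X\<close>; it is meaningful only for \<open>f\<close> analytic at \<open>t\<close>.
\<close>

definition hyperderiv :: "nat \<Rightarrow> ('c::nonarch_field \<Rightarrow> 'c) \<Rightarrow> 'c \<Rightarrow> 'c" where
  "hyperderiv n f t =
     (THE a. \<exists>r>0. \<forall>x. vabs x < r \<longrightarrow> (\<lambda>k. a k * x ^ k) sums f (t + x)) n"

text \<open>
  Multi-indices \<open>(e\<^sub>1, \<dots>, e\<^sub>d)\<close> are functions \<open>nat \<Rightarrow> nat\<close> vanishing outside \<open>{1..d}\<close>, with the
  pointwise order of the library, for which \<open><\<close> is \<open>\<le>\<close> and \<open>\<noteq>\<close>.  Functions below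
  \<open>const_index d c\<close> automatically vanish outside \<open>{1..d}\<close>.
\<close>

definition const_index :: "nat \<Rightarrow> nat \<Rightarrow> nat \<Rightarrow> nat" where
  "const_index d c = (\<lambda>i. if i \<in> {1..d} then c else 0)"

definition omega_pow ::
  "('a::{field,finite} fls alg_closure \<Rightarrow> 'c::nonarch_field) \<Rightarrow> 'c \<Rightarrow> 'c \<Rightarrow> nat \<Rightarrow> nat
     \<Rightarrow> (nat \<Rightarrow> nat) \<Rightarrow> 'c" where
  "omega_pow \<iota> lam \<zeta> d n e =
     (\<Prod>i\<in>{1..d}. hyperderiv n (omega \<iota> lam) (\<zeta> ^ (CARD('a) ^ (i - 1))) ^ e i)"

end

(*
  Let k = F_q(zeta) = F_(q^d) and let omega^(n)(zeta_i) denote the hyperderivatives of omega at the roots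
  zeta_i of p. The functional equation omega^(tau)(t) = (t - theta) omega(t) gives
    omega^(n)(zeta_i)^q = (zeta_(i+1) - theta) omega^(n)(zeta_(i+1)) + omega^(n-1)(zeta_(i+1)),
  so the span of the asserted basis over the previous ring is closed under multiplication.

  In a valuation ring of C_infinity containing k[theta] in which theta - zeta_i is not a unit, this
  relation determines the values of all omega^(n)(zeta_j): up to units they are powers of a single element,
  and the exponents of the basis monomials are the numbers with base-q digits e_1, ..., e_d (in an order
  depending on i). Distinct monomials therefore have distinct values, all less than the value of
  theta - zeta_i, which yields linear independence and integral closedness at theta - zeta_i. At a prime g
  of k[theta] different from all theta - zeta_i, the relation shows that y^q in gB implies y in gB,
  which yields integral closedness at g.

  Finally, theta acts on the traces sum_i b^(q^(i-1)) omega^(n)(zeta_i), b in k, as b |-> zeta b plus a shift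
  of n. Hence they are torsion points, and by counting they give all the torsion points.
*)
theory Submission
  imports Defs
begin

section \<open>Subrings and multi-indexed spans\<close>

text \<open>The ambient field's own absolute value is the one at infinity, so it says nothing about
  the primes \<theta> - \<zeta>_i. Chevalley's theorem supplies valuation rings at these primes,
  perhaps with a non-discrete value group; comparison up to units is enough, since all the values
  that occur are powers of one element. The spans are studied as rings \<open>B n\<close> in their
  own right and are compared with \<open>A\<^sub>n[\<zeta>]\<close> only at the end. One inclusion
  holds because \<open>B n\<close> is integrally closed and its fractions contain the torsion; the
  other because Lagrange interpolation at the distinct \<zeta>_i recovers each
  \<omega>^(n)(\<zeta>_i) from traces, which are torsion points. The top exponent is missing at the
  bottom layer because multiplying the relations for n = 0 over all i gives prod
  \<omega>(\<zeta>_i)^(q-1) = prod (\<zeta>_i - \<theta>), an element of A[\<zeta>]. The power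
  series of \<omega> is built from successive Artin-Schreier equations, so that the functional
  equation holds by construction; the infinite product is recovered afterwards from the Frobenius
  twists of the series.\<close>

lemma is_subringI:
  assumes "0 \<in> R" "1 \<in> R" "\<And>x y. x \<in> R \<Longrightarrow> y \<in> R \<Longrightarrow> x + y \<in> R"
    "\<And>x y. x \<in> R \<Longrightarrow> y \<in> R \<Longrightarrow> x * y \<in> R" "\<And>x. x \<in> R \<Longrightarrow> - x \<in> R"
  shows "is_subring R"
  using assms by (auto simp: is_subring_def)

lemma
  assumes "is_subring R"
  shows subring_0: "0 \<in> R" and subring_1: "1 \<in> R"
    and subring_add: "x \<in> R \<Longrightarrow> y \<in> R \<Longrightarrow> x + y \<in> R"
    and subring_mult: "x \<in> R \<Longrightarrow> y \<in> R \<Longrightarrow> x * y \<in> R"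
    and subring_uminus: "x \<in> R \<Longrightarrow> - x \<in> R"
  using assms by (auto simp: is_subring_def)

lemma subring_diff: "is_subring R \<Longrightarrow> x \<in> R \<Longrightarrow> y \<in> R \<Longrightarrow> x - y \<in> R"
  using subring_add[of R x "-y"] subring_uminus[of R y] by simp

lemma subring_power: "is_subring R \<Longrightarrow> x \<in> R \<Longrightarrow> x ^ n \<in> R"
  by (induction n) (auto simp: subring_1 subring_mult)

lemma subring_sum: "is_subring R \<Longrightarrow> (\<And>i. i \<in> I \<Longrightarrow> f i \<in> R) \<Longrightarrow> sum f I \<in> R"
  by (induction I rule: infinite_finite_induct) (auto simp: subring_0 subring_add)

lemma subring_prod: "is_subring R \<Longrightarrow> (\<And>i. i \<in> I \<Longrightarrow> f i \<in> R) \<Longrightarrow> prod f I \<in> R"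
  by (induction I rule: infinite_finite_induct) (auto simp: subring_1 subring_mult)

lemma subring_of_nat: "is_subring R \<Longrightarrow> of_nat n \<in> R"
  by (induction n) (auto simp: subring_0 subring_1 subring_add)

lemma subring_poly: "is_subring R \<Longrightarrow> (\<And>i. coeff p i \<in> R) \<Longrightarrow> x \<in> R \<Longrightarrow> poly p x \<in> R"
  unfolding poly_altdef by (intro subring_sum subring_mult subring_power)

lemma is_subring_hull: "is_subring (is_subring hull S)"
  by (rule hull_in) (auto simp: is_subring_def)

lemma is_subring_coeffs:
  assumes "is_subring k"
  shows "is_subring {poly p x |p. \<forall>i. coeff p i \<in> k}"
proof (rule is_subringI, unfold mem_Collect_eq, goal_cases)
  case 1 show ?case
    by (rule exI[of _ 0]) (auto simp: subring_0[OF assms])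
next
  case 2 show ?case
    by (rule exI[of _ 1]) (auto simp: coeff_1 subring_0[OF assms] subring_1[OF assms])
next
  case (3 y z)
  then obtain p p' where "y = poly p x" "z = poly p' x" "\<forall>i. coeff p i \<in> k" "\<forall>i. coeff p' i \<in> k"
    by blast
  then show ?case
    by (intro exI[of _ "p + p'"]) (auto simp: subring_add[OF assms])
next
  case (4 y z)
  then obtain p p' where "y = poly p x" "z = poly p' x" "\<forall>i. coeff p i \<in> k" "\<forall>i. coeff p' i \<in> k"
    by blast
  then show ?case
    by (intro exI[of _ "p * p'"])
      (auto simp: coeff_mult intro!: subring_sum[OF assms] subring_mult[OF assms])
next
  case (5 y)
  then obtain p where "y = poly p x" "\<forall>i. coeff p i \<in> k"
    by blast
  then show ?case
    by (intro exI[of _ "- p"]) (auto simp: subring_uminus[OF assms])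
qed

text \<open>Gaussian elimination by cross-multiplication instead of division, so that the
  coefficients stay in \<open>T\<close>.\<close>

lemma subring_linear_dependence:
  fixes a :: "'i \<Rightarrow> nat \<Rightarrow> 'f::idom"
  assumes T: "is_subring T" and "finite I" "card I > N" "\<And>i j. i \<in> I \<Longrightarrow> a i j \<in> T"
  shows "\<exists>c. (\<forall>i\<in>I. c i \<in> T) \<and> (\<exists>i\<in>I. c i \<noteq> 0) \<and> (\<forall>j<N. (\<Sum>i\<in>I. c i * a i j) = 0)"
  using assms(2-)
proof (induction N arbitrary: I a)
  case 0
  then have "I \<noteq> {}" by auto
  then obtain i where "i \<in> I" by blast
  then show ?case by (intro exI[of _ "\<lambda>_. 1"]) (auto simp: subring_1[OF T])
next
  case (Suc N)
  show ?case
  proof (cases "\<forall>i\<in>I. a i N = 0")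
    case True
    have "card I > N" using Suc.prems by simp
    then obtain c where
      c: "\<forall>i\<in>I. c i \<in> T" "\<exists>i\<in>I. c i \<noteq> 0" "\<forall>j<N. (\<Sum>i\<in>I. c i * a i j) = 0"
      using Suc.IH[of I a] Suc.prems by auto
    have "(\<Sum>i\<in>I. c i * a i j) = 0" if "j < Suc N" for j
      using that c(3) True by (cases "j = N") auto
    then show ?thesis using c by blast
  next
    case False
    then obtain i0 where i0: "i0 \<in> I" "a i0 N \<noteq> 0" by auto
    define b where "b i j = a i0 N * a i j - a i N * a i0 j" for i j
    have "card (I - {i0}) > N" using Suc.prems i0 by simp
    moreover have "b i j \<in> T" if "i \<in> I - {i0}" for i j
      unfolding b_def using that i0 Suc.prems
      by (intro subring_diff[OF T] subring_mult[OF T]) auto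
    ultimately obtain c where c: "\<forall>i\<in>I-{i0}. c i \<in> T" "\<exists>i\<in>I-{i0}. c i \<noteq> 0"
      "\<forall>j<N. (\<Sum>i\<in>I-{i0}. c i * b i j) = 0"
      using Suc.IH[of "I - {i0}" b] Suc.prems(1) by auto
    \<comment> \<open>Undoes the elimination: the other coefficients are scaled by the pivot entry,
      and the coefficient of the pivot row balances them in column \<open>N\<close>.\<close>
    define c' where "c' i = (if i = i0 then - (\<Sum>i\<in>I-{i0}. c i * a i N) else a i0 N * c i)" for i
    have 1: "c' i \<in> T" if "i \<in> I" for i
      unfolding c'_def using that i0 Suc.prems c(1)
      by (auto intro!: subring_uminus[OF T] subring_mult[OF T] subring_sum[OF T])
    have 2: "\<exists>i\<in>I. c' i \<noteq> 0" using c(2) i0 by (auto simp: c'_def)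
    have 3: "(\<Sum>i\<in>I. c' i * a i j) = (\<Sum>i\<in>I-{i0}. c i * b i j)" for j
    proof -
      have "(\<Sum>i\<in>I. c' i * a i j) = c' i0 * a i0 j + (\<Sum>i\<in>I-{i0}. c' i * a i j)"
        using i0 Suc.prems(1) by (simp add: sum.remove)
      also have "(\<Sum>i\<in>I-{i0}. c' i * a i j) = (\<Sum>i\<in>I-{i0}. a i0 N * c i * a i j)"
        by (rule sum.cong) (auto simp: c'_def)
      also have "c' i0 * a i0 j = - (\<Sum>i\<in>I-{i0}. c i * a i N * a i0 j)"
        by (simp add: c'_def sum_distrib_right)
      finally show ?thesis
        by (simp add: b_def sum_subtractf right_diff_distrib mult_ac)
    qed
    have "(\<Sum>i\<in>I-{i0}. c i * b i j) = 0" if "j < Suc N" for j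
      using that c(3) by (cases "j = N") (auto simp: b_def mult_ac)
    then show ?thesis using 1 2 3 by (intro exI[of _ c']) auto
  qed
qed

section \<open>Monomials in several elements and the modules they span\<close>

definition mpow :: "(nat \<Rightarrow> 'f::comm_ring_1) \<Rightarrow> nat \<Rightarrow> (nat \<Rightarrow> nat) \<Rightarrow> 'f" where
  "mpow Y d e = (\<Prod>i\<in>{1..d}. Y i ^ e i)"

definition mspan :: "'f::comm_ring_1 set \<Rightarrow> (nat \<Rightarrow> nat) set \<Rightarrow> (nat \<Rightarrow> 'f) \<Rightarrow> nat \<Rightarrow> 'f set" where
  "mspan T J Y d = {\<Sum>e\<in>J. t e * mpow Y d e |t. \<forall>e\<in>J. t e \<in> T}"

lemma mspanI: "(\<And>e. e \<in> J \<Longrightarrow> t e \<in> T) \<Longrightarrow> (\<Sum>e\<in>J. t e * mpow Y d e) \<in> mspan T J Y d"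
  by (auto simp: mspan_def)

lemma mspanE:
  assumes "y \<in> mspan T J Y d"
  obtains t where "\<And>e. e \<in> J \<Longrightarrow> t e \<in> T" "y = (\<Sum>e\<in>J. t e * mpow Y d e)"
  using assms by (auto simp: mspan_def)

lemma mspan_add:
  assumes "is_subring T" "x \<in> mspan T J Y d" "y \<in> mspan T J Y d"
  shows "x + y \<in> mspan T J Y d"
proof -
  obtain s t where s: "\<And>e. e \<in> J \<Longrightarrow> s e \<in> T" "x = (\<Sum>e\<in>J. s e * mpow Y d e)"
    and t: "\<And>e. e \<in> J \<Longrightarrow> t e \<in> T" "y = (\<Sum>e\<in>J. t e * mpow Y d e)"
    by (rule mspanE[OF assms(2)], rule mspanE[OF assms(3)]) blast
  have "x + y = (\<Sum>e\<in>J. (s e + t e) * mpow Y d e)"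
    by (simp add: s t sum.distrib distrib_right)
  also have "\<dots> \<in> mspan T J Y d"
    by (rule mspanI) (auto intro: subring_add assms s t)
  finally show ?thesis .
qed

lemma mspan_smult:
  assumes "is_subring T" "c \<in> T" "y \<in> mspan T J Y d"
  shows "c * y \<in> mspan T J Y d"
proof -
  obtain t where t: "\<And>e. e \<in> J \<Longrightarrow> t e \<in> T" "y = (\<Sum>e\<in>J. t e * mpow Y d e)"
    by (rule mspanE[OF assms(3)]) blast
  have "c * y = (\<Sum>e\<in>J. (c * t e) * mpow Y d e)"
    by (simp add: t sum_distrib_left mult_ac)
  also have "\<dots> \<in> mspan T J Y d"
    by (rule mspanI) (auto intro: subring_mult assms t)
  finally show ?thesis .
qed

lemma mspan_0: "is_subring T \<Longrightarrow> 0 \<in> mspan T J Y d"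
  using mspanI[of J "\<lambda>_. 0" T Y d] by (simp add: subring_0)

lemma mspan_sum: "is_subring T \<Longrightarrow> (\<And>i. i \<in> I \<Longrightarrow> f i \<in> mspan T J Y d) \<Longrightarrow> sum f I \<in> mspan T J Y d"
  by (induction I rule: infinite_finite_induct) (auto simp: mspan_0 mspan_add)

lemma mspan_mon: 
  assumes "is_subring T" "finite J" "e \<in> J"
  shows "mpow Y d e \<in> mspan T J Y d"
proof -
  have "(\<Sum>f\<in>J. (if f = e then 1 else 0) * mpow Y d f) = (\<Sum>f\<in>J. if f = e then mpow Y d f else 0)"
    by (intro sum.cong) auto
  also have "\<dots> = mpow Y d e" using assms by simp
  finally show ?thesis 
    using mspanI[of J "\<lambda>f. if f = e then 1 else 0" T Y d] assms by (auto simp: subring_0 subring_1)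
qed

lemma mpow_add: "mpow Y d (\<lambda>i. e i + f i) = mpow Y d e * mpow Y d f"
  by (simp add: mpow_def power_add prod.distrib)

lemma le_const_index: "e \<le> const_index d c \<longleftrightarrow> (\<forall>i. (i \<in> {1..d} \<longrightarrow> e i \<le> c) \<and> (i \<notin> {1..d} \<longrightarrow> e i = 0))"
  unfolding le_fun_def const_index_def by (metis le_zero_eq zero_le)

lemma finite_le_const_index: "finite {..const_index d c}"
proof (rule finite_subset)
  show "{..const_index d c} \<subseteq> {f. \<forall>i. (i \<in> {1..d} \<longrightarrow> f i \<in> {..c}) \<and> (i \<notin> {1..d} \<longrightarrow> f i = 0)}"
    by (auto simp: le_const_index)
  show "finite {f. \<forall>i. (i \<in> {1..d} \<longrightarrow> f i \<in> {..c}) \<and> (i \<notin> {1..d} \<longrightarrow> f i = (0::nat))}"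
    by (rule finite_set_of_finite_funs) auto
qed

section \<open>Valuation rings\<close>

locale val_ring =
  fixes V :: "'f::field set"
  assumes subring: "is_subring V" and total: "x \<in> V \<or> inverse x \<in> V"
begin

text \<open>The case \<open>x = 0\<close> is listed separately because \<open>inverse 0 = 0\<close>
  does lie in \<open>V\<close>.\<close>

definition max_ideal :: "'f set" where "max_ideal = {x \<in> V. x = 0 \<or> inverse x \<notin> V}"

text \<open>Plays the role of equality of valuations: the two elements differ by a unit of
  \<open>V\<close>. No value group is constructed.\<close>

definition val_eq :: "'f \<Rightarrow> 'f \<Rightarrow> bool" where
  "val_eq x y \<longleftrightarrow> x \<noteq> 0 \<and> y \<noteq> 0 \<and> x / y \<in> V \<and> y / x \<in> V"

lemmas V_closed = subring_0[OF subring] subring_1[OF subring] subring_add[OF subring]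
  subring_mult[OF subring] subring_uminus[OF subring] subring_diff[OF subring]
  subring_power[OF subring] subring_sum[OF subring]

lemma max_ideal_V: "x \<in> max_ideal \<Longrightarrow> x \<in> V"
  by (auto simp: max_ideal_def)

lemma zero_in_max: "0 \<in> max_ideal" and one_notin_max: "1 \<notin> max_ideal"
  by (auto simp: max_ideal_def V_closed)

lemma max_mult: assumes "x \<in> max_ideal" "y \<in> V" shows "x * y \<in> max_ideal"
proof (cases "x * y = 0")
  case False
  then have "inverse x = y * inverse (x * y)" by (auto simp: field_simps)
  then have "inverse (x * y) \<notin> V" using assms V_closed(4)[of y "inverse (x * y)"] False
    by (auto simp: max_ideal_def simp del: inverse_mult_distrib)
  then show ?thesis using assms by (auto simp: max_ideal_def V_closed)
qed (auto simp: zero_in_max)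

lemma max_mult2: assumes "x \<in> max_ideal" "y \<in> V" shows "y * x \<in> max_ideal"
  using max_mult[OF assms] by (simp add: mult.commute)

lemma max_add_aux:
  assumes "x \<in> max_ideal" "y \<in> max_ideal" "y \<noteq> 0" "x / y \<in> V"
  shows "x + y \<in> max_ideal"
proof -
  have "x + y = y * (x / y + 1)" using assms by (simp add: field_simps)
  then show ?thesis using max_mult[OF assms(2)] assms(4) by (simp add: V_closed)
qed

lemma max_add: assumes "x \<in> max_ideal" "y \<in> max_ideal" shows "x + y \<in> max_ideal"
proof (cases "x = 0 \<or> y = 0")
  case False
  then show ?thesis using total[of "x / y"] max_add_aux[of x y] max_add_aux[of y x] assms
    by (auto simp: add.commute)
qed (use assms in auto)

lemma max_uminus: "x \<in> max_ideal \<Longrightarrow> - x \<in> max_ideal"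
  using max_mult[of x "-1"] by (simp add: V_closed)

lemma max_sum: "(\<And>i. i \<in> I \<Longrightarrow> f i \<in> max_ideal) \<Longrightarrow> sum f I \<in> max_ideal"
  by (induction I rule: infinite_finite_induct) (auto simp: zero_in_max max_add)

lemma max_power: "x \<in> max_ideal \<Longrightarrow> n > 0 \<Longrightarrow> x ^ n \<in> max_ideal"
  by (cases n) (auto simp: max_mult V_closed max_ideal_V)

text \<open>An \<open>x\<close> outside \<open>V\<close> would have its inverse in \<open>V\<close>,
  and \<open>x = x ^ n * inverse x ^ (n - 1)\<close> would bring it back. The exponent 0 is excluded
  because 1 is a unit.\<close>

lemma max_rootD: assumes "x ^ n \<in> max_ideal" shows "x \<in> max_ideal"
proof -
  have "x \<in> V"
  proof (rule ccontr)
    assume x: "x \<notin> V"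
    then have "inverse x \<in> V" "n > 0" using total[of x] assms one_notin_max by (cases n; auto)+
    moreover have "x \<noteq> 0" using x V_closed by auto
    ultimately have "x = x ^ n * inverse x ^ (n - 1)" 
      by (cases n) (auto simp: field_simps)
    then show False using x assms \<open>inverse x \<in> V\<close> by (metis V_closed(4,7) max_ideal_V)
  qed
  moreover have "inverse x \<notin> V" if "x \<noteq> 0"
  proof
    assume "inverse x \<in> V"
    then have "inverse (x ^ n) \<in> V" by (simp add: V_closed flip: power_inverse)
    then show False using assms that by (auto simp: max_ideal_def)
  qed
  ultimately show ?thesis by (auto simp: max_ideal_def)
qed

lemma val_eq_refl: "x \<noteq> 0 \<Longrightarrow> val_eq x x" by (auto simp: val_eq_def V_closed)
lemma val_eq_sym: "val_eq x y \<Longrightarrow> val_eq y x" by (auto simp: val_eq_def)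

lemma val_eq_mult: "val_eq x y \<Longrightarrow> val_eq x' y' \<Longrightarrow> val_eq (x * x') (y * y')"
  using V_closed(4)[of "x / y" "x' / y'"] V_closed(4)[of "y / x" "y' / x'"] by (auto simp: val_eq_def)

lemma val_eq_trans[trans]: "val_eq x y \<Longrightarrow> val_eq y z \<Longrightarrow> val_eq x z"
  using V_closed(4)[of "x / y" "y / z"] V_closed(4)[of "z / y" "y / x"] by (auto simp: val_eq_def)

lemma val_eq_power: "val_eq x y \<Longrightarrow> val_eq (x ^ n) (y ^ n)"
  by (induction n) (auto simp: val_eq_refl val_eq_mult)

lemma val_eq_prod: 
  assumes "finite I" "\<And>i. i \<in> I \<Longrightarrow> val_eq (f i) (g i)"
  shows "val_eq (prod f I) (prod g I)"
  using assms by (induction I rule: finite_induct) (auto simp: val_eq_refl val_eq_mult)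

lemma val_eq_unit: assumes "x \<in> V" "x \<notin> max_ideal" shows "val_eq x 1"
  using assms by (auto simp: val_eq_def max_ideal_def inverse_eq_divide)

text \<open>A summand of strictly larger value is negligible: \<open>1 + y / x\<close> is a
  unit.\<close>

lemma val_eq_add: assumes "x \<noteq> 0" "y / x \<in> max_ideal" shows "val_eq (x + y) x"
proof -
  have *: "1 + y / x \<in> V" using assms max_ideal_V by (auto simp: V_closed)
  have "1 + y / x \<notin> max_ideal"
    using assms max_add[of "1 + y / x" "- (y / x)"] max_uminus[of "y / x"] one_notin_max by auto
  from val_eq_mult[OF val_eq_unit[OF * this] val_eq_refl[OF assms(1)]]
  show ?thesis using assms by (simp add: distrib_right)
qed

lemma val_eq_max: "val_eq x y \<Longrightarrow> y \<in> max_ideal \<Longrightarrow> x \<in> max_ideal"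
  using max_mult[of y "x / y"] by (auto simp: val_eq_def)

lemma val_eq_div: "val_eq x y \<Longrightarrow> z \<noteq> 0 \<Longrightarrow> val_eq (x / z) (y / z)"
  using val_eq_mult[of x y "inverse z" "inverse z"] val_eq_refl[of "inverse z"]
  by (simp add: field_simps)

lemma div_power_max:
  assumes "w \<in> max_ideal" "w \<noteq> 0" "val_eq x (w ^ a)" "a > b" shows "x / w ^ b \<in> max_ideal"
proof -
  have "w ^ a / w ^ b = w ^ (a - b)" using assms by (simp add: power_diff)
  then have "w ^ a / w ^ b \<in> max_ideal" using assms max_power[of w "a - b"] by simp
  moreover have "val_eq (x / w ^ b) (w ^ a / w ^ b)"
    using assms by (intro val_eq_div) auto
  ultimately show ?thesis using val_eq_max by blast
qed

text \<open>Were \<open>x\<close> outside \<open>V\<close>, dividing its equation by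
  \<open>x ^ n\<close> would write -1 as a combination of positive powers of the non-unit
  \<open>inverse x\<close>.\<close>

lemma integral_in_V:
  assumes "lead_coeff p = 1" "\<And>i. coeff p i \<in> V" "poly p x = 0"
  shows "x \<in> V"
proof (rule ccontr)
  assume x: "x \<notin> V"
  define n where "n = degree p"
  have x0: "x \<noteq> 0" and ix: "inverse x \<in> V" using x total[of x] V_closed by auto
  have im: "inverse x \<in> max_ideal" using x ix by (auto simp: max_ideal_def)
  have "poly p x = (\<Sum>i\<le>n. coeff p i * x ^ i)" by (simp add: poly_altdef n_def)
  also have "\<dots> = (\<Sum>i<n. coeff p i * x ^ i) + x ^ n"
    using assms(1) by (simp add: n_def flip: lessThan_Suc_atMost)
  finally have "(\<Sum>i<n. coeff p i * x ^ i) / x ^ n = - 1" 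
    using assms(3) x0 by (simp add: field_simps eq_neg_iff_add_eq_0)
  moreover have "(\<Sum>i<n. coeff p i * x ^ i) / x ^ n = (\<Sum>i<n. coeff p i * inverse x ^ (n - i))"
    unfolding sum_divide_distrib using x0
    by (intro sum.cong) (auto simp: power_diff field_simps power_inverse)
  moreover have "(\<Sum>i<n. coeff p i * inverse x ^ (n - i)) \<in> max_ideal"
    by (intro max_sum max_mult2 max_power im assms) auto
  ultimately have "- 1 \<in> max_ideal" by simp
  then show False using max_uminus[of "-1"] one_notin_max by simp
qed

text \<open>The weights \<open>N * D + g e\<close> of the summands not divisible by \<open>p\<close> are distinct, so the
  summand of least weight determines the value of the sum.\<close>

lemma span_value:
  assumes T: "is_subring T" "T \<subseteq> V" and w: "w \<in> max_ideal" "w \<noteq> 0"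
    and v: "val_eq v (w ^ D)" and p: "val_eq p (v ^ M)"
    and val: "\<And>t. t \<in> T \<Longrightarrow> t \<in> (*) p ` T \<or> (\<exists>N<M. val_eq t (v ^ N))"
    and J: "finite J" "inj_on g J" "\<And>e. e \<in> J \<Longrightarrow> g e < D"
    and Y: "\<And>e. e \<in> J \<Longrightarrow> val_eq (Y e) (w ^ g e)"
    and t: "\<And>e. e \<in> J \<Longrightarrow> t e \<in> T" and ex: "\<exists>e\<in>J. t e \<notin> (*) p ` T"
  shows "\<exists>N<M * D. val_eq (\<Sum>e\<in>J. t e * Y e) (w ^ N)"
proof -
  \<comment> \<open>A summand whose coefficient is divisible by \<open>p\<close> has at least the
    value of \<open>p\<close>, that is weight \<open>M * D\<close>, which exceeds all the weights
    \<open>h e\<close>. Only \<open>J'\<close> can contain the dominant summand.\<close>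
  define J' where "J' = {e \<in> J. t e \<notin> (*) p ` T}"
  have "\<forall>e\<in>J'. \<exists>N<M. val_eq (t e) (v ^ N)" using val t by (auto simp: J'_def)
  then obtain N where N: "\<And>e. e \<in> J' \<Longrightarrow> N e < M \<and> val_eq (t e) (v ^ N e)" by metis
  define h where "h e = N e * D + g e" for e
  have hlt: "h e < M * D" if "e \<in> J'" for e
  proof -
    have "h e < (N e + 1) * D" using J(3)[of e] that by (auto simp: h_def J'_def)
    also have "\<dots> \<le> M * D" using N[OF that] by (intro mult_right_mono) auto
    finally show ?thesis .
  qed
  \<comment> \<open>Since \<open>g e < D\<close>, the remainder of \<open>h e\<close> modulo
    \<open>D\<close> is \<open>g e\<close>, so injectivity of \<open>g\<close> suffices.\<close>
  have inj: "e = e'" if "e \<in> J'" "e' \<in> J'" "h e = h e'" for e e'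
  proof -
    have "g e = h e mod D" "g e' = h e' mod D"
      using J(3)[of e] J(3)[of e'] that(1,2) by (simp_all add: h_def J'_def)
    then show ?thesis using that J(2) by (auto simp: inj_on_def J'_def)
  qed
  have tX: "val_eq (t e * Y e) (w ^ h e)" if "e \<in> J'" for e
  proof -
    have "val_eq (t e) (w ^ (N e * D))"
      using N[OF that] val_eq_trans[OF _ val_eq_power[OF v, of "N e"]] 
      by (auto simp: power_mult[symmetric] mult.commute)
    from val_eq_mult[OF this Y[of e]] that show ?thesis by (auto simp: h_def power_add J'_def)
  qed
  have "finite J'" "J' \<noteq> {}" using J ex by (auto simp: J'_def)
  then obtain e0 where e0: "e0 \<in> J'" "\<And>e. e \<in> J' \<Longrightarrow> h e0 \<le> h e"
    using ex_is_arg_min_if_finite[of J' h] by (auto simp: is_arg_min_def not_less)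
  have pw: "val_eq p (w ^ (M * D))"
    using val_eq_trans[OF p val_eq_power[OF v]] by (simp add: power_mult[symmetric] mult.commute)
  have rest: "(t e * Y e) / w ^ h e0 \<in> max_ideal" if e: "e \<in> J - {e0}" for e
  proof (cases "e \<in> J'")
    case True
    then have "h e0 < h e" using e0 inj[of e e0] that by force
    then show ?thesis using div_power_max[OF w tX[OF True]] by simp
  next
    case False
    then obtain s where s: "s \<in> T" "t e = p * s" using e by (auto simp: J'_def)
    have "Y e \<in> V" using val_eq_mult[OF Y[of e] val_eq_refl[of 1]] that w(1)[THEN max_ideal_V]
      V_closed(4)[of "Y e / w ^ g e" "w ^ g e"] w Y[of e] by (auto simp: val_eq_def V_closed)
    then have "p / w ^ h e0 * (s * Y e) \<in> max_ideal"
      using div_power_max[OF w pw hlt[OF e0(1)]] s T by (intro max_mult) (auto simp: V_closed)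
    then show ?thesis using s by (simp add: field_simps)
  qed
  define y where "y = (\<Sum>e\<in>J-{e0}. t e * Y e)"
  have eq: "(\<Sum>e\<in>J. t e * Y e) = t e0 * Y e0 + y"
    using J e0 by (auto simp: y_def J'_def sum.remove)
  have "y / w ^ h e0 \<in> max_ideal" unfolding y_def sum_divide_distrib by (rule max_sum) (rule rest)
  moreover have tx0: "t e0 * Y e0 \<noteq> 0" "w ^ h e0 / (t e0 * Y e0) \<in> V"
    using tX[OF e0(1)] by (auto simp: val_eq_def)
  ultimately have "y / w ^ h e0 * (w ^ h e0 / (t e0 * Y e0)) \<in> max_ideal"
    by (intro max_mult)
  then have "y / (t e0 * Y e0) \<in> max_ideal" using w(2) by simp
  from val_eq_trans[OF val_eq_add[OF tx0(1) this] tX[OF e0(1)]] show ?thesis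
    using hlt[OF e0(1)] eq by auto
qed

end

text \<open>A subring that is maximal among those in which \<open>p\<close> is not invertible is a valuation ring.\<close>

lemma chevalley_reduce:
  fixes x :: "'f::field"
  assumes V: "is_subring V" and u: "\<And>a. a \<in> V \<Longrightarrow> inverse (1 - p * a) \<in> V \<and> 1 - p * a \<noteq> 0"
    and p: "p \<in> V" and "x \<noteq> 0" "n > 0"
    and a: "\<And>i. a i \<in> V" "p * (\<Sum>i\<le>n. a i * x ^ i) = 1"
    and b: "\<And>i. b i \<in> V" "p * (\<Sum>i\<le>n. b i * inverse x ^ i) = 1"
  shows "\<exists>c. (\<forall>i. c i \<in> V) \<and> p * (\<Sum>i\<le>n - 1. c i * x ^ i) = 1"
proof -
  define w where "w = inverse (1 - p * b 0)"
  have w: "w \<in> V" "w * (1 - p * b 0) = 1" using u[OF b(1)[of 0]] by (auto simp: w_def)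
  \<comment> \<open>The relation for \<open>inverse x\<close>, multiplied by \<open>x ^ n\<close>,
    expresses \<open>x ^ n\<close> by lower powers, because \<open>1 - p * b 0\<close> is a
    unit.\<close>
  have "x ^ n = p * (\<Sum>i\<le>n. b i * (inverse x ^ i * x ^ n))"
    using b(2) by (simp flip: mult.assoc sum_distrib_right)
  also have "(\<Sum>i\<le>n. b i * (inverse x ^ i * x ^ n)) = (\<Sum>i\<le>n. b i * x ^ (n - i))"
    using \<open>x \<noteq> 0\<close> by (intro sum.cong) (auto simp: power_diff field_simps power_inverse)
  also have "\<dots> = (\<Sum>i\<le>n. b (n - i) * x ^ i)"
    by (rule sum.reindex_bij_witness[of _ "\<lambda>i. n - i" "\<lambda>i. n - i"]) auto
  also have "\<dots> = (\<Sum>i<n. b (n - i) * x ^ i) + b 0 * x ^ n"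
    by (simp flip: lessThan_Suc_atMost)
  finally have "(1 - p * b 0) * x ^ n = p * (\<Sum>i<n. b (n - i) * x ^ i)"
    by (simp add: algebra_simps)
  then have "w * (1 - p * b 0) * x ^ n = w * p * (\<Sum>i<n. b (n - i) * x ^ i)"
    by (simp add: mult.assoc)
  then have xn: "x ^ n = w * p * (\<Sum>i<n. b (n - i) * x ^ i)" by (simp add: w(2))
  \<comment> \<open>Inserting this expression for \<open>x ^ n\<close> removes the leading term of
    the relation for \<open>x\<close>.\<close>
  define c where "c i = a i + a n * w * p * b (n - i)" for i
  have "(\<Sum>i\<le>n - 1. c i * x ^ i) = (\<Sum>i<n. c i * x ^ i)"
    using \<open>n > 0\<close> by (intro sum.cong) auto
  also have "\<dots> = (\<Sum>i<n. a i * x ^ i) + a n * (w * p * (\<Sum>i<n. b (n - i) * x ^ i))"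
    by (simp add: c_def distrib_right distrib_left sum.distrib sum_distrib_left mult_ac)
  also have "\<dots> = (\<Sum>i\<le>n. a i * x ^ i)"
    unfolding xn[symmetric] by (simp flip: lessThan_Suc_atMost)
  finally have "p * (\<Sum>i\<le>n - 1. c i * x ^ i) = 1" using a(2) by simp
  moreover have "c i \<in> V" for i
    unfolding c_def by (intro subring_add[OF V] subring_mult[OF V] a b w p)
  ultimately show ?thesis by blast
qed

text \<open>Zorn's lemma provides the maximal ring. Maximality is used twice: localizing at the
  elements \<open>1 - p * a\<close> adds nothing, and adjoining any element outside \<open>V\<close>
  makes \<open>p\<close> invertible.\<close>

lemma chevalley:
  fixes R :: "'f::field set"
  assumes R: "is_subring R" and p: "p \<in> R" and nu: "\<And>s. s \<in> R \<Longrightarrow> p * s \<noteq> 1"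
  obtains V where "val_ring V" "R \<subseteq> V" "p \<in> val_ring.max_ideal V"
proof -
  define \<A> where "\<A> = {S. is_subring S \<and> R \<subseteq> S \<and> (\<forall>s\<in>S. p * s \<noteq> 1)}"
  have "\<exists>V\<in>\<A>. \<forall>S\<in>\<A>. V \<subseteq> S \<longrightarrow> S = V"
  proof (rule subset_Zorn_nonempty)
    show "\<A> \<noteq> {}" using R nu by (auto simp: \<A>_def)
    fix C assume C: "C \<noteq> {}" "subset.chain \<A> C"
    then have CA: "C \<subseteq> \<A>" by (auto simp: subset.chain_def)
    have ch: "\<exists>S\<in>C. x \<in> S \<and> y \<in> S" if xy: "x \<in> \<Union>C" "y \<in> \<Union>C" for x y
    proof -
      obtain A B where "A \<in> C" "x \<in> A" "B \<in> C" "y \<in> B" using xy by blast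
      moreover from this have "A \<subseteq> B \<or> B \<subseteq> A" using C(2) by (auto simp: subset_chain_def)
      ultimately show ?thesis by blast
    qed
    have "is_subring (\<Union>C)"
    proof (rule is_subringI)
      show "0 \<in> \<Union>C" "1 \<in> \<Union>C" using C(1) CA by (auto simp: \<A>_def is_subring_def)
      show "x + y \<in> \<Union>C" "x * y \<in> \<Union>C" if xy: "x \<in> \<Union>C" "y \<in> \<Union>C" for x y
      proof -
        obtain S where S: "S \<in> C" "x \<in> S" "y \<in> S" using ch[OF xy] by blast
        then have "is_subring S" using CA by (auto simp: \<A>_def)
        then have "x + y \<in> S" "x * y \<in> S" using S by (auto simp: is_subring_def)
        then show "x + y \<in> \<Union>C" "x * y \<in> \<Union>C" using S by blast+
      qed
      show "- x \<in> \<Union>C" if x: "x \<in> \<Union>C" for x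
      proof -
        obtain S where S: "S \<in> C" "x \<in> S" using x by blast
        then have "is_subring S" using CA by (auto simp: \<A>_def)
        then show ?thesis using S subring_uminus by blast
      qed
    qed
    then show "\<Union>C \<in> \<A>" using C(1) CA by (fastforce simp: \<A>_def)
  qed
  then obtain V where V: "is_subring V" "R \<subseteq> V" "\<And>s. s \<in> V \<Longrightarrow> p * s \<noteq> 1"
    and mx: "\<And>S. is_subring S \<Longrightarrow> V \<subseteq> S \<Longrightarrow> (\<And>s. s \<in> S \<Longrightarrow> p * s \<noteq> 1) \<Longrightarrow> S = V"
    by (auto simp: \<A>_def)
  have pV: "p \<in> V" using p V by auto
  note cl = subring_add[OF V(1)] subring_mult[OF V(1)] subring_diff[OF V(1)] subring_0[OF V(1)]
    subring_1[OF V(1)] subring_uminus[OF V(1)]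
  have nz: "1 - p * a \<noteq> 0" if "a \<in> V" for a using V(3)[OF that] by auto
  have unit: "inverse (1 - p * a) \<in> V" if a: "a \<in> V" for a
  proof -
    \<comment> \<open>The localization of \<open>V\<close> at the elements \<open>1 - p * b\<close>.
      An inverse of \<open>p\<close> in \<open>S\<close> would give one in \<open>V\<close>, so
      \<open>S = V\<close> by maximality.\<close>
    define S where "S = {x / (1 - p * b) |x b. x \<in> V \<and> b \<in> V}"
    have comb: "(1 - p * b) * (1 - p * b') = 1 - p * (b + b' - p * b * b')" for b b'
      by (simp add: algebra_simps)
    have combV: "b + b' - p * b * b' \<in> V" if "b \<in> V" "b' \<in> V" for b b'
      using that pV by (intro cl)
    have SI: "x / (1 - p * b) \<in> S" if "x \<in> V" "b \<in> V" for x b using that by (auto simp: S_def)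
    have VS: "x \<in> S" if "x \<in> V" for x using SI[OF that cl(4)] by simp
    have "is_subring S"
    proof (rule is_subringI)
      show "0 \<in> S" "1 \<in> S" using VS cl by auto
      fix x y assume "x \<in> S" "y \<in> S"
      then obtain s b s' b' where s: "s \<in> V" "b \<in> V" "s' \<in> V" "b' \<in> V"
        "x = s / (1 - p * b)" "y = s' / (1 - p * b')" unfolding S_def by blast
      have "x + y = (s * (1 - p * b') + s' * (1 - p * b)) / (1 - p * (b + b' - p * b * b'))"
        unfolding comb[symmetric] s(5,6) using nz s by (simp add: divide_simps)
      moreover have "s * (1 - p * b') + s' * (1 - p * b) \<in> V" using s pV by (intro cl)
      ultimately show "x + y \<in> S" using SI[OF _ combV[OF s(2,4)]] by metis
      have "x * y = (s * s') / (1 - p * (b + b' - p * b * b'))"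
        unfolding comb[symmetric] s(5,6) by simp
      moreover have "s * s' \<in> V" using s by (intro cl)
      ultimately show "x * y \<in> S" using SI[OF _ combV[OF s(2,4)]] by metis
    next
      fix x assume "x \<in> S"
      then obtain s b where s: "s \<in> V" "b \<in> V" "x = s / (1 - p * b)" unfolding S_def by blast
      then have "- x = (- s) / (1 - p * b)" by simp
      then show "- x \<in> S" using SI[of "- s" b] s cl by simp
    qed
    moreover have "V \<subseteq> S" using VS by blast
    moreover have "p * s \<noteq> 1" if s: "s \<in> S" for s
    proof
      assume ps: "p * s = 1"
      obtain x b where xb: "x \<in> V" "b \<in> V" "s = x / (1 - p * b)" using s by (auto simp: S_def)
      then have "p * (x + b) = 1" using ps nz[of b] by (simp add: field_simps)
      then show False using V(3)[of "x + b"] xb cl by auto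
    qed
    ultimately have "S = V" by (rule mx)
    moreover have "inverse (1 - p * a) \<in> S" using SI[OF cl(5) a] by (simp add: inverse_eq_divide)
    ultimately show ?thesis by simp
  qed
  \<comment> \<open>Invertibility of \<open>p\<close> in V[x], with an inverse of degree at most
    \<open>n\<close>.\<close>
  define E where "E x n \<longleftrightarrow> (\<exists>a. (\<forall>i. a i \<in> V) \<and> p * (\<Sum>i\<le>n. a i * x ^ i) = 1)" for x n
  have E_mono: "E x m" if "E x n" "n \<le> m" for x n m
  proof -
    obtain a where a: "\<And>i. a i \<in> V" "p * (\<Sum>i\<le>n. a i * x ^ i) = 1" using \<open>E x n\<close> by (auto simp: E_def)
    define b where "b i = (if i \<le> n then a i else 0)" for i
    have "(\<Sum>i\<le>m. b i * x ^ i) = (\<Sum>i\<le>n. a i * x ^ i)"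
      using \<open>n \<le> m\<close> by (intro sum.mono_neutral_cong_right) (auto simp: b_def)
    then show ?thesis unfolding E_def using a cl by (intro exI[of _ b]) (auto simp: b_def)
  qed
  have adj: "\<exists>n. E x n" if "x \<notin> V" for x
  proof (rule ccontr)
    assume nE: "\<nexists>n. E x n"
    define S where "S = {poly f x |f. \<forall>i. coeff f i \<in> V}"
    have "p * s \<noteq> 1" if "s \<in> S" for s
      using that nE by (auto simp: S_def E_def poly_altdef)
    moreover have "V \<subseteq> S" 
    proof
      fix y assume "y \<in> V"
      then show "y \<in> S" unfolding S_def by (auto intro!: exI[of _ "[:y:]"] simp: coeff_pCons cl split: nat.split)
    qed
    ultimately have "S = V" using mx is_subring_coeffs[OF V(1)] unfolding S_def by blast
    moreover have "x \<in> S" unfolding S_def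
      by (auto intro!: exI[of _ "[:0, 1:]"] simp: coeff_pCons cl split: nat.split)
    ultimately show False using that by simp
  qed
  interpret val_ring V
  proof
    show "is_subring V" by fact
    fix x
    show "x \<in> V \<or> inverse x \<in> V"
    proof (rule ccontr)
      assume "\<not> ?thesis"
      then have x: "x \<notin> V" "inverse x \<notin> V" by auto
      then have x0: "x \<noteq> 0" using cl by auto
      obtain n1 n2 where "E x n1" "E (inverse x) n2" using adj x by blast
      \<comment> \<open>A common degree bound for \<open>x\<close> and \<open>inverse x\<close>,
        taken minimal below: \<open>chevalley_reduce\<close>, applied once in each direction, lowers
        both degrees simultaneously.\<close>
      then have "\<exists>n. E x n \<and> E (inverse x) n" 
        using E_mono[of x n1 "max n1 n2"] E_mono[of "inverse x" n2 "max n1 n2"] by auto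
      then obtain n where n: "E x n" "E (inverse x) n"
        and mn: "\<And>m. m < n \<Longrightarrow> \<not> (E x m \<and> E (inverse x) m)"
        unfolding exists_least_iff[of "\<lambda>n. E x n \<and> E (inverse x) n"] by blast
      have "n \<noteq> 0"
      proof
        assume "n = 0"
        then have "\<exists>a\<in>V. p * a = 1" using n(1) by (auto simp: E_def)
        then show False using V(3) by blast
      qed
      then have "n > 0" by simp
      from n obtain a b where a: "\<And>i. a i \<in> V" "p * (\<Sum>i\<le>n. a i * x ^ i) = 1"
        and b: "\<And>i. b i \<in> V" "p * (\<Sum>i\<le>n. b i * inverse x ^ i) = 1" by (auto simp: E_def)
      have "E x (n - 1)" unfolding E_def
        by (rule chevalley_reduce[OF V(1) _ pV x0 \<open>n > 0\<close> a b]) (use unit nz in auto)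
      moreover have "E (inverse x) (n - 1)" unfolding E_def
        by (rule chevalley_reduce[OF V(1) _ pV _ \<open>n > 0\<close> b, of a]) (use unit nz a x0 in auto)
      ultimately show False using mn[of "n - 1"] \<open>n > 0\<close> by auto
    qed
  qed
  have "inverse p \<notin> V" if "p \<noteq> 0" using V(3)[of "inverse p"] that by auto
  then have "p \<in> max_ideal" using pV by (auto simp: max_ideal_def)
  then show ?thesis using that val_ring_axioms V(2) by auto
qed

section \<open>Analysis in non-archimedean fields\<close>

lemma dist_eq_vabs: "dist x y = vabs (x - y)" for x y :: "'c::nonarch_field"
  using dist_add_right_eq[of x "- y" y] by (simp add: vabs_def)

lemma vabs_0 [simp]: "vabs 0 = 0"
  by (simp add: vabs_def)

lemma vabs_eq_0 [simp]: "vabs x = 0 \<longleftrightarrow> x = 0"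
  by (simp add: vabs_def)

lemma vabs_nonneg [simp]: "vabs x \<ge> 0"
  by (simp add: vabs_def)

lemma vabs_pos [simp]: "vabs x > 0 \<longleftrightarrow> x \<noteq> 0"
  by (simp add: vabs_def)

lemma vabs_mult: "vabs (x * y) = vabs x * vabs y"
  by (simp add: vabs_def dist_mult_zero)

lemma vabs_1 [simp]: "vabs (1 :: 'c::nonarch_field) = 1"
  using vabs_mult[of "1::'c" 1] by simp

lemma vabs_minus [simp]: "vabs (- x) = vabs (x :: 'c::nonarch_field)"
  using dist_eq_vabs[of 0 x] by (simp add: vabs_def dist_commute)

lemma vabs_diff_commute: "vabs (x - y) = vabs (y - x :: 'c::nonarch_field)"
  using vabs_minus[of "x - y"] by simp

lemma vabs_add: "vabs (x + y) \<le> max (vabs x) (vabs (y :: 'c::nonarch_field))"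
  using dist_ultrametric[of x "-y" 0] dist_eq_vabs[of x "-y"] by (simp add: dist_eq_vabs max.commute)

lemma vabs_add_le: "vabs x \<le> b \<Longrightarrow> vabs y \<le> b \<Longrightarrow> vabs (x + y :: 'c::nonarch_field) \<le> b"
  using vabs_add[of x y] by simp

lemma vabs_add_eq: "vabs y < vabs x \<Longrightarrow> vabs (x + y :: 'c::nonarch_field) = vabs x"
  using vabs_add[of x y] vabs_add[of "x + y" "-y"] by (auto simp: max_def split: if_splits)

lemma vabs_power: "vabs (x ^ n) = vabs (x :: 'c::nonarch_field) ^ n"
  by (induction n) (auto simp: vabs_mult)

lemma vabs_inverse: "vabs (inverse x) = inverse (vabs (x :: 'c::nonarch_field))"
  using vabs_mult[of x "inverse x"] by (cases "x = 0") (auto simp: field_simps)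

lemma vabs_divide: "vabs (x / y) = vabs x / vabs (y :: 'c::nonarch_field)"
  by (simp add: divide_inverse vabs_mult vabs_inverse)

lemma vabs_sum_le:
  "b \<ge> 0 \<Longrightarrow> (\<And>i. i \<in> I \<Longrightarrow> vabs (f i :: 'c::nonarch_field) \<le> b) \<Longrightarrow> vabs (sum f I) \<le> b"
  by (induction I rule: infinite_finite_induct) (auto intro: vabs_add_le)

lemma vabs_of_nat_le: "vabs (of_nat n :: 'c::nonarch_field) \<le> 1"
  by (induction n) (auto intro: vabs_add_le)

lemma tendsto_vabs_iff: "(f \<longlongrightarrow> (l :: 'c::nonarch_field)) F \<longleftrightarrow> ((\<lambda>x. vabs (f x - l)) \<longlongrightarrow> 0) F"
  by (simp add: tendsto_dist_iff[of f] dist_eq_vabs)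

lemma vabs_add_sum: "vabs (x + y :: 'c::nonarch_field) \<le> vabs x + vabs y"
  using vabs_add[of x y] by (smt (verit) vabs_nonneg)

lemma vabs_squeeze:
  assumes "\<And>x. vabs (f x - (l :: 'c::nonarch_field)) \<le> g x" "(g \<longlongrightarrow> 0) F"
  shows "(f \<longlongrightarrow> l) F"
  unfolding tendsto_vabs_iff[of f]
proof (rule tendsto_sandwich[OF _ _ tendsto_const assms(2)])
  show "\<forall>\<^sub>F x in F. 0 \<le> vabs (f x - l)" by simp
  show "\<forall>\<^sub>F x in F. vabs (f x - l) \<le> g x" by (rule always_eventually) (simp add: assms(1))
qed

lemma nonarch_tendsto_add:
  fixes f g :: "'b \<Rightarrow> 'c::nonarch_field"
  assumes "(f \<longlongrightarrow> a) F" "(g \<longlongrightarrow> b) F"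
  shows "((\<lambda>x. f x + g x) \<longlongrightarrow> a + b) F"
proof -
  have "((\<lambda>x. vabs (f x - a) + vabs (g x - b)) \<longlongrightarrow> 0 + 0) F"
    using assms unfolding tendsto_vabs_iff[of f] tendsto_vabs_iff[of g] by (rule tendsto_add)
  moreover have "vabs ((f x + g x) - (a + b)) \<le> vabs (f x - a) + vabs (g x - b)" for x
    using vabs_add_sum[of "f x - a" "g x - b"] by (simp add: algebra_simps)
  ultimately show ?thesis by (intro vabs_squeeze) auto
qed

lemma nonarch_tendsto_mult:
  fixes f g :: "'b \<Rightarrow> 'c::nonarch_field"
  assumes "(f \<longlongrightarrow> a) F" "(g \<longlongrightarrow> b) F"
  shows "((\<lambda>x. f x * g x) \<longlongrightarrow> a * b) F"
proof -
  have le: "vabs (f x * g x - a * b) \<le> vabs (f x - a) * vabs (g x - b) + vabs a * vabs (g x - b) + vabs b * vabs (f x - a)" for x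
  proof -
    have "f x * g x - a * b = ((f x - a) * (g x - b) + a * (g x - b)) + b * (f x - a)"
      by (simp add: algebra_simps)
    then show ?thesis
      using vabs_add_sum[of "(f x - a) * (g x - b) + a * (g x - b)" "b * (f x - a)"]
        vabs_add_sum[of "(f x - a) * (g x - b)" "a * (g x - b)"] by (simp add: vabs_mult)
  qed
  have "((\<lambda>x. vabs (f x - a) * vabs (g x - b) + vabs a * vabs (g x - b) + vabs b * vabs (f x - a))
      \<longlongrightarrow> 0 * 0 + vabs a * 0 + vabs b * 0) F"
    using assms unfolding tendsto_vabs_iff[of f] tendsto_vabs_iff[of g] by (intro tendsto_intros)
  then show ?thesis using vabs_squeeze[OF le] by simp
qed

text \<open>These instances make general limit rules such as \<open>tendsto_diff\<close> and
  \<open>sums_add\<close> applicable.\<close>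

instance nonarch_field \<subseteq> topological_group_add
proof
  fix a b :: 'a
  show "LIM x (nhds a \<times>\<^sub>F nhds b). fst x + snd x :> nhds (a + b)"
    by (intro nonarch_tendsto_add filterlim_fst filterlim_snd)
  show "(uminus \<longlongrightarrow> - a) (nhds a)"
    using filterlim_ident[of "nhds a"] unfolding tendsto_vabs_iff[of uminus] tendsto_vabs_iff[of "\<lambda>x. x"]
    by (simp add: vabs_diff_commute)
qed

instance nonarch_field \<subseteq> topological_comm_monoid_add ..
instance nonarch_field \<subseteq> topological_ab_group_add ..

instance nonarch_field \<subseteq> topological_semigroup_mult
proof
  fix a b :: 'a
  show "LIM x (nhds a \<times>\<^sub>F nhds b). fst x * snd x :> nhds (a * b)"
    by (intro nonarch_tendsto_mult filterlim_fst filterlim_snd)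
qed

lemma nonarch_tendsto_power:
  fixes f :: "'b \<Rightarrow> 'c::nonarch_field"
  shows "(f \<longlongrightarrow> a) F \<Longrightarrow> ((\<lambda>x. f x ^ n) \<longlongrightarrow> a ^ n) F"
  by (induction n) (auto intro: nonarch_tendsto_mult)

lemma nonarch_sums_mult: "f sums s \<Longrightarrow> (\<lambda>n. c * f n) sums (c * s :: 'c::nonarch_field)"
  unfolding sums_def sum_distrib_left[symmetric] by (rule nonarch_tendsto_mult[OF tendsto_const])

lemma nonarch_sums_diff:
  "f sums a \<Longrightarrow> g sums b \<Longrightarrow> (\<lambda>n. f n - g n) sums (a - b :: 'c::nonarch_field)"
  unfolding sums_def by (simp add: sum_subtractf tendsto_diff)

lemma nonarch_sums_shift:
  fixes f :: "nat \<Rightarrow> 'c::nonarch_field"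
  assumes "f sums s"
  shows "(\<lambda>i. f (i + n)) sums (s - sum f {..<n})"
proof -
  have *: "(\<Sum>i<m. f (i + n)) = sum f {..<m + n} - sum f {..<n}" for m
    by (induction m) auto
  have "(\<lambda>m. sum f {..<m + n}) \<longlonglongrightarrow> s"
    using assms unfolding sums_def by (rule LIMSEQ_ignore_initial_segment)
  then show ?thesis unfolding sums_def * by (intro tendsto_diff tendsto_const)
qed

lemma nonarch_sums_terms_tendsto_0:
  fixes f :: "nat \<Rightarrow> 'c::nonarch_field"
  assumes "f sums s"
  shows "f \<longlonglongrightarrow> 0"
proof -
  have s: "(\<lambda>n. sum f {..<n}) \<longlonglongrightarrow> s" using assms by (simp add: sums_def)
  from tendsto_diff[OF LIMSEQ_Suc[OF s] s] show ?thesis by simp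
qed

lemma nonarch_tendsto_inverse:
  fixes f :: "nat \<Rightarrow> 'c::nonarch_field"
  assumes "f \<longlonglongrightarrow> a" "a \<noteq> 0"
  shows "(\<lambda>n. inverse (f n)) \<longlonglongrightarrow> inverse a"
proof -
  have t: "(\<lambda>n. vabs (f n - a)) \<longlonglongrightarrow> 0" using assms tendsto_vabs_iff[of f] by simp
  then have "\<forall>\<^sub>F n in sequentially. vabs (f n - a) < vabs a"
    using assms(2) by (intro order_tendstoD) auto
  then have "\<forall>\<^sub>F n in sequentially. vabs (inverse (f n) - inverse a) = vabs (f n - a) / (vabs a * vabs a)"
  proof eventually_elim
    case (elim n)
    then have fn: "vabs (f n) = vabs a" using vabs_add_eq[of "f n - a" a] by simp
    then have "f n \<noteq> 0" using assms(2) by (metis vabs_eq_0)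
    then have "inverse (f n) - inverse a = (a - f n) / (f n * a)"
      using assms(2) by (simp add: field_simps)
    then show ?case by (simp add: vabs_divide vabs_mult fn vabs_diff_commute)
  qed
  moreover have "(\<lambda>n. vabs (f n - a) / (vabs a * vabs a)) \<longlonglongrightarrow> 0 / (vabs a * vabs a)"
    using assms t by (intro tendsto_intros) auto
  ultimately show ?thesis
    unfolding tendsto_vabs_iff[of "\<lambda>n. inverse (f n)"] by (simp add: filterlim_cong)
qed

lemma vabs_partial_sum_le:
  assumes "b \<ge> 0" "\<And>n. vabs (f n :: 'c::nonarch_field) \<le> b" "f sums s" 
  shows "vabs s \<le> b"
proof (rule field_le_epsilon)
  fix e :: real assume "e > 0"
  have "(\<lambda>n. sum f {..<n}) \<longlonglongrightarrow> s" using assms by (simp add: sums_def)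
  then have "(\<lambda>n. vabs (sum f {..<n} - s)) \<longlonglongrightarrow> 0" using tendsto_vabs_iff[of "\<lambda>n. sum f {..<n}"] by simp
  then have "\<forall>\<^sub>F n in sequentially. vabs (sum f {..<n} - s) < e" 
    using \<open>e > 0\<close> by (intro order_tendstoD) auto
  then obtain n where n: "vabs (sum f {..<n} - s) < e" by (auto simp: eventually_sequentially)
  have "vabs s = vabs (sum f {..<n} + - (sum f {..<n} - s))" by simp
  also have "\<dots> \<le> vabs (sum f {..<n}) + vabs (sum f {..<n} - s)" 
    using vabs_add_sum[of "sum f {..<n}" "- (sum f {..<n} - s)"] by (simp only: vabs_minus)
  also have "\<dots> \<le> b + e" using n assms by (intro add_mono vabs_sum_le) auto
  finally show "vabs s \<le> b + e" .
qed

lemma vabs_tail_le: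
  assumes "b \<ge> 0" "\<And>n. n \<ge> N \<Longrightarrow> vabs (f n :: 'c::nonarch_field) \<le> b" "f sums s"
  shows "vabs (s - sum f {..<N}) \<le> b"
proof (rule vabs_partial_sum_le)
  show "(\<lambda>i. f (i + N)) sums (s - sum f {..<N})" using assms(3) by (rule nonarch_sums_shift)
qed (use assms in auto)

text \<open>By the ultrametric inequality a block of terms is bounded by its largest term, so the
  partial sums are Cauchy once the terms tend to 0.\<close>

lemma nonarch_summable:
  fixes f :: "nat \<Rightarrow> 'c::{nonarch_field,complete_space}"
  assumes "f \<longlonglongrightarrow> 0"
  shows "summable f"
proof -
  have "Cauchy (\<lambda>n. sum f {..<n})"
  proof (rule metric_CauchyI)
    fix e :: real assume e: "e > 0"
    have "(\<lambda>n. vabs (f n)) \<longlonglongrightarrow> 0" using assms tendsto_vabs_iff[of f] by simp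
    then have "\<forall>\<^sub>F n in sequentially. vabs (f n) < e / 2" using e by (intro order_tendstoD) auto
    then obtain N where N: "\<And>n. n \<ge> N \<Longrightarrow> vabs (f n) < e / 2" by (auto simp: eventually_sequentially)
    have *: "vabs (sum f {..<n} - sum f {..<m}) < e" if "N \<le> m" "m \<le> n" for m n
    proof -
      have "sum f {..<n} - sum f {..<m} = sum f {m..<n}"
        using that by (simp add: sum_diff_nat_ivl atLeast0LessThan[symmetric])
      also have "vabs \<dots> \<le> e / 2" using that N e by (intro vabs_sum_le) (auto intro: less_imp_le)
      finally show ?thesis using e by simp
    qed
    show "\<exists>M. \<forall>m\<ge>M. \<forall>n\<ge>M. dist (sum f {..<m}) (sum f {..<n}) < e"
    proof (intro exI[of _ N] allI impI)
      fix m n assume "m \<ge> N" "n \<ge> N"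
      then show "dist (sum f {..<m}) (sum f {..<n}) < e"
        using *[of m n] *[of n m] by (cases "m \<le> n") (auto simp: dist_eq_vabs vabs_diff_commute)
    qed
  qed
  then show ?thesis unfolding summable_iff_convergent by (rule Cauchy_convergent)
qed

lemma nonarch_summable_geometric:
  fixes f :: "nat \<Rightarrow> 'c::{nonarch_field,complete_space}"
  assumes "\<And>n. vabs (f n) \<le> C * r ^ n" "0 \<le> r" "r < 1"
  shows "summable f"
proof (rule nonarch_summable)
  have "(\<lambda>n. C * r ^ n) \<longlonglongrightarrow> C * 0" using assms by (intro tendsto_intros LIMSEQ_realpow_zero)
  then show "f \<longlonglongrightarrow> 0" using assms(1) by (intro vabs_squeeze[of f 0]) simp_all
qed

text \<open>If \<open>d k\<close> is the first nonzero coefficient, then \<open>\<bar>d k\<bar>\<close> is bounded by a multiple of \<open>\<bar>x\<bar>\<close> for all small \<open>x\<close>.\<close>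

lemma power_series_zero:
  fixes d :: "nat \<Rightarrow> 'c::nonarch_field"
  assumes r: "r > 0" and th: "vabs (\<theta> :: 'c) > 1"
    and z: "\<And>x. vabs x < r \<Longrightarrow> (\<lambda>k. d k * x ^ k) sums 0"
  shows "d = (\<lambda>_. 0)"
proof (rule ccontr)
  assume "d \<noteq> (\<lambda>_. 0)"
  then have "\<exists>k. d k \<noteq> 0" by auto
  then obtain k where k: "d k \<noteq> 0" "\<And>i. i < k \<Longrightarrow> d i = 0"
    unfolding exists_least_iff[of "\<lambda>k. d k \<noteq> 0"] by blast
  have th0: "\<theta> \<noteq> 0" using th by auto
  have lim: "(\<lambda>n. inverse (vabs \<theta>) ^ n) \<longlonglongrightarrow> 0" using th
    by (intro LIMSEQ_realpow_zero) (auto simp: inverse_less_1_iff)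
  then have "\<forall>\<^sub>F n in sequentially. inverse (vabs \<theta>) ^ n < r" using r by (intro order_tendstoD)
  then obtain n0 where n0: "inverse (vabs \<theta>) ^ n0 < r" by (auto simp: eventually_sequentially)
  \<comment> \<open>A nonzero point of the disc of convergence; the boundedness of the terms at
    \<open>x0\<close> gives the constant \<open>C\<close>.\<close>
  define x0 where "x0 = inverse \<theta> ^ n0"
  have x0: "x0 \<noteq> 0" "vabs x0 < r" using n0 th0 by (auto simp: x0_def vabs_power vabs_inverse)
  define y where "y n = inverse \<theta> ^ n" for n
  have vy: "vabs (y n) = inverse (vabs \<theta>) ^ n" for n by (simp add: y_def vabs_power vabs_inverse)
  have ylt: "vabs (y n) \<le> 1" "y n \<noteq> 0" for n 
    unfolding vy using th th0 by (auto simp: y_def intro!: power_le_one simp: inverse_le_1_iff)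
  have shift: "(\<lambda>i. d (i + k) * x ^ i) sums 0" if "vabs x < r" "x \<noteq> 0" for x
  proof -
    have "(\<lambda>i. d (i + k) * x ^ (i + k)) sums (0 - (\<Sum>i<k. d i * x ^ i))"
      by (rule nonarch_sums_shift[OF z[OF that(1)]])
    also have "0 - (\<Sum>i<k. d i * x ^ i) = 0" using k by simp
    finally have "(\<lambda>i. inverse (x ^ k) * (d (i + k) * x ^ (i + k))) sums (inverse (x ^ k) * 0)"
      by (rule nonarch_sums_mult)
    then show ?thesis using that by (simp add: power_add field_simps)
  qed
  have "(\<lambda>i. d (i + k) * x0 ^ i) sums 0" using shift x0 by simp
  then have "(\<lambda>i. d (i + k) * x0 ^ i) \<longlonglongrightarrow> 0"
    by (rule nonarch_sums_terms_tendsto_0)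
  then have "Bseq (\<lambda>i. vabs (d (i + k) * x0 ^ i))"
    by (intro convergent_imp_Bseq convergentI[of _ 0]) (simp add: tendsto_vabs_iff[of "\<lambda>i. d (i + k) * x0 ^ i"])
  then obtain C where C: "C > 0" "\<And>i. vabs (d (i + k) * x0 ^ i) \<le> C" by (auto simp: Bseq_def)
  \<comment> \<open>Replacing \<open>x0\<close> by \<open>x0 * y n\<close> gains at least one factor
    \<open>vabs (y n)\<close> in every term but the constant one, and the whole sum is 0.\<close>
  have le: "vabs (d k) \<le> C * inverse (vabs \<theta>) ^ n" for n
  proof -
    let ?x = "x0 * y n"
    have "vabs ?x \<le> vabs x0 * 1" unfolding vabs_mult using ylt by (intro mult_left_mono) auto
    then have "(\<lambda>i. d (i + k) * ?x ^ i) sums 0" using x0 ylt by (intro shift) auto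
    then have "vabs (0 - (\<Sum>i<1. d (i + k) * ?x ^ i)) \<le> C * vabs (y n)"
    proof (rule vabs_tail_le[rotated 2])
      fix i :: nat assume "i \<ge> 1"
      have "vabs (d (i + k) * ?x ^ i) = vabs (d (i + k) * x0 ^ i) * vabs (y n) ^ i"
        by (simp add: vabs_mult vabs_power power_mult_distrib)
      also have "\<dots> \<le> C * vabs (y n) ^ 1"
        using \<open>i \<ge> 1\<close> ylt C by (intro mult_mono power_decreasing) auto
      finally show "vabs (d (i + k) * ?x ^ i) \<le> C * vabs (y n)" by simp
    qed (use C in auto)
    then show ?thesis by (simp add: vy)
  qed
  have "(\<lambda>n. C * inverse (vabs \<theta>) ^ n) \<longlonglongrightarrow> C * 0" by (intro tendsto_intros lim)
  then have "vabs (d k) \<le> C * 0" by (rule LIMSEQ_le_const) (use le in auto)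
  then have "vabs (d k) = 0" using vabs_nonneg[of "d k"] by linarith
  then show False using k by simp
qed

text \<open>Uniqueness of the expansion rests on \<theta>: its inverse powers are nonzero points
  arbitrarily close to 0, without which a power series near 0 would not determine its
  coefficients.\<close>

lemma hyperderiv_eqI:
  fixes a :: "nat \<Rightarrow> 'c::nonarch_field"
  assumes th: "vabs (\<theta> :: 'c) > 1" and r: "r > 0"
    and a: "\<And>x. vabs x < r \<Longrightarrow> (\<lambda>k. a k * x ^ k) sums f (t + x)"
  shows "hyperderiv n f t = a n"
proof -
  have "(THE a. \<exists>r>0. \<forall>x. vabs x < r \<longrightarrow> (\<lambda>k. a k * x ^ k) sums f (t + x)) = a"
  proof (rule the_equality)
    show "\<exists>r>0. \<forall>x. vabs x < r \<longrightarrow> (\<lambda>k. a k * x ^ k) sums f (t + x)" using a r by blast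
    fix b assume "\<exists>r>0. \<forall>x. vabs x < r \<longrightarrow> (\<lambda>k. b k * x ^ k) sums f (t + x)"
    then obtain s where s: "s > 0" "\<And>x. vabs x < s \<Longrightarrow> (\<lambda>k. b k * x ^ k) sums f (t + x)" by auto
    have "(\<lambda>k. b k - a k) = (\<lambda>_. 0)"
    proof (rule power_series_zero[OF _ th])
      show "min r s > 0" using r s by simp
      fix x :: 'c assume "vabs x < min r s"
      then show "(\<lambda>k. (b k - a k) * x ^ k) sums 0"
        using nonarch_sums_diff[of _ "f (t + x)" _ "f (t + x)", OF s(2)[of x] a[of x]]
        by (simp add: left_diff_distrib)
    qed
    then show "b = a" by (auto simp: fun_eq_iff)
  qed
  then show ?thesis by (simp add: hyperderiv_def)
qed

section \<open>One step of the tower\<close>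

text \<open>Cyclic neighbours in {1..d}: the \<open>q\<close>-Frobenius sends \<zeta>_i to
  \<zeta>_(i+1) and \<zeta>_d to \<zeta>_1. Accordingly \<open>shift\<close> moves exponents when a
  monomial is raised to the power \<open>q\<close>.\<close>

definition prv :: "nat \<Rightarrow> nat \<Rightarrow> nat" where "prv d i = (if i = 1 then d else i - 1)"
definition nxt :: "nat \<Rightarrow> nat \<Rightarrow> nat" where "nxt d i = (if i = d then 1 else i + 1)"
definition shift :: "nat \<Rightarrow> (nat \<Rightarrow> nat) \<Rightarrow> nat \<Rightarrow> nat" where
  "shift d e = (\<lambda>i. if i \<in> {1..d} then e (prv d i) else 0)"

lemma prv_nxt: "i \<in> {1..d} \<Longrightarrow> prv d (nxt d i) = i" "i \<in> {1..d} \<Longrightarrow> nxt d (prv d i) = i"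
  "i \<in> {1..d} \<Longrightarrow> prv d i \<in> {1..d}" "i \<in> {1..d} \<Longrightarrow> nxt d i \<in> {1..d}"
  by (auto simp: prv_def nxt_def)

lemma prod_prv: "(\<Prod>i\<in>{1..d}. f (prv d i)) = (\<Prod>i\<in>{1..d}. f i)"
  by (rule prod.reindex_bij_witness[of _ "nxt d" "prv d"]) (auto simp: prv_def nxt_def split: if_splits)

lemma sum_prv: "(\<Sum>i\<in>{1..d}. f (prv d i)) = (\<Sum>i\<in>{1..d}. f i)"
  by (rule sum.reindex_bij_witness[of _ "nxt d" "prv d"]) (auto simp: prv_def nxt_def split: if_splits)

lemma sum_shift: "(\<Sum>i\<in>{1..d}. shift d e i) = (\<Sum>i\<in>{1..d}. e i)"
proof -
  have "(\<Sum>i\<in>{1..d}. shift d e i) = (\<Sum>i\<in>{1..d}. e (prv d i))"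
    by (intro sum.cong) (auto simp: shift_def)
  then show ?thesis by (simp only: sum_prv)
qed

lemma shift_const_index: "shift d (const_index d c) = const_index d c"
  using prv_nxt(3)[of _ d] by (auto simp: shift_def const_index_def fun_eq_iff)

lemma shift_mono: "e \<le> f \<Longrightarrow> shift d e \<le> shift d f"
  by (auto simp: shift_def le_fun_def)

lemma shift_inj:
  assumes "shift d e = shift d f" "\<And>i. i \<notin> {1..d} \<Longrightarrow> e i = 0" "\<And>i. i \<notin> {1..d} \<Longrightarrow> f i = 0"
  shows "e = f"
proof
  fix i
  show "e i = f i"
  proof (cases "i \<in> {1..d}")
    case True
    then have "shift d e (nxt d i) = e i" "shift d f (nxt d i) = f i" 
      using prv_nxt(1,4)[OF True] by (auto simp: shift_def)
    then show ?thesis using assms by simp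
  qed (use assms in auto)
qed

lemma mpow_plus:
  assumes "i \<in> {1..d}"
  shows "mpow Y d (e(i := e i + n)) = Y i ^ n * mpow Y d e"
proof -
  have "mpow Y d (e(i := e i + n)) = Y i ^ (e i + n) * (\<Prod>j\<in>{1..d}-{i}. Y j ^ e j)"
    unfolding mpow_def using assms by (subst prod.remove[of _ i]) (auto intro!: arg_cong2[of _ _ _ _ "(*)"] prod.cong)
  also have "\<dots> = Y i ^ n * mpow Y d e"
    unfolding mpow_def using assms by (subst (2) prod.remove[of _ i]) (auto simp: power_add mult_ac)
  finally show ?thesis .
qed

lemma sum_plus:
  assumes "i \<in> {1..d::nat}"
  shows "sum (e(i := e i + n)) {1..d} = sum e {1..d} + (n::nat)"
proof -
  have "sum (e(i := e i + n)) {1..d} = e i + n + (\<Sum>j\<in>{1..d}-{i}. e j)"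
    using assms by (subst sum.remove[of _ i]) (auto intro!: sum.cong)
  also have "\<dots> = sum e {1..d} + n"
    using assms by (subst (2) sum.remove[of _ i]) auto
  finally show ?thesis .
qed

lemma mpow_zero: "mpow Y d (\<lambda>_. 0) = 1"
  by (simp add: mpow_def)

lemma mspan_subset:
  assumes "is_subring S" "T \<subseteq> S" "\<And>i. i \<in> {1..d} \<Longrightarrow> Y i \<in> S"
  shows "mspan T J Y d \<subseteq> S"
proof
  fix y assume "y \<in> mspan T J Y d"
  then obtain t where "\<And>e. e \<in> J \<Longrightarrow> t e \<in> T" "y = (\<Sum>e\<in>J. t e * mpow Y d e)" by (rule mspanE) blast
  then show "y \<in> S" unfolding mpow_def using assms
    by (auto intro!: subring_sum subring_mult subring_prod subring_power)
qed

section \<open>Linear independence of monomials\<close>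

definition mindep :: "'f::comm_ring_1 set \<Rightarrow> (nat \<Rightarrow> nat) set \<Rightarrow> (nat \<Rightarrow> 'f) \<Rightarrow> nat \<Rightarrow> bool" where
  "mindep T J Y d \<longleftrightarrow>
    (\<forall>t. (\<forall>e\<in>J. t e \<in> T) \<longrightarrow> (\<Sum>e\<in>J. t e * mpow Y d e) = 0 \<longrightarrow> (\<forall>e\<in>J. t e = 0))"

lemma mindep_eq:
  assumes "mindep T J Y d" "is_subring T" "\<And>e. e \<in> J \<Longrightarrow> s e \<in> T" "\<And>e. e \<in> J \<Longrightarrow> t e \<in> T"
    "(\<Sum>e\<in>J. s e * mpow Y d e) = (\<Sum>e\<in>J. t e * mpow Y d e)" "e \<in> J"
  shows "s e = t e"
proof -
  have "(\<Sum>e\<in>J. (s e - t e) * mpow Y d e) = 0"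
    using assms(5) by (simp add: left_diff_distrib sum_subtractf)
  moreover have "\<forall>e\<in>J. s e - t e \<in> T" using assms by (auto intro: subring_diff)
  ultimately have "\<forall>e\<in>J. s e - t e = 0"
    using assms(1)[unfolded mindep_def, rule_format, of "\<lambda>e. s e - t e"] by blast
  then show ?thesis using assms(6) by simp
qed

text \<open>Infinite descent: all coefficients of a relation can be divided by \<open>p\<close>
  again and again, and only 0 is divisible by every power of \<open>p\<close>.\<close>

lemma mindepI_descent:
  fixes p :: "'f::idom"
  assumes "p \<noteq> 0"
    and sep: "\<And>t. t \<in> T \<Longrightarrow> (\<And>s. t \<in> (*) (p ^ s) ` T) \<Longrightarrow> t = 0"
    and div: "\<And>t. (\<And>e. e \<in> J \<Longrightarrow> t e \<in> T) \<Longrightarrow> (\<Sum>e\<in>J. t e * mpow Y d e) = 0 \<Longrightarrow> \<forall>e\<in>J. t e \<in> (*) p ` T"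
  shows "mindep T J Y d"
proof -
  have *: "\<forall>e\<in>J. t e \<in> (*) (p ^ s) ` T"
    if "\<forall>e\<in>J. t e \<in> T" "(\<Sum>e\<in>J. t e * mpow Y d e) = 0" for t s
    using that
  proof (induction s arbitrary: t)
    case 0
    then show ?case by auto
  next
    case (Suc s)
    then have "\<forall>e\<in>J. \<exists>r\<in>T. t e = p * r" using div[of t] by (auto simp: image_iff)
    then obtain r where r: "\<And>e. e \<in> J \<Longrightarrow> r e \<in> T \<and> t e = p * r e" by metis
    have "(\<Sum>e\<in>J. t e * mpow Y d e) = p * (\<Sum>e\<in>J. r e * mpow Y d e)"
      unfolding sum_distrib_left using r by (intro sum.cong) (auto simp: mult.assoc)
    then have "\<forall>e\<in>J. r e \<in> (*) (p ^ s) ` T" using Suc r \<open>p \<noteq> 0\<close> by auto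
    then show ?case using r by (fastforce simp: image_iff mult.assoc)
  qed
  show ?thesis unfolding mindep_def
  proof (intro allI impI ballI)
    fix t e assume t: "\<forall>e\<in>J. t e \<in> T" "(\<Sum>e\<in>J. t e * mpow Y d e) = 0" and e: "e \<in> J"
    show "t e = 0" using *[OF t] e t by (intro sep) auto
  qed
qed

text \<open>Carries the hypothesis of the descent to the next layer: by independence, divisibility
  of \<open>y\<close> by \<open>p ^ s\<close> is divisibility of each coefficient.\<close>

lemma mindep_sep:
  fixes p :: "'f::idom"
  assumes ind: "mindep T J Y d" and T: "is_subring T" "p \<in> T"
    and sep: "\<And>t. t \<in> T \<Longrightarrow> (\<And>s. t \<in> (*) (p ^ s) ` T) \<Longrightarrow> t = 0"
    and y: "y \<in> mspan T J Y d" "\<And>s. y \<in> (*) (p ^ s) ` mspan T J Y d"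
  shows "y = 0"
proof -
  obtain t where t: "\<And>e. e \<in> J \<Longrightarrow> t e \<in> T" "y = (\<Sum>e\<in>J. t e * mpow Y d e)"
    by (rule mspanE[OF y(1)]) blast
  have "t e \<in> (*) (p ^ s) ` T" if "e \<in> J" for e s
  proof -
    obtain z where z: "z \<in> mspan T J Y d" "y = p ^ s * z" using y(2)[of s] by auto
    obtain r where r: "\<And>e. e \<in> J \<Longrightarrow> r e \<in> T" "z = (\<Sum>e\<in>J. r e * mpow Y d e)"
      by (rule mspanE[OF z(1)]) blast
    have "(\<Sum>e\<in>J. t e * mpow Y d e) = (\<Sum>e\<in>J. (p ^ s * r e) * mpow Y d e)"
      using z t(2) r(2) by (simp add: sum_distrib_left mult.assoc)
    then have "t e = p ^ s * r e" using that t r T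
      by (intro mindep_eq[OF ind T(1), of t "\<lambda>e. p ^ s * r e"]) (auto intro: subring_mult subring_power)
    then show ?thesis using r that by auto
  qed
  then have "t e = 0" if "e \<in> J" for e using sep[of "t e"] that t by blast
  then show ?thesis using t by simp
qed

lemma prod_binomial_expand:
  fixes Y u l :: "nat \<Rightarrow> 'f::comm_ring_1"
  assumes h: "\<And>i. i \<notin> {1..d} \<Longrightarrow> h i = 0"
  shows "(\<Prod>i\<in>{1..d}. (u i * Y i + l i) ^ h i) =
    (\<Sum>f\<in>{..h}. (\<Prod>i\<in>{1..d}. of_nat (h i choose f i) * u i ^ f i * l i ^ (h i - f i)) * mpow Y d f)"
proof -
  have le: "f \<le> h \<longleftrightarrow> (\<forall>i. (i \<in> {1..d} \<longrightarrow> f i \<le> h i) \<and> (i \<notin> {1..d} \<longrightarrow> f i = 0))" for f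
    unfolding le_fun_def using h by (metis le_zero_eq order_refl)
  have "(\<Prod>i\<in>{1..d}. (u i * Y i + l i) ^ h i) =
    (\<Prod>i\<in>{1..d}. \<Sum>k\<in>{..h i}. of_nat (h i choose k) * u i ^ k * l i ^ (h i - k) * Y i ^ k)"
    by (simp add: binomial_ring power_mult_distrib mult_ac)
  also have "\<dots> = (\<Sum>f\<in>PiE {1..d} (\<lambda>i. {..h i}).
      \<Prod>i\<in>{1..d}. of_nat (h i choose f i) * u i ^ f i * l i ^ (h i - f i) * Y i ^ f i)"
    by (rule prod_sum_PiE) auto
  also have "\<dots> = (\<Sum>f\<in>{..h}.
      \<Prod>i\<in>{1..d}. of_nat (h i choose f i) * u i ^ f i * l i ^ (h i - f i) * Y i ^ f i)"
  proof (rule sum.reindex_bij_witness[of _ "\<lambda>f. restrict f {1..d}" "\<lambda>f i. if i \<in> {1..d} then f i else 0"])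
    fix f assume "f \<in> PiE {1..d} (\<lambda>i. {..h i})"
    then show "restrict (\<lambda>i. if i \<in> {1..d} then f i else 0) {1..d} = f"
      "(\<lambda>i. if i \<in> {1..d} then f i else 0) \<in> {..h}"
      by (auto simp: le PiE_def extensional_def restrict_def fun_eq_iff)
  next
    fix f assume "f \<in> {..h}"
    then show "(\<lambda>i. if i \<in> {1..d} then restrict f {1..d} i else 0) = f"
      "restrict f {1..d} \<in> PiE {1..d} (\<lambda>i. {..h i})"
      by (auto simp: le fun_eq_iff)
  qed (auto intro!: prod.cong)
  finally show ?thesis by (simp add: mpow_def prod.distrib)
qed

text \<open>One layer of the tower in the abstract: \<open>Y i\<close> stands for
  \<omega>^(n)(\<zeta>_i), \<open>u i\<close> for \<zeta>_i - \<theta> and \<open>l i\<close> for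
  \<omega>^(n-1)(\<zeta>_i), or 0 if n = 0. The second alternative for \<open>J\<close> is the
  bottom layer.\<close>

locale frob_step =
  fixes T :: "'f::field set" and Y u l :: "nat \<Rightarrow> 'f" and d q :: nat and J :: "(nat \<Rightarrow> nat) set"
  assumes T: "is_subring T" and q: "q \<ge> 2" and d: "d \<ge> 1"
    and frob: "\<And>x y :: 'f. (x + y) ^ q = x ^ q + y ^ q"
    and uT: "\<And>i. i \<in> {1..d} \<Longrightarrow> u i \<in> T" and lT: "\<And>i. i \<in> {1..d} \<Longrightarrow> l i \<in> T"
    and rel: "\<And>i. i \<in> {1..d} \<Longrightarrow> Y (prv d i) ^ q = u i * Y i + l i"
    and J: "J = {..const_index d (q - 1)} \<or>
      (J = {..<const_index d (q - 1)} \<and> mpow Y d (const_index d (q - 1)) \<in> T)"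
begin

abbreviation "T' \<equiv> mspan T J Y d"

lemma J_le: "J \<subseteq> {..const_index d (q - 1)}" and J_finite: "finite J"
proof -
  show *: "J \<subseteq> {..const_index d (q - 1)}" using J by auto
  then show "finite J" using finite_le_const_index finite_subset by blast
qed

lemma J_supp: "e \<in> J \<Longrightarrow> i \<notin> {1..d} \<Longrightarrow> e i = 0"
  using J_le le_const_index[of e d "q - 1"] by auto

lemma J_down: "e \<in> J \<Longrightarrow> f \<le> e \<Longrightarrow> f \<in> J"
  using J by auto

lemma J_shift: assumes "e \<in> J" shows "shift d e \<in> J"
proof -
  have le: "e \<le> const_index d (q - 1)" using assms J_le by auto
  then have "shift d e \<le> const_index d (q - 1)"
    using shift_mono[OF le, of d] shift_const_index[of d "q - 1"] by simp
  moreover have "e = const_index d (q - 1)" if "shift d e = const_index d (q - 1)"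
    by (rule shift_inj[of d]) (use that J_supp[OF assms] in \<open>auto simp: shift_const_index\<close>, auto simp: const_index_def)
  ultimately show ?thesis using J assms by (auto simp: less_le)
qed

lemma zero_J: "(\<lambda>_. 0) \<in> J"
proof -
  have "(\<lambda>_. 0) \<noteq> const_index d (q - 1)" 
    using q d by (auto simp: const_index_def fun_eq_iff intro!: exI[of _ 1])
  moreover have "(\<lambda>_. 0) \<le> const_index d (q - 1)" by (auto simp: le_fun_def)
  ultimately show ?thesis using J by (auto simp: less_le)
qed

lemma T_sub: "T \<subseteq> T'"
proof
  fix t assume "t \<in> T"
  from mspan_smult[OF T this mspan_mon[OF T J_finite zero_J, of Y d]] 
  show "t \<in> T'" by (simp add: mpow_zero)
qed

text \<open>Rewriting \<open>Y i ^ q\<close> by the relation lowers the total degree by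
  \<open>q - 1\<close> or \<open>q\<close>, so all exponents eventually fall below
  \<open>q\<close>.\<close>

lemma mpow_in_span:
  assumes "\<And>i. i \<notin> {1..d} \<Longrightarrow> e i = 0"
  shows "mpow Y d e \<in> T'"
  using assms
proof (induction "sum e {1..d}" arbitrary: e rule: less_induct)
  case less
  consider "e \<in> J" | i where "i \<in> {1..d}" "e i \<ge> q" | "e \<notin> J" "\<And>i. i \<in> {1..d} \<Longrightarrow> e i \<le> q - 1"
    by (metis Suc_diff_1 d le_less_trans not_less_eq_eq not_less zero_le q diff_Suc_1 Suc_le_D)
  then show ?case
  proof cases
    case 1
    then show ?thesis by (rule mspan_mon[OF T J_finite])
  next
    case (2 i)
    define j where "j = nxt d i"
    have j: "j \<in> {1..d}" "prv d j = i" using 2 prv_nxt by (auto simp: j_def simp del: atLeastAtMost_iff)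
    define e' where "e' = e(i := e i - q)"
    have e: "e = e'(i := e' i + q)" using 2 by (auto simp: e'_def)
    have s: "sum e {1..d} = sum e' {1..d} + q" unfolding e by (rule sum_plus) (use 2 in auto)
    have supp: "e' k = 0" if "k \<notin> {1..d}" for k using less.prems[OF that] that 2 by (auto simp: e'_def)
    have "mpow Y d e = Y i ^ q * mpow Y d e'" by (subst e, rule mpow_plus) (use 2 in auto)
    also have "Y i ^ q = u j * Y j + l j" using rel[OF j(1)] j(2) by simp
    also have "(u j * Y j + l j) * mpow Y d e' = u j * mpow Y d (e'(j := e' j + 1)) + l j * mpow Y d e'"
      using mpow_plus[OF j(1), of Y e' 1] by (simp add: algebra_simps)
    also have "\<dots> \<in> T'"
    proof (intro mspan_add[OF T] mspan_smult[OF T] uT lT j)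
      show "mpow Y d (e'(j := e' j + 1)) \<in> T'"
        by (rule less.hyps) (use s q sum_plus[OF j(1), of e' 1] supp j in auto)
      show "mpow Y d e' \<in> T'"
        by (rule less.hyps) (use s q supp in auto)
    qed
    finally show ?thesis .
  next
    \<comment> \<open>The top exponent is the only one in the box that can be missing from
      \<open>J\<close>, and then its monomial lies in \<open>T\<close>.\<close>
    case 3
    then have "e \<le> const_index d (q - 1)" using less.prems by (auto simp: le_const_index)
    then have "e = const_index d (q - 1)" "mpow Y d (const_index d (q - 1)) \<in> T"
      using J 3 by (auto simp: less_le)
    then show ?thesis using T_sub by auto
  qed
qed

lemma subring_T': "is_subring T'"
proof (rule is_subringI)
  show "0 \<in> T'" by (rule mspan_0[OF T])
  show "1 \<in> T'" using T_sub subring_1[OF T] by auto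
  show "x + y \<in> T'" if "x \<in> T'" "y \<in> T'" for x y using mspan_add[OF T that] .
  show "- x \<in> T'" if "x \<in> T'" for x
    using mspan_smult[OF T _ that, of "-1"] subring_uminus[OF T subring_1[OF T]] by simp
  fix x y assume x: "x \<in> T'" and y: "y \<in> T'"
  obtain s where s: "\<And>e. e \<in> J \<Longrightarrow> s e \<in> T" "x = (\<Sum>e\<in>J. s e * mpow Y d e)"
    by (rule mspanE[OF x]) blast
  obtain t where t: "\<And>e. e \<in> J \<Longrightarrow> t e \<in> T" "y = (\<Sum>e\<in>J. t e * mpow Y d e)"
    by (rule mspanE[OF y]) blast
  have "x * y = (\<Sum>e\<in>J. \<Sum>f\<in>J. (s e * t f) * mpow Y d (\<lambda>i. e i + f i))"
    unfolding s(2) t(2) sum_product by (simp add: mpow_add mult_ac)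
  also have "\<dots> \<in> T'"
    using J_supp by (intro mspan_sum[OF T] mspan_smult[OF T] subring_mult[OF T] s t mpow_in_span) auto
  finally show "x * y \<in> T'" .
qed

lemma Y_in_T': assumes "i \<in> {1..d}" shows "Y i \<in> T'"
proof -
  have "mpow Y d ((\<lambda>_. 0)(i := 0 + 1)) = Y i ^ 1 * mpow Y d (\<lambda>_. 0)"
    by (rule mpow_plus) (use assms in auto)
  moreover have "mpow Y d ((\<lambda>_. 0)(i := 0 + 1)) \<in> T'"
    by (rule mpow_in_span) (use assms in auto)
  ultimately show ?thesis by (simp add: mpow_zero)
qed

text \<open>The powers of \<open>y\<close> up to \<open>card J\<close> are linearly dependent over
  \<open>T\<close>. After cancelling the lowest occurring power of \<open>y\<close>, the constant
  term of the relation is a nonzero multiple of \<open>y\<close> in \<open>T\<close>. This yields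
  inverses in the fraction field.\<close>

lemma norm_exists:
  assumes y: "y \<in> T'" "y \<noteq> 0"
  shows "\<exists>z\<in>T'. y * z \<in> T \<and> y * z \<noteq> 0"
proof -
  have "\<forall>i. \<exists>t. (\<forall>e\<in>J. t e \<in> T) \<and> y ^ i = (\<Sum>e\<in>J. t e * mpow Y d e)"
    using subring_power[OF subring_T' y(1)] by (metis mspanE)
  then obtain a where a: "\<And>i e. e \<in> J \<Longrightarrow> a i e \<in> T" "\<And>i. y ^ i = (\<Sum>e\<in>J. a i e * mpow Y d e)" by metis
  obtain b where b: "bij_betw b {..<card J} J"
    using J_finite by (metis atLeast0LessThan ex_bij_betw_nat_finite)
  have bJ: "b j \<in> J" if "j < card J" for j using b that by (auto simp: bij_betw_def)
  define a' where "a' i j = (if j < card J then a i (b j) else 0)" for i j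
  have "\<exists>c. (\<forall>i\<in>{..card J}. c i \<in> T) \<and> (\<exists>i\<in>{..card J}. c i \<noteq> 0) \<and>
      (\<forall>j<card J. (\<Sum>i\<in>{..card J}. c i * a' i j) = 0)"
    using subring_0[OF T] bJ a(1) by (intro subring_linear_dependence[OF T]) (auto simp: a'_def)
  then obtain c where c: "\<And>i. i \<le> card J \<Longrightarrow> c i \<in> T" "\<exists>i\<le>card J. c i \<noteq> 0"
    "\<And>j. j < card J \<Longrightarrow> (\<Sum>i\<le>card J. c i * a i (b j)) = 0"
    by (auto simp: a'_def)
  have ce: "(\<Sum>i\<le>card J. c i * a i e) = 0" if "e \<in> J" for e
  proof -
    obtain j where "j < card J" "e = b j" using b \<open>e \<in> J\<close> by (auto simp: bij_betw_def)
    then show ?thesis using c(3) by simp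
  qed
  have "(\<Sum>i\<le>card J. c i * y ^ i) = (\<Sum>i\<le>card J. \<Sum>e\<in>J. c i * a i e * mpow Y d e)"
    unfolding a(2) by (simp add: sum_distrib_left mult.assoc)
  also have "\<dots> = (\<Sum>e\<in>J. (\<Sum>i\<le>card J. c i * a i e) * mpow Y d e)"
    unfolding sum_distrib_right by (rule sum.swap)
  also have "\<dots> = 0" using ce by simp
  finally have z: "(\<Sum>i\<le>card J. c i * y ^ i) = 0" .
  define m where "m = (LEAST i. i \<le> card J \<and> c i \<noteq> 0)"
  have m: "m \<le> card J" "c m \<noteq> 0" using LeastI_ex[OF c(2)[unfolded Bex_def]] c(2) 
    by (auto simp: m_def intro: LeastI2_ex)
  have lt: "c i = 0" if "i < m" for i 
    using not_less_Least[of i "\<lambda>i. i \<le> card J \<and> c i \<noteq> 0"] that m by (auto simp: m_def[symmetric])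
  define w where "w = (\<Sum>i\<in>{m<..card J}. c i * y ^ (i - m - 1))"
  have "(\<Sum>i\<le>card J. c i * y ^ i) = (\<Sum>i\<in>{m..card J}. c i * y ^ i)"
    using lt by (intro sum.mono_neutral_right) auto
  also have "\<dots> = c m * y ^ m + (\<Sum>i\<in>{m<..card J}. c i * y ^ i)"
    using m by (simp add: sum.head)
  also have "(\<Sum>i\<in>{m<..card J}. c i * y ^ i) = y ^ m * (y * w)"
    unfolding w_def sum_distrib_left
  proof (rule sum.cong)
    fix i assume "i \<in> {m<..card J}"
    then have "y ^ i = y ^ m * (y * y ^ (i - m - 1))" 
      by (simp flip: power_Suc power_add)
    then show "c i * y ^ i = y ^ m * (y * (c i * y ^ (i - m - 1)))" by simp
  qed simp
  also have "c m * y ^ m + y ^ m * (y * w) = y ^ m * (c m + y * w)" by (simp add: algebra_simps)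
  finally have "c m + y * w = 0" using z y by simp
  then have yw: "y * (- w) = c m" using eq_neg_iff_add_eq_0[of "c m" "y * w"] by simp
  have "- w \<in> T'" unfolding w_def using c(1) T_sub
    by (intro subring_uminus[OF subring_T'] subring_sum[OF subring_T'] subring_mult[OF subring_T']
        subring_power[OF subring_T'] y) auto
  then show ?thesis using yw m c(1) by metis
qed

lemma frob_sum:
  fixes f :: "'i \<Rightarrow> 'f"
  shows "sum f I ^ q = (\<Sum>i\<in>I. f i ^ q)"
proof -
  have "(0::'f) ^ q = 0" using q by (simp add: power_0_left)
  then show ?thesis by (induction I rule: infinite_finite_induct) (auto simp: frob)
qed

lemma mpow_frob: 
  shows "mpow Y d e ^ q = (\<Prod>i\<in>{1..d}. (u i * Y i + l i) ^ shift d e i)"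
proof -
  have "mpow Y d e ^ q = (\<Prod>i\<in>{1..d}. (Y i ^ q) ^ e i)"
    by (simp add: mpow_def prod_power_distrib power_mult[symmetric] mult.commute)
  also have "\<dots> = (\<Prod>i\<in>{1..d}. (Y (prv d i) ^ q) ^ e (prv d i))" by (rule prod_prv[symmetric])
  also have "\<dots> = (\<Prod>i\<in>{1..d}. (u i * Y i + l i) ^ shift d e i)"
    by (intro prod.cong) (auto simp: rel shift_def)
  finally show ?thesis .
qed

text \<open>Among the coefficients of \<open>y\<close> not divisible by \<open>g\<close> take one at an exponent \<open>e\<close> of maximal
  total degree: the coefficient of \<open>y ^ q\<close> at \<open>shift d e\<close> is its \<open>q\<close>-th power times a unit modulo \<open>g\<close>.\<close>

lemma root_divides:
  assumes ind: "mindep T J Y d" and g: "g \<in> T"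
    and unit: "\<And>i. i \<in> {1..d} \<Longrightarrow> \<exists>v\<in>T. \<exists>r\<in>T. u i * v = 1 + g * r"
    and IH: "\<And>t. t \<in> T \<Longrightarrow> t ^ q \<in> (*) g ` T \<Longrightarrow> t \<in> (*) g ` T"
    and y: "y \<in> T'" "y ^ q \<in> (*) g ` T'"
  shows "y \<in> (*) g ` T'"
proof -
  note cl = subring_0[OF T] subring_1[OF T] subring_add[OF T] subring_mult[OF T] subring_power[OF T]
    subring_prod[OF T] subring_sum[OF T] subring_of_nat[OF T] subring_diff[OF T]
  obtain t where t: "\<And>e. e \<in> J \<Longrightarrow> t e \<in> T" "y = (\<Sum>e\<in>J. t e * mpow Y d e)"
    by (rule mspanE[OF y(1)]) blast
  define J' where "J' = {e \<in> J. t e \<notin> (*) g ` T}"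
  have J'J: "J' \<subseteq> J" by (auto simp: J'_def)
  have "\<forall>e\<in>J-J'. \<exists>s\<in>T. t e = g * s" by (auto simp: J'_def)
  then obtain s where s: "\<And>e. e \<in> J - J' \<Longrightarrow> s e \<in> T \<and> t e = g * s e" by metis
  define z where "z = (\<Sum>e\<in>J. (if e \<in> J' then 0 else s e) * mpow Y d e)"
  have zT: "z \<in> T'" unfolding z_def using s cl by (intro mspanI) auto
  \<comment> \<open>By additivity of the Frobenius, the part \<open>g * z\<close> of
    \<open>y\<close> only contributes a multiple of \<open>g\<close> to \<open>y ^ q\<close> and can
    be discarded.\<close>
  define y' where "y' = (\<Sum>e\<in>J'. t e * mpow Y d e)"
  have "g * z = (\<Sum>e\<in>J-J'. t e * mpow Y d e)"
    unfolding z_def sum_distrib_left using J_finite s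
    by (intro sum.mono_neutral_cong_right) (auto simp: mult.assoc)
  then have yy: "y = y' + g * z" 
    unfolding t(2) y'_def using sum.subset_diff[OF J'J J_finite] by (simp add: add.commute)
  show ?thesis
  proof (cases "J' = {}")
    case True
    then show ?thesis using yy zT by (auto simp: y'_def)
  next
    case False
    have fJ': "finite J'" using J'J J_finite finite_subset by blast
    obtain w where w: "w \<in> T'" "y ^ q = g * w" using y(2) by auto
    have "y' ^ q = g * w - (g * z) ^ q" using frob[of y' "g * z"] yy w by (simp add: eq_diff_eq)
    also have "(g * z) ^ q = g * (g ^ (q - 1) * z ^ q)"
      using q by (simp add: power_mult_distrib flip: mult.assoc power_Suc)
    finally have "y' ^ q = g * (w - g ^ (q - 1) * z ^ q)" by (simp add: right_diff_distrib)
    moreover have "w - g ^ (q - 1) * z ^ q \<in> T'"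
      using g T_sub w zT by (intro subring_diff[OF subring_T'] subring_mult[OF subring_T'] subring_power[OF subring_T']) auto
    ultimately obtain r where r: "\<And>e. e \<in> J \<Longrightarrow> r e \<in> T" "y' ^ q = g * (\<Sum>e\<in>J. r e * mpow Y d e)"
      by (metis mspanE)
    \<comment> \<open>The coefficient at the exponent \<open>f\<close> of the \<open>q\<close>-th
      power of the monomial whose shifted exponent is \<open>h\<close>, extended by 0 so that all
      sums run over \<open>J\<close>.\<close>
    define C where "C h f = (if f \<le> h then \<Prod>i\<in>{1..d}. of_nat (h i choose f i) * u i ^ f i * l i ^ (h i - f i) else 0)"
      for h f :: "nat \<Rightarrow> nat"
    have CT: "C h f \<in> T" for h f unfolding C_def using uT lT by (auto intro!: cl)
    have exp: "mpow Y d e ^ q = (\<Sum>f\<in>J. C (shift d e) f * mpow Y d f)" if "e \<in> J" for e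
    proof -
      have "mpow Y d e ^ q = (\<Sum>f\<in>{..shift d e}. C (shift d e) f * mpow Y d f)"
        unfolding mpow_frob by (subst prod_binomial_expand) (auto simp: shift_def C_def)
      also have "\<dots> = (\<Sum>f\<in>J. C (shift d e) f * mpow Y d f)"
        using J_down[OF J_shift[OF that]] J_finite by (intro sum.mono_neutral_left) (auto simp: C_def)
      finally show ?thesis .
    qed
    have "y' ^ q = (\<Sum>e\<in>J'. \<Sum>f\<in>J. t e ^ q * C (shift d e) f * mpow Y d f)"
      unfolding y'_def frob_sum power_mult_distrib using J'J exp
      by (intro sum.cong refl) (auto simp: sum_distrib_left mult.assoc subset_iff)
    also have "\<dots> = (\<Sum>f\<in>J. (\<Sum>e\<in>J'. t e ^ q * C (shift d e) f) * mpow Y d f)"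
      unfolding sum_distrib_right by (rule sum.swap)
    finally have eqn: "(\<Sum>f\<in>J. (\<Sum>e\<in>J'. t e ^ q * C (shift d e) f) * mpow Y d f) = (\<Sum>f\<in>J. (g * r f) * mpow Y d f)"
      using r(2) by (simp add: sum_distrib_left mult.assoc)
    have coeff: "(\<Sum>e\<in>J'. t e ^ q * C (shift d e) f) = g * r f" if "f \<in> J" for f
    proof (rule mindep_eq[OF ind T, of "\<lambda>f. \<Sum>e\<in>J'. t e ^ q * C (shift d e) f" "\<lambda>f. g * r f"])
      show "(\<Sum>e\<in>J'. t e ^ q * C (shift d e) f) \<in> T" for f
        using J'J t(1) CT by (intro cl) auto
    qed (use that g r eqn in \<open>auto intro: cl\<close>)
    obtain e0 where e0: "e0 \<in> J'" "\<And>e. e \<in> J' \<Longrightarrow> sum e {1..d} \<le> sum e0 {1..d}"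
    proof -
      have "Max ((\<lambda>e. sum e {1..d}) ` J') \<in> (\<lambda>e. sum e {1..d}) ` J'"
        using fJ' False by (intro Max_in) auto
      then obtain e0 where "e0 \<in> J'" "sum e0 {1..d} = Max ((\<lambda>e. sum e {1..d}) ` J')" by auto
      moreover have "sum e {1..d} \<le> Max ((\<lambda>e. sum e {1..d}) ` J')" if "e \<in> J'" for e
        using fJ' that by (intro Max_ge) auto
      ultimately show ?thesis using that by metis
    qed
    have e0J: "e0 \<in> J" using e0 J'J by auto
    \<comment> \<open>A contribution requires \<open>shift d e0 \<le> shift d e\<close>; as the
      total degree of \<open>e0\<close> is maximal, the two exponents then agree.\<close>
    have zero: "C (shift d e) (shift d e0) = 0" if "e \<in> J'" "e \<noteq> e0" for e
    proof (rule ccontr)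
      assume "C (shift d e) (shift d e0) \<noteq> 0"
      then have le: "shift d e0 \<le> shift d e" by (auto simp: C_def split: if_splits)
      have "sum (shift d e) {1..d} \<le> sum (shift d e0) {1..d}" using e0(2)[OF that(1)] unfolding sum_shift .
      have "shift d e0 i = shift d e i" for i
      proof (rule ccontr)
        assume ne: "shift d e0 i \<noteq> shift d e i"
        then have "i \<in> {1..d}" by (auto simp: shift_def split: if_splits)
        then have "sum (shift d e0) {1..d} < sum (shift d e) {1..d}"
        proof (intro sum_strict_mono_ex1 ballI)
          show "\<exists>i\<in>{1..d}. shift d e0 i < shift d e i"
            using \<open>i \<in> {1..d}\<close> ne le[THEN le_funD, of i] by (intro bexI[of _ i]) linarith+
        qed (use le[THEN le_funD] in auto)
        then show False using \<open>sum (shift d e) {1..d} \<le> _\<close> by simp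
      qed
      then have "shift d e0 = shift d e" by blast
      moreover have "e \<in> J" using that J'J by blast
      ultimately have "e0 = e" using J_supp[OF e0J] J_supp[of e] by (intro shift_inj[of d e0 e])
      then show False using that by simp
    qed
    have "(\<Sum>e\<in>J'. t e ^ q * C (shift d e) (shift d e0)) = t e0 ^ q * C (shift d e0) (shift d e0)"
      using zero fJ' e0(1) by (subst sum.remove[OF fJ' e0(1)]) auto
    moreover have "C (shift d e0) (shift d e0) = (\<Prod>i\<in>{1..d}. u i ^ shift d e0 i)"
      by (simp add: C_def)
    ultimately have eq: "t e0 ^ q * (\<Prod>i\<in>{1..d}. u i ^ shift d e0 i) = g * r (shift d e0)"
      using coeff[OF J_shift[OF e0J]] by simp
    \<comment> \<open>Invertibility modulo \<open>g\<close> passes from \<open>u i\<close> to its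
      powers, and below to the product of these.\<close>
    have u1: "\<exists>v\<in>T. \<exists>r\<in>T. u i ^ n * v = 1 + g * r" if i: "i \<in> {1..d}" for i n
    proof (induction n)
      case (Suc n)
      then obtain v r where v: "v \<in> T" "r \<in> T" "u i ^ n * v = 1 + g * r" by auto
      obtain v' r' where v': "v' \<in> T" "r' \<in> T" "u i * v' = 1 + g * r'" using unit[OF i] by auto
      have "u i ^ Suc n * (v * v') = (u i ^ n * v) * (u i * v')" by simp
      also have "\<dots> = 1 + g * (r + r' + g * r * r')" unfolding v v' by (simp add: algebra_simps)
      finally show ?case using v v' g by (intro bexI[of _ "v * v'"] bexI[of _ "r + r' + g * r * r'"]) (auto intro!: cl)
    qed (use cl in auto)
    have "\<exists>v\<in>T. \<exists>r\<in>T. (\<Prod>i\<in>I. u i ^ shift d e0 i) * v = 1 + g * r" if "finite I" "I \<subseteq> {1..d}" for I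
      using that
    proof (induction I rule: finite_induct)
      case (insert i I)
      then obtain v r where v: "v \<in> T" "r \<in> T" "(\<Prod>i\<in>I. u i ^ shift d e0 i) * v = 1 + g * r" by auto
      obtain v' r' where v': "v' \<in> T" "r' \<in> T" "u i ^ shift d e0 i * v' = 1 + g * r'" 
        using u1[of i "shift d e0 i"] insert by auto
      have "(\<Prod>i\<in>insert i I. u i ^ shift d e0 i) * (v * v') = ((\<Prod>i\<in>I. u i ^ shift d e0 i) * v) * (u i ^ shift d e0 i * v')"
        using insert by (simp add: mult_ac)
      also have "\<dots> = 1 + g * (r + r' + g * r * r')" unfolding v v' by (simp add: algebra_simps)
      finally show ?case using v v' g by (intro bexI[of _ "v * v'"] bexI[of _ "r + r' + g * r * r'"]) (auto intro!: cl)
    qed (use cl in auto)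
    from this[of "{1..d}"] obtain v r' where v: "v \<in> T" "r' \<in> T"
      "(\<Prod>i\<in>{1..d}. u i ^ shift d e0 i) * v = 1 + g * r'" by auto
    \<comment> \<open>Multiplying \<open>eq\<close> by the inverse \<open>v\<close> modulo
      \<open>g\<close> isolates \<open>t e0 ^ q\<close>.\<close>
    have "t e0 ^ q = t e0 ^ q * (1 + g * r') - g * (t e0 ^ q * r')" by (simp add: algebra_simps)
    also have "\<dots> = g * (r (shift d e0) * v - t e0 ^ q * r')"
      unfolding v(3)[symmetric] mult.assoc[symmetric] eq by (simp add: algebra_simps)
    finally have "t e0 ^ q \<in> (*) g ` T"
      using v r(1)[OF J_shift[OF e0J]] t(1)[OF e0J] by (intro image_eqI[of _ _ "r (shift d e0) * v - t e0 ^ q * r'"]) (auto intro!: cl)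
    then have "t e0 \<in> (*) g ` T" using IH t(1)[OF e0J] by blast
    then show ?thesis using e0(1) by (auto simp: J'_def)
  qed
qed

end

section \<open>The Anderson-Thakur function\<close>

lemma poly_zero_many_roots:
  fixes p :: "'c::idom poly"
  assumes "\<And>x. x \<in> S \<Longrightarrow> poly p x = 0" "card S = n" "\<And>i. i \<ge> n \<Longrightarrow> coeff p i = 0" "finite S" "n > 0"
  shows "p = 0"
proof (rule ccontr)
  assume p: "p \<noteq> 0"
  have "n \<le> card {x. poly p x = 0}"
    using assms poly_roots_finite[OF p] by (auto intro!: card_mono)
  also have "\<dots> \<le> degree p" by (rule card_poly_roots_bound[OF p])
  also have "\<dots> < n" using assms by (intro degree_lessI) auto
  finally show False by simp
qed

text \<open>Pascal's rule with the powers attached. Whenever a subtraction of exponents is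
  truncated, the binomial coefficient next to it is 0.\<close>

lemma pascal_step:
  fixes w a :: "'b::comm_ring_1"
  shows "w * (of_nat (m choose n) * a * w ^ (m - n)) +
      (if n = 0 then 0 else of_nat (m choose (n - 1)) * a * w ^ (m - (n - 1))) =
    of_nat (Suc m choose n) * a * w ^ (Suc m - n)"
proof (cases n)
  case 0
  then show ?thesis by (simp add: mult.left_commute)
next
  case (Suc k)
  have "w * (of_nat (m choose Suc k) * a * w ^ (m - Suc k)) = of_nat (m choose Suc k) * a * w ^ (m - k)"
  proof (cases "Suc k \<le> m")
    case True
    then have "m - k = Suc (m - Suc k)" by auto
    then show ?thesis by (simp add: mult.left_commute)
  qed (simp add: binomial_eq_0)
  then show ?thesis by (simp add: Suc distrib_right add.commute)
qed

locale carlitz_field = C_infinity \<iota>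
  for \<iota> :: "'a::{field,finite} fls alg_closure \<Rightarrow> 'c::{nonarch_field,complete_space}" +
  fixes q :: nat
  assumes q: "q = CARD('a)"
begin

abbreviation "\<theta> \<equiv> theta \<iota>"

lemma hom_0 [simp]: "\<iota> 0 = 0"
  by (metis add_cancel_left_right hom_add add.right_neutral)

lemma q_ge_2: "q \<ge> 2"
proof -
  have "card {0, 1 :: 'a} \<le> q" unfolding q by (intro card_mono) auto
  then show ?thesis by simp
qed

lemma vabs_theta: "vabs \<theta> = real q"
  using vabs_fls[of fls_X_inv] by (simp add: theta_def q)

lemma theta_nz: "\<theta> \<noteq> 0"
proof
  assume "\<theta> = 0"
  then show False using vabs_theta q_ge_2 by simp
qed

lemma Fq_emb_0 [simp]: "Fq_emb \<iota> 0 = 0" and Fq_emb_1 [simp]: "Fq_emb \<iota> 1 = 1"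
  by (simp_all add: Fq_emb_def hom_one)

lemma Fq_emb_add: "Fq_emb \<iota> (x + y) = Fq_emb \<iota> x + Fq_emb \<iota> y"
  unfolding Fq_emb_def fls_plus_const[symmetric] to_ac_add hom_add ..

lemma Fq_emb_mult: "Fq_emb \<iota> (x * y) = Fq_emb \<iota> x * Fq_emb \<iota> y"
  unfolding Fq_emb_def fls_const_mult_const[symmetric] to_ac_mult hom_mult ..

lemma Fq_emb_minus: "Fq_emb \<iota> (- x) = - Fq_emb \<iota> x"
  using Fq_emb_add[of x "- x"] by (intro minus_unique[symmetric]) simp

lemma Fq_emb_power: "Fq_emb \<iota> (x ^ n) = Fq_emb \<iota> x ^ n"
  by (induction n) (auto simp: Fq_emb_mult)

lemma vabs_Fq_emb: "x \<noteq> 0 \<Longrightarrow> vabs (Fq_emb \<iota> x) = 1"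
  using vabs_fls[of "fls_const x"] by (simp add: Fq_emb_def)

lemma Fq_emb_eq_0 [simp]: "Fq_emb \<iota> x = 0 \<longleftrightarrow> x = 0"
  using vabs_Fq_emb[of x] by (cases "x = 0") auto

lemma inj_Fq_emb: "inj (Fq_emb \<iota>)"
proof (rule injI)
  fix x y assume "Fq_emb \<iota> x = Fq_emb \<iota> y"
  then have "Fq_emb \<iota> (x + - y) = 0" by (simp only: Fq_emb_add Fq_emb_minus) simp
  then show "x = y" by simp
qed

lemma Fq_power: "(x :: 'a) ^ q = x"
proof (cases "x = 0")
  case False
  have "(\<Prod>y\<in>UNIV-{0}. x * y) = (\<Prod>y\<in>UNIV-{0}. y)"
    by (rule prod.reindex_bij_witness[of _ "\<lambda>y. y / x" "\<lambda>y. x * y"]) (use False in auto)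
  moreover have "(\<Prod>y\<in>UNIV-{0}. x * y) = x ^ (q - 1) * (\<Prod>y\<in>UNIV-{0}. y)"
    by (simp add: prod.distrib q)
  ultimately have "x ^ (q - 1) = 1" by simp
  then have "x ^ Suc (q - 1) = x" by simp
  then show ?thesis using q_ge_2 by simp
qed (use q_ge_2 in auto)

lemma Fq_emb_frob: "Fq_emb \<iota> c ^ q = Fq_emb \<iota> c"
  by (simp add: Fq_power flip: Fq_emb_power)

text \<open>For fixed \<open>x\<close> the polynomial \<open>(x + Z) ^ q - x ^ q - Z ^ q\<close> has degree less than \<open>q\<close>, so it is
  zero once it vanishes at all \<open>Z\<close> in \<open>\<bbbF>\<^sub>q\<close>; apply this first with \<open>x\<close> in \<open>\<bbbF>\<^sub>q\<close>.\<close>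

lemma frob_aux:
  assumes "\<And>c. (x + Fq_emb \<iota> c) ^ q = x ^ q + Fq_emb \<iota> c ^ q"
  shows "(x + z) ^ q = x ^ q + z ^ q"
proof -
  define p where "p = [:x, 1:] ^ q - monom 1 q - [:x ^ q:]"
  have "p = 0"
  proof (rule poly_zero_many_roots)
    show "card (range (Fq_emb \<iota>)) = q" by (simp add: card_image inj_Fq_emb q)
    show "poly p y = 0" if "y \<in> range (Fq_emb \<iota>)" for y
      using that assms by (auto simp: p_def poly_monom)
    show "coeff p i = 0" if "i \<ge> q" for i
    proof (cases "i = q")
      case True
      then show ?thesis using q_ge_2
        by (auto simp: p_def coeff_linear_power coeff_pCons split: nat.split)
    next
      case False
      then have "coeff ([:x, 1:] ^ q) i = 0" using that by (intro coeff_eq_0) (simp add: degree_linear_power)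
      then show ?thesis using False that q_ge_2
        by (auto simp: p_def coeff_pCons split: nat.split)
    qed
  qed (use q_ge_2 in auto)
  then have "poly p z = 0" by simp
  then show ?thesis by (simp add: p_def poly_monom algebra_simps)
qed

lemma frob: "(x + y :: 'c) ^ q = x ^ q + y ^ q"
proof -
  have 1: "(Fq_emb \<iota> c + y) ^ q = Fq_emb \<iota> c ^ q + y ^ q" for c y
    by (rule frob_aux) (simp add: Fq_emb_frob flip: Fq_emb_add)
  have "(x + Fq_emb \<iota> c) ^ q = x ^ q + Fq_emb \<iota> c ^ q" for c
    using 1[of c x] by (simp add: add.commute)
  then show ?thesis by (rule frob_aux)
qed

lemma zero_pow_q: "(0 :: 'c) ^ q = 0"
  using q_ge_2 by (simp add: power_0_left)

lemma frob_minus: "(- x :: 'c) ^ q = - (x ^ q)"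
proof -
  have "x ^ q + (- x) ^ q = (x + - x) ^ q" by (simp only: frob)
  also have "\<dots> = 0" by (simp only: right_minus zero_pow_q)
  finally show ?thesis by (rule minus_unique[symmetric])
qed

lemma frob_diff: "(x - y :: 'c) ^ q = x ^ q - y ^ q"
  by (simp only: diff_conv_add_uminus frob frob_minus)

lemma frob_sum: "(sum f I :: 'c) ^ q = (\<Sum>i\<in>I. f i ^ q)"
  by (induction I rule: infinite_finite_induct) (simp_all add: frob zero_pow_q)

lemma pow_q_Suc: "x ^ (q ^ Suc s) = (x ^ (q ^ s)) ^ q" for x :: 'c
  by (simp only: power_Suc2 power_mult)

lemma frob_pow: "(x + y :: 'c) ^ (q ^ s) = x ^ (q ^ s) + y ^ (q ^ s)"
proof (induction s)
  case (Suc s)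
  then show ?case unfolding pow_q_Suc by (simp only: frob)
qed simp

lemma frob_pow_diff: "(x - y :: 'c) ^ (q ^ s) = x ^ (q ^ s) - y ^ (q ^ s)"
proof (induction s)
  case (Suc s)
  then show ?case unfolding pow_q_Suc by (simp only: frob_diff)
qed simp

lemma frob_of_nat: "(of_nat n :: 'c) ^ q = of_nat n"
  by (induction n) (simp_all only: of_nat_0 of_nat_Suc zero_pow_q frob power_one)

lemma frob_sums: "f sums (s :: 'c) \<Longrightarrow> (\<lambda>n. f n ^ q) sums (s ^ q)"
  unfolding sums_def frob_sum[symmetric] by (rule nonarch_tendsto_power)

abbreviation "r \<equiv> 1 / real q"

lemma r_bounds: "0 < r" "r < 1" "0 \<le> r" "r \<le> 1"
  using q_ge_2 by auto

text \<open>The small solution \<open>y\<close> of \<open>y - y ^ q = x\<close>.\<close>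

definition artin_schreier :: "'c \<Rightarrow> 'c" where "artin_schreier x = (\<Sum>s. x ^ (q ^ s))"

lemma suc_le_q_pow: "s + 1 \<le> q ^ s"
proof (induction s)
  case (Suc s)
  have "Suc s + 1 \<le> 2 * (s + 1)" by simp
  from le_trans[OF this mult_le_mono[OF q_ge_2 Suc]] show ?case unfolding power_Suc .
qed auto

text \<open>Raising the series to the power \<open>q\<close> drops its first term
  \<open>x\<close>.\<close>

lemma artin_schreier:
  assumes "vabs x \<le> b" "b < 1"
  shows "artin_schreier x - artin_schreier x ^ q = x" "vabs (artin_schreier x) \<le> b"
proof -
  have b: "b \<ge> 0" using assms vabs_nonneg[of x] by linarith
  have le: "vabs (x ^ (q ^ s)) \<le> b * b ^ s" for s
  proof -
    have "vabs (x ^ (q ^ s)) \<le> b ^ (q ^ s)" 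
      unfolding vabs_power by (intro power_mono assms) auto
    also have "\<dots> \<le> b ^ (s + 1)" using suc_le_q_pow[of s] b assms by (intro power_decreasing) auto
    finally show ?thesis by simp
  qed
  then have s: "(\<lambda>s. x ^ (q ^ s)) sums artin_schreier x"
    unfolding artin_schreier_def using b assms by (intro summable_sums nonarch_summable_geometric[of _ b b]) auto
  have "(\<lambda>s. x ^ (q ^ (s + 1))) sums (artin_schreier x - (\<Sum>s<1. x ^ (q ^ s)))"
    by (rule nonarch_sums_shift[OF s])
  moreover have "(\<lambda>s. (x ^ (q ^ s)) ^ q) sums (artin_schreier x ^ q)" by (rule frob_sums[OF s])
  ultimately have "artin_schreier x - x = artin_schreier x ^ q"
    by (simp add: mult.commute sums_unique2 flip: power_mult)
  then show "artin_schreier x - artin_schreier x ^ q = x" by (simp add: algebra_simps)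
  show "vabs (artin_schreier x) \<le> b"
  proof (rule vabs_partial_sum_le[OF b _ s])
    fix n
    have "b * b ^ n \<le> b * 1" using b assms by (intro mult_left_mono power_le_one) auto
    then show "vabs (x ^ (q ^ n)) \<le> b" using le[of n] by simp
  qed
qed

text \<open>The coefficients of \<open>\<omega> / \<lambda>\<^sub>\<theta>\<close>: the functional equation of \<open>\<omega>\<close> says that
  \<open>f - f\<^sup>q = f' / \<theta>\<close> for consecutive coefficients \<open>f', f\<close>.\<close>

primrec at_coeff :: "nat \<Rightarrow> 'c" where
  "at_coeff 0 = 1"
| "at_coeff (Suc m) = artin_schreier (at_coeff m / \<theta>)"

declare at_coeff.simps(2) [simp del]

text \<open>Each step divides by \<theta>, and the small Artin-Schreier solution respects the bound.
  This gives convergence on the closed unit disc, which contains all \<zeta>_i.\<close>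

lemma at_coeff_le: "vabs (at_coeff m) \<le> r ^ m"
proof (induction m)
  case (Suc m)
  have "vabs (at_coeff m / \<theta>) \<le> r ^ m * r"
    using Suc by (simp add: vabs_divide vabs_theta divide_right_mono)
  moreover have "r ^ m * r < 1"
    using r_bounds power_Suc_less_one[of r m] by (simp add: mult.commute)
  ultimately show ?case using artin_schreier(2)[of "at_coeff m / \<theta>" "r ^ m * r"] by (simp add: mult.commute at_coeff.simps)
qed auto

lemma at_coeff_frob: "at_coeff (Suc m) ^ q = at_coeff (Suc m) - at_coeff m / \<theta>"
proof -
  have "vabs (at_coeff m / \<theta>) \<le> r ^ m * r"
    using at_coeff_le[of m] by (simp add: vabs_divide vabs_theta divide_right_mono)
  moreover have "r ^ m * r < 1"
    using r_bounds power_Suc_less_one[of r m] by (simp add: mult.commute)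
  ultimately show ?thesis using artin_schreier(1)[of "at_coeff m / \<theta>" "r ^ m * r"] 
    by (simp add: algebra_simps at_coeff.simps)
qed

text \<open>The \<open>s\<close>-th Frobenius twist of the series. It is the product of the first \<open>s\<close> factors
  \<open>1 - t / \<theta>\<^bsup>q^j\<^esup>\<close> with the series itself and tends to 1, so the series is the inverse of the
  infinite product.\<close>

definition twist :: "nat \<Rightarrow> 'c \<Rightarrow> 'c" where "twist s t = (\<Sum>m. at_coeff m ^ (q ^ s) * t ^ m)"

lemma twist_term_le:
  assumes "vabs t \<le> 1"
  shows "vabs (at_coeff m ^ (q ^ s) * t ^ m) \<le> (r ^ (q ^ s)) ^ m"
proof -
  have "vabs (at_coeff m) ^ (q ^ s) \<le> (r ^ m) ^ (q ^ s)" by (intro power_mono at_coeff_le) auto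
  moreover have "vabs t ^ m \<le> 1" using assms by (intro power_le_one) auto
  ultimately have "vabs (at_coeff m) ^ (q ^ s) * vabs t ^ m \<le> (r ^ m) ^ (q ^ s) * 1"
    by (intro mult_mono) auto
  then show ?thesis by (simp add: vabs_mult vabs_power mult.commute flip: power_mult)
qed

lemma twist_sums:
  assumes "vabs t \<le> 1"
  shows "(\<lambda>m. at_coeff m ^ (q ^ s) * t ^ m) sums twist s t"
  unfolding twist_def
proof (intro summable_sums nonarch_summable_geometric)
  show "vabs (at_coeff m ^ (q ^ s) * t ^ m) \<le> 1 * (r ^ (q ^ s)) ^ m" for m
    using twist_term_le[OF assms] by simp
  show "r ^ (q ^ s) < 1" using r_bounds q_ge_2 by (intro power_less_one_iff[THEN iffD2]) auto
qed (use r_bounds in auto)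

text \<open>Coefficient by coefficient, this is \<open>at_coeff_frob\<close> raised to the power
  \<open>q ^ s\<close>.\<close>

lemma twist_Suc:
  assumes t: "vabs t \<le> 1"
  shows "twist (Suc s) t = (1 - t / \<theta> ^ (q ^ s)) * twist s t"
proof -
  let ?a = "\<lambda>s m. at_coeff m ^ (q ^ s) * t ^ m"
  have "(\<lambda>m. ?a s (m + 1)) sums (twist s t - (\<Sum>m<1. ?a s m))"
    by (rule nonarch_sums_shift[OF twist_sums[OF t]])
  moreover have "(\<lambda>m. t / \<theta> ^ (q ^ s) * ?a s m) sums (t / \<theta> ^ (q ^ s) * twist s t)"
    by (rule nonarch_sums_mult[OF twist_sums[OF t]])
  ultimately have "(\<lambda>m. ?a s (m + 1) - t / \<theta> ^ (q ^ s) * ?a s m) sums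
      (twist s t - (\<Sum>m<1. ?a s m) - t / \<theta> ^ (q ^ s) * twist s t)"
    by (rule nonarch_sums_diff)
  also have "(\<lambda>m. ?a s (m + 1) - t / \<theta> ^ (q ^ s) * ?a s m) = (\<lambda>m. ?a (Suc s) (m + 1))"
  proof
    fix m
    have "at_coeff (m + 1) ^ (q ^ Suc s) = (at_coeff (m + 1) - at_coeff m / \<theta>) ^ (q ^ s)"
      using at_coeff_frob[of m] by (simp add: power_mult)
    also have "\<dots> = at_coeff (m + 1) ^ (q ^ s) - at_coeff m ^ (q ^ s) / \<theta> ^ (q ^ s)"
      by (simp only: frob_pow_diff power_divide)
    finally have "?a (Suc s) (m + 1) = (at_coeff (m + 1) ^ (q ^ s) - at_coeff m ^ (q ^ s) / \<theta> ^ (q ^ s)) * t ^ (m + 1)"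
      by (simp only:)
    then show "?a s (m + 1) - t / \<theta> ^ (q ^ s) * ?a s m = ?a (Suc s) (m + 1)"
      by (simp add: algebra_simps)
  qed
  finally have *: "(\<lambda>m. ?a (Suc s) (m + 1)) sums
      (twist s t - (\<Sum>m<1. ?a s m) - t / \<theta> ^ (q ^ s) * twist s t)" .
  have "(\<lambda>m. ?a (Suc s) (m + 1)) sums (twist (Suc s) t - (\<Sum>m<1. ?a (Suc s) m))"
    by (rule nonarch_sums_shift[OF twist_sums[OF t]])
  from sums_unique2[OF this *] show ?thesis by (simp add: algebra_simps)
qed

lemma twist_tendsto:
  assumes t: "vabs t \<le> 1"
  shows "(\<lambda>s. twist s t) \<longlonglongrightarrow> 1"
proof (rule vabs_squeeze)
  fix s
  have "vabs (twist s t - (\<Sum>m<1. at_coeff m ^ (q ^ s) * t ^ m)) \<le> r ^ (q ^ s)"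
  proof (rule vabs_tail_le[OF _ _ twist_sums[OF t]])
    fix m :: nat assume m: "m \<ge> 1"
    have "(r ^ (q ^ s)) ^ m \<le> (r ^ (q ^ s)) ^ 1"
      using m r_bounds by (intro power_decreasing power_le_one) auto
    then show "vabs (at_coeff m ^ (q ^ s) * t ^ m) \<le> r ^ (q ^ s)"
      using twist_term_le[OF t, of m s] by simp
  qed (use r_bounds in auto)
  also have "\<dots> \<le> r ^ s" using r_bounds suc_le_q_pow[of s] by (intro power_decreasing) auto
  finally show "vabs (twist s t - 1) \<le> r ^ s" by simp
  show "(\<lambda>s. r ^ s) \<longlonglongrightarrow> 0" using r_bounds by (intro LIMSEQ_realpow_zero) auto
qed

lemma twist_prod:
  assumes t: "vabs t \<le> 1"
  shows "twist s t = (\<Prod>j<s. 1 - t / \<theta> ^ (q ^ j)) * twist 0 t"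
  by (induction s) (auto simp: twist_Suc[OF t])

text \<open>A zero would propagate to all twists by the product formula, but these tend to
  1.\<close>

lemma twist_0_nz: assumes t: "vabs t \<le> 1" shows "twist 0 t \<noteq> 0"
proof
  assume 0: "twist 0 t = 0"
  have "twist s t = 0" for s by (subst twist_prod[OF t]) (simp only: 0 mult_zero_right)
  then have "(\<lambda>s. twist s t) = (\<lambda>_. 0)" by blast
  then show False using LIMSEQ_unique[OF twist_tendsto[OF t], of 0] by simp
qed

lemma omega_eq:
  assumes t: "vabs t \<le> 1"
  shows "omega \<iota> lam t = lam * twist 0 t"
proof -
  let ?f = "\<lambda>j. inverse (1 - t / \<theta> ^ (q ^ j))"
  have nz: "1 - t / \<theta> ^ (q ^ j) \<noteq> 0" for j
  proof
    assume "1 - t / \<theta> ^ (q ^ j) = 0"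
    then have "t = \<theta> ^ (q ^ j)" using theta_nz by (simp add: field_simps)
    then have "real q ^ (q ^ j) \<le> 1" using t by (simp add: vabs_power vabs_theta)
    moreover have "real q ^ (q ^ j) > 1" using q_ge_2 by (intro one_less_power) auto
    ultimately show False by simp
  qed
  have "(\<lambda>s. twist 0 t * inverse (twist s t)) \<longlonglongrightarrow> twist 0 t * inverse 1"
    by (intro nonarch_tendsto_mult tendsto_const nonarch_tendsto_inverse twist_tendsto t) auto
  moreover have "twist 0 t * inverse (twist s t) = (\<Prod>j<s. ?f j)" for s
    unfolding twist_prod[OF t, of s] using twist_0_nz[OF t] prod_inversef[of "\<lambda>j. 1 - t / \<theta> ^ (q ^ j)" "{..<s}"]
    by (simp add: comp_def)
  ultimately have "(\<lambda>s. \<Prod>j<s. ?f j) \<longlonglongrightarrow> twist 0 t" by simp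
  \<comment> \<open>The partial products in \<open>has_prod\<close> include the index
    \<open>n\<close>.\<close>
  then have "(\<lambda>n. \<Prod>j\<le>n. ?f j) \<longlonglongrightarrow> twist 0 t"
    by (subst (asm) filterlim_sequentially_Suc[symmetric]) (simp add: lessThan_Suc_atMost)
  then have "?f has_prod twist 0 t" using twist_0_nz[OF t] by (simp add: has_prod_def raw_has_prod_def)
  then have "prodinf ?f = twist 0 t" by (rule has_prod_unique[symmetric])
  then show ?thesis unfolding omega_def q[symmetric] by (simp only:)
qed

text \<open>The hyperderivative of \<open>\<omega> / \<lambda>\<^sub>\<theta>\<close>.\<close>

definition hyper :: "nat \<Rightarrow> 'c \<Rightarrow> 'c" where
  "hyper n z = (\<Sum>m. of_nat (m choose n) * at_coeff m * z ^ (m - n))"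

lemma hyper_term_le:
  assumes z: "vabs z \<le> 1"
  shows "vabs (of_nat (m choose n) * at_coeff m * z ^ (m - n)) \<le> r ^ m"
proof -
  have "vabs z ^ (m - n) \<le> 1" using z by (intro power_le_one) auto
  then have "vabs (of_nat (m choose n) :: 'c) * vabs (at_coeff m) * vabs z ^ (m - n) \<le> 1 * r ^ m * 1"
    using r_bounds by (intro mult_mono vabs_of_nat_le at_coeff_le) auto
  then show ?thesis by (simp add: vabs_mult vabs_power)
qed

lemma hyper_sums:
  assumes z: "vabs z \<le> 1"
  shows "(\<lambda>m. of_nat (m choose n) * at_coeff m * z ^ (m - n)) sums hyper n z"
  unfolding hyper_def using hyper_term_le[OF z] r_bounds
  by (intro summable_sums nonarch_summable_geometric[of _ 1 r]) auto

text \<open>No double series is rearranged: the square partial sums are finite, and the tails in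
  \<open>m\<close> are bounded by \<open>r ^ M\<close> uniformly in \<open>n\<close>.\<close>

lemma hyper_expansion:
  assumes z: "vabs z \<le> 1" and x: "vabs x < 1"
  shows "(\<lambda>n. hyper n z * x ^ n) sums twist 0 (z + x)"
proof -
  let ?A = "\<lambda>M. \<Sum>n<M. hyper n z * x ^ n" and ?B = "\<lambda>M. \<Sum>m<M. at_coeff m * (z + x) ^ m"
  have zx: "vabs (z + x) \<le> 1" using z x by (intro vabs_add_le) auto
  have B: "?B \<longlonglongrightarrow> twist 0 (z + x)" using twist_sums[OF zx, of 0] by (simp add: sums_def)
  have diff: "vabs (?A M - ?B M - 0) \<le> r ^ M" for M
  proof -
    let ?t = "\<lambda>m n. of_nat (m choose n) * at_coeff m * z ^ (m - n)"
    have "?B M = (\<Sum>m<M. \<Sum>n<M. ?t m n * x ^ n)"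
    proof (rule sum.cong)
      fix m assume "m \<in> {..<M}"
      have "(z + x) ^ m = (\<Sum>n\<le>m. of_nat (m choose n) * x ^ n * z ^ (m - n))"
        by (subst add.commute) (rule binomial_ring)
      then have "at_coeff m * (z + x) ^ m = (\<Sum>n\<le>m. at_coeff m * (of_nat (m choose n) * x ^ n * z ^ (m - n)))"
        by (simp only: sum_distrib_left)
      also have "\<dots> = (\<Sum>n\<le>m. ?t m n * x ^ n)"
        by (rule sum.cong) (simp_all only: mult_ac)
      also have "\<dots> = (\<Sum>n<M. ?t m n * x ^ n)"
        using \<open>m \<in> {..<M}\<close> by (intro sum.mono_neutral_left) (auto simp: binomial_eq_0)
      finally show "at_coeff m * (z + x) ^ m = (\<Sum>n<M. ?t m n * x ^ n)" .
    qed simp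
    also have "\<dots> = (\<Sum>n<M. (\<Sum>m<M. ?t m n) * x ^ n)"
      unfolding sum_distrib_right by (rule sum.swap)
    finally have BM: "?B M = (\<Sum>n<M. (\<Sum>m<M. ?t m n) * x ^ n)" .
    have "?A M - ?B M = (\<Sum>n<M. (hyper n z - (\<Sum>m<M. ?t m n)) * x ^ n)"
      unfolding BM sum_subtractf[symmetric] left_diff_distrib ..
    also have "vabs \<dots> \<le> r ^ M"
    proof (rule vabs_sum_le)
      fix n
      have "vabs (hyper n z - (\<Sum>m<M. ?t m n)) \<le> r ^ M"
      proof (rule vabs_tail_le[OF _ _ hyper_sums[OF z]])
        fix m assume "m \<ge> M"
        then have "r ^ m \<le> r ^ M" using r_bounds by (intro power_decreasing) auto
        then show "vabs (?t m n) \<le> r ^ M" using hyper_term_le[OF z, of m n] by linarith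
      qed (use r_bounds in auto)
      moreover have "vabs x ^ n \<le> 1" using x by (intro power_le_one) auto
      ultimately have "vabs (hyper n z - (\<Sum>m<M. ?t m n)) * vabs x ^ n \<le> r ^ M * 1"
        by (intro mult_mono) auto
      then show "vabs ((hyper n z - (\<Sum>m<M. ?t m n)) * x ^ n) \<le> r ^ M"
        by (simp only: vabs_mult vabs_power mult_1_right)
    next
      show "0 \<le> r ^ M" using r_bounds(3) by (rule zero_le_power)
    qed
    finally show ?thesis by (simp only: diff_0_right)
  qed
  have "(\<lambda>M. r ^ M) \<longlonglongrightarrow> 0" using r_bounds by (intro LIMSEQ_realpow_zero) auto
  from vabs_squeeze[OF diff this] have "(\<lambda>M. ?A M - ?B M) \<longlonglongrightarrow> 0" .
  from tendsto_add[OF this B] show ?thesis by (simp add: sums_def)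
qed

lemma hyperderiv_omega:
  assumes z: "vabs z \<le> 1"
  shows "hyperderiv n (omega \<iota> lam) z = lam * hyper n z"
proof (rule hyperderiv_eqI[of \<theta> 1])
  fix x :: 'c assume x: "vabs x < 1"
  have "vabs (z + x) \<le> 1" using z x by (intro vabs_add_le) auto
  then show "(\<lambda>k. lam * hyper k z * x ^ k) sums omega \<iota> lam (z + x)"
    using nonarch_sums_mult[OF hyper_expansion[OF z x], of lam] by (simp add: omega_eq mult.assoc)
qed (use q_ge_2 in \<open>auto simp: vabs_theta\<close>)

text \<open>The functional equation for \<omega> / \<lambda>_\<theta>, hyperdifferentiated termwise:
  \<open>at_coeff_frob\<close> rewrites the \<open>q\<close>-th powers of the coefficients, and
  Pascal's rule splits off the hyperderivative of order \<open>n - 1\<close>.\<close>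

lemma hyper_frob:
  assumes z: "vabs z \<le> 1"
  shows "hyper n z ^ q = hyper n (z ^ q) - (z ^ q * hyper n (z ^ q) + (if n = 0 then 0 else hyper (n - 1) (z ^ q))) / \<theta>"
proof -
  let ?w = "z ^ q" and ?h = "\<lambda>n. if n = 0 then 0 else hyper (n - 1) (z ^ q)"
  let ?t = "\<lambda>n m. of_nat (m choose n) * at_coeff m * ?w ^ (m - n)"
  have w: "vabs ?w \<le> 1" using z by (auto simp: vabs_power intro!: power_le_one)
  have L: "(\<lambda>m. (of_nat (m choose n) * at_coeff m * z ^ (m - n)) ^ q) sums (hyper n z ^ q)"
    by (rule frob_sums[OF hyper_sums[OF z]])
  have L': "(\<lambda>m. (of_nat (m choose n) * at_coeff m * z ^ (m - n)) ^ q) = (\<lambda>m. of_nat (m choose n) * at_coeff m ^ q * ?w ^ (m - n))"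
  proof
    fix m
    have "(z ^ (m - n)) ^ q = ?w ^ (m - n)" by (metis power_mult mult.commute)
    then show "(of_nat (m choose n) * at_coeff m * z ^ (m - n)) ^ q = of_nat (m choose n) * at_coeff m ^ q * ?w ^ (m - n)"
      by (simp only: power_mult_distrib frob_of_nat)
  qed
  have S1: "(\<lambda>m. ?t n (m + 1)) sums (hyper n ?w - (\<Sum>m<1. ?t n m))"
    by (rule nonarch_sums_shift[OF hyper_sums[OF w]])
  have "(\<lambda>m. if n = 0 then 0 else ?t (n - 1) m) sums ?h n"
    using hyper_sums[OF w, of "n - 1"] by (cases "n = 0") auto
  then have "(\<lambda>m. inverse \<theta> * (?w * ?t n m + (if n = 0 then 0 else ?t (n - 1) m))) sums
      (inverse \<theta> * (?w * hyper n ?w + ?h n))"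
    by (intro nonarch_sums_mult sums_add hyper_sums[OF w])
  from nonarch_sums_diff[OF S1 this]
  have "(\<lambda>m. ?t n (m + 1) - inverse \<theta> * (?w * ?t n m + (if n = 0 then 0 else ?t (n - 1) m))) sums
      (hyper n ?w - (\<Sum>m<1. ?t n m) - inverse \<theta> * (?w * hyper n ?w + ?h n))" .
  also have "(\<lambda>m. ?t n (m + 1) - inverse \<theta> * (?w * ?t n m + (if n = 0 then 0 else ?t (n - 1) m))) =
    (\<lambda>m. of_nat ((m + 1) choose n) * at_coeff (m + 1) ^ q * ?w ^ (m + 1 - n))"
  proof
    fix m
    have "?w * ?t n m + (if n = 0 then 0 else ?t (n - 1) m) = of_nat ((m + 1) choose n) * at_coeff m * ?w ^ (m + 1 - n)"
      using pascal_step[of ?w m n "at_coeff m"] by (simp only: Suc_eq_plus1)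
    then have "?t n (m + 1) - inverse \<theta> * (?w * ?t n m + (if n = 0 then 0 else ?t (n - 1) m)) =
      ?t n (m + 1) - inverse \<theta> * (of_nat ((m + 1) choose n) * at_coeff m * ?w ^ (m + 1 - n))"
      by (rule arg_cong)
    also have "\<dots> = of_nat ((m + 1) choose n) * (at_coeff (m + 1) - at_coeff m / \<theta>) * ?w ^ (m + 1 - n)"
      by (simp only: divide_inverse left_diff_distrib right_diff_distrib mult_ac)
    also have "at_coeff (m + 1) - at_coeff m / \<theta> = at_coeff (m + 1) ^ q"
      using at_coeff_frob[of m] by (simp only: Suc_eq_plus1)
    finally show "?t n (m + 1) - inverse \<theta> * (?w * ?t n m + (if n = 0 then 0 else ?t (n - 1) m)) =
      of_nat ((m + 1) choose n) * at_coeff (m + 1) ^ q * ?w ^ (m + 1 - n)" .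
  qed
  finally have R: "(\<lambda>m. of_nat ((m + 1) choose n) * at_coeff (m + 1) ^ q * ?w ^ (m + 1 - n)) sums
    (hyper n ?w - (\<Sum>m<1. ?t n m) - inverse \<theta> * (?w * hyper n ?w + ?h n))" .
  have "(\<lambda>m. of_nat ((m + 1) choose n) * at_coeff (m + 1) ^ q * ?w ^ (m + 1 - n)) sums
    (hyper n z ^ q - (\<Sum>m<1. of_nat (m choose n) * at_coeff m ^ q * ?w ^ (m - n)))"
    using L unfolding L' by (rule nonarch_sums_shift)
  from sums_unique2[OF this R] have E: "hyper n z ^ q - (\<Sum>m<1. of_nat (m choose n) * at_coeff m ^ q * ?w ^ (m - n)) =
    hyper n ?w - (\<Sum>m<1. ?t n m) - inverse \<theta> * (?w * hyper n ?w + ?h n)" .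
  \<comment> \<open>The recursion only covers the terms with \<open>m \<ge> 1\<close>. The terms
    with \<open>m = 0\<close> cancel because \<open>at_coeff 0 = 1\<close> is fixed by the
    Frobenius.\<close>
  have S: "(\<Sum>m<1. of_nat (m choose n) * at_coeff m ^ q * ?w ^ (m - n)) = (\<Sum>m<1. ?t n m)"
  proof (rule sum.cong)
    fix m :: nat assume "m \<in> {..<1}"
    then have "at_coeff m ^ q = at_coeff m" by simp
    then show "of_nat (m choose n) * at_coeff m ^ q * ?w ^ (m - n) = ?t n m" by (simp only:)
  qed (rule refl)
  have *: "a = b - c" if "a - s = b - s - c" for a b c s :: 'c
    using that by (simp add: algebra_simps)
  have "hyper n z ^ q = hyper n ?w - inverse \<theta> * (?w * hyper n ?w + ?h n)"
    using E unfolding S by (rule *)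
  then show ?thesis unfolding divide_inverse mult.commute[of "inverse \<theta>"] .
qed

end

section \<open>Constants and the polynomial ring over them\<close>

lemma card_polys_degree_less:
  assumes "d > 0"
  shows "card {f :: 'a::{field,finite} poly. degree f < d} = CARD('a) ^ d"
proof -
  let ?g = "\<lambda>f :: 'a poly. map (coeff f) [0..<d]"
  have "bij_betw ?g {f. degree f < d} {xs. set xs \<subseteq> UNIV \<and> length xs = d}"
  proof (rule bij_betw_imageI)
    show "inj_on ?g {f. degree f < d}"
    proof (rule inj_onI)
      fix f h :: "'a poly" assume *: "f \<in> {f. degree f < d}" "h \<in> {f. degree f < d}" "?g f = ?g h"
      show "f = h"
      proof (rule poly_eqI)
        fix i
        show "coeff f i = coeff h i"
        proof (cases "i < d")
          case True
          then show ?thesis using arg_cong[OF *(3), of "\<lambda>xs. xs ! i"] by simp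
        next
          case False
          then show ?thesis using * by (simp add: coeff_eq_0)
        qed
      qed
    qed
    show "?g ` {f. degree f < d} = {xs. set xs \<subseteq> UNIV \<and> length xs = d}"
    proof (intro equalityI subsetI)
      fix xs :: "'a list" assume "xs \<in> {xs. set xs \<subseteq> UNIV \<and> length xs = d}"
      then have l: "length xs = d" by simp
      have "xs = ?g (Poly xs)" by (intro nth_equalityI) (auto simp: l nth_default_def coeff_Poly_eq)
      moreover have "degree (Poly xs) < d"
        using assms by (intro degree_lessI) (auto simp: l nth_default_def coeff_Poly_eq)
      ultimately show "xs \<in> ?g ` {f. degree f < d}" by blast
    qed auto
  qed
  from bij_betw_same_card[OF this] show ?thesis using card_lists_length_eq[of "UNIV :: 'a set" d] by simp
qed

text \<open>Only well-ordering of degrees: \<open>I\<close> is any set with a nonzero element. It is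
  also used for sets of denominators and of divisors.\<close>

lemma degree_ideal_generator:
  fixes I :: "'b::field poly set"
  assumes "f \<in> I" "f \<noteq> 0"
  obtains g where "g \<in> I" "g \<noteq> 0" "\<And>h. h \<in> I \<Longrightarrow> h \<noteq> 0 \<Longrightarrow> degree g \<le> degree h"
proof -
  have "\<exists>n. \<exists>g. g \<in> I \<and> g \<noteq> 0 \<and> degree g = n" using assms by blast
  then obtain n where n: "\<exists>g. g \<in> I \<and> g \<noteq> 0 \<and> degree g = n" 
    "\<And>m. m < n \<Longrightarrow> \<not> (\<exists>g. g \<in> I \<and> g \<noteq> 0 \<and> degree g = m)"
    unfolding exists_least_iff[of "\<lambda>n. \<exists>g. g \<in> I \<and> g \<noteq> 0 \<and> degree g = n"] by blast
  then show ?thesis using that by (metis not_less)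
qed

locale carlitz_prime = carlitz_field \<iota> q
  for \<iota> :: "'a::{field,finite} fls alg_closure \<Rightarrow> 'c::{nonarch_field,complete_space}" and q :: nat +
  fixes lam \<zeta> :: 'c and \<pp> :: "'a poly" and d :: nat
  assumes lam: "lam ^ (q - 1) = - theta \<iota>"
    and irred: "irreducible \<pp>" and monic: "lead_coeff \<pp> = 1" and d_def: "d = degree \<pp>"
    and root: "poly (map_poly (Fq_emb \<iota>) \<pp>) \<zeta> = 0"
begin

abbreviation "Fp \<equiv> map_poly (Fq_emb \<iota>)"

lemma coeff_Fp [simp]: "coeff (Fp p) i = Fq_emb \<iota> (coeff p i)"
  by (simp add: coeff_map_poly)

lemma Fp_add: "Fp (a + b) = Fp a + Fp b"
  by (rule poly_eqI) (simp add: Fq_emb_add)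

lemma Fq_emb_sum: "Fq_emb \<iota> (sum f I) = (\<Sum>i\<in>I. Fq_emb \<iota> (f i))"
  by (induction I rule: infinite_finite_induct) (auto simp: Fq_emb_add)

lemma Fp_mult: "Fp (a * b) = Fp a * Fp b"
  by (rule poly_eqI) (simp add: coeff_mult Fq_emb_sum Fq_emb_mult)

lemma Fp_const: "Fp [:c:] = [:Fq_emb \<iota> c:]"
  by (rule poly_eqI) (simp add: coeff_pCons split: nat.split)

lemma lam_nz: "lam \<noteq> 0"
  using lam theta_nz q_ge_2 by (auto simp: power_0_left)

lemma lam_pow_q: "lam ^ q = - \<theta> * lam"
proof -
  have "lam ^ q = lam ^ Suc (q - 1)" using q_ge_2 by simp
  then show ?thesis using lam by simp
qed

lemma d_pos: "d > 0"
proof (rule ccontr)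
  assume "\<not> d > 0"
  then have "\<pp> dvd 1" using monic d_def by (auto elim!: degree_eq_zeroE simp: one_pCons)
  then show False using irred by (auto simp: irreducible_def)
qed

text \<open>Evaluation at \<zeta> instead of \<theta>; its range is the field F_q(\<zeta>).\<close>

definition ev :: "'a poly \<Rightarrow> 'c" where "ev f = poly (Fp f) \<zeta>"

lemma ev_add: "ev (f + g) = ev f + ev g" and ev_mult: "ev (f * g) = ev f * ev g"
  and ev_const: "ev [:c:] = Fq_emb \<iota> c" and ev_pp: "ev \<pp> = 0"
  by (simp_all add: ev_def Fp_add Fp_mult Fp_const root)

lemma ev_minus: "ev (- f) = - ev f"
proof -
  have "ev f + ev (- f) = ev 0" by (simp flip: ev_add)
  also have "\<dots> = 0" by (simp add: ev_def)
  finally show ?thesis by (rule minus_unique[symmetric])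
qed

text \<open>A kernel element of least degree divides \<pp> and is not a unit, so irreducibility
  forces it to have the degree of \<pp>.\<close>

lemma ev_kernel_degree:
  assumes "ev f = 0" "f \<noteq> 0" shows "d \<le> degree f"
proof -
  obtain g where g: "g \<in> {f. ev f = 0}" "g \<noteq> 0" "\<And>h. h \<in> {f. ev f = 0} \<Longrightarrow> h \<noteq> 0 \<Longrightarrow> degree g \<le> degree h"
    using degree_ideal_generator[of f "{f. ev f = 0}"] assms by blast
  have "ev \<pp> = ev (\<pp> div g * g) + ev (\<pp> mod g)" by (simp flip: ev_add)
  then have "ev (\<pp> mod g) = 0" using g(1) by (simp add: ev_pp ev_mult)
  then have "\<pp> mod g = 0" using g degree_mod_less[of g \<pp>] by fastforce
  then obtain h where h: "\<pp> = g * h" by (metis dvd_def mod_0_imp_dvd)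
  then have "g dvd 1 \<or> h dvd 1" using irred irreducibleD by blast
  moreover have "\<not> g dvd 1"
  proof
    assume "g dvd 1"
    then have "ev g * ev (1 div g) = ev [:1:]" by (simp add: one_pCons flip: ev_mult)
    then show False using g(1) by (simp add: ev_const)
  qed
  ultimately have "h dvd 1" by blast
  then have "degree h = 0" using dvd_imp_degree_le[of h 1] by simp
  then have "degree \<pp> = degree g" using h g(2) monic by (subst h, subst degree_mult_eq) auto
  then show ?thesis using g(3)[of f] assms d_def by simp
qed

text \<open>The field k with q^d elements. The description by Frobenius invariance makes closure
  under polynomial division easy; equality with F_q(\<zeta>) follows by counting in
  \<open>kk_eq\<close>.\<close>

definition kk :: "'c set" where "kk = {x. x ^ (q ^ d) = x}"

lemma frob_fixed_card:
  assumes "s > 0"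
  shows "finite {x::'c. x ^ (q ^ s) = x}" "card {x::'c. x ^ (q ^ s) = x} \<le> q ^ s"
proof -
  have Q: "q ^ s > 1" using q_ge_2 assms by (intro one_less_power) auto
  let ?p = "monom 1 (q ^ s) - [:0, 1:] :: 'c poly"
  have eq: "{x::'c. x ^ (q ^ s) = x} = {x. poly ?p x = 0}" by (auto simp: poly_monom)
  have "coeff ?p (q ^ s) = 1" using Q assms by (auto simp: coeff_pCons split: nat.split)
  then have nz: "?p \<noteq> 0" by (metis coeff_0 zero_neq_one)
  have "degree ?p \<le> q ^ s" using Q by (intro degree_diff_le) (auto simp: degree_monom_le)
  then show "finite {x::'c. x ^ (q ^ s) = x}" "card {x::'c. x ^ (q ^ s) = x} \<le> q ^ s"
    unfolding eq using poly_roots_finite[OF nz] card_poly_roots_bound[OF nz] by auto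
qed

lemma range_ev: "range ev = ev ` {f. degree f < d}" and card_range_ev: "card (range ev) = q ^ d"
proof -
  show eq: "range ev = ev ` {f. degree f < d}"
  proof (intro equalityI subsetI)
    fix x assume "x \<in> range ev"
    then obtain f where f: "x = ev f" by blast
    have "ev f = ev (f div \<pp> * \<pp>) + ev (f mod \<pp>)" by (simp flip: ev_add)
    then have "x = ev (f mod \<pp>)" by (simp add: f ev_mult ev_pp)
    moreover have "degree (f mod \<pp>) < d" using degree_mod_less[of \<pp> f] monic d_pos d_def by fastforce
    ultimately show "x \<in> ev ` {f. degree f < d}" by blast
  qed auto
  have "inj_on ev {f. degree f < d}"
  proof (rule inj_onI)
    fix f g assume *: "f \<in> {f. degree f < d}" "g \<in> {f. degree f < d}" "ev f = ev g"
    have "ev (f + - g) = 0" unfolding ev_add ev_minus using *(3) by simp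
    moreover have "degree (f + - g) < d" using * by (intro degree_add_less) auto
    ultimately show "f = g" using ev_kernel_degree[of "f + - g"] by auto
  qed
  then show "card (range ev) = q ^ d"
    unfolding eq using card_polys_degree_less[OF d_pos, where 'a='a] by (simp add: card_image q)
qed

lemma subring_range_ev: "is_subring (range ev)"
proof (rule is_subringI)
  show "0 \<in> range ev" using ev_const[of 0] by (metis Fq_emb_0 rangeI)
  show "1 \<in> range ev" using ev_const[of 1] by (metis Fq_emb_1 rangeI)
  show "x + y \<in> range ev" if "x \<in> range ev" "y \<in> range ev" for x y
    using that by (auto simp flip: ev_add)
  show "x * y \<in> range ev" if "x \<in> range ev" "y \<in> range ev" for x y
    using that by (auto simp flip: ev_mult)
  show "- x \<in> range ev" if "x \<in> range ev" for x
    using that by (auto simp flip: ev_minus)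
qed

text \<open>Multiplication by a nonzero \<open>x\<close> permutes the \<open>q ^ d - 1\<close>
  nonzero values, and comparing products gives \<open>x ^ (q ^ d - 1) = 1\<close>. Conversely there
  are at most \<open>q ^ d\<close> fixed points.\<close>

lemma kk_eq: "kk = range ev"
proof -
  have fin: "finite (range ev)" using card_range_ev q_ge_2 by (intro card_ge_0_finite) simp
  have "range ev \<subseteq> kk"
  proof
    fix x assume x: "x \<in> range ev"
    show "x \<in> kk"
    proof (cases "x = 0")
      case False
      let ?U = "range ev - {0}"
      have im: "(*) x ` ?U = ?U"
      proof (rule card_subset_eq)
        show "finite ?U" using fin by simp
        show "(*) x ` ?U \<subseteq> ?U" using x False subring_mult[OF subring_range_ev] by auto
        show "card ((*) x ` ?U) = card ?U" using False by (intro card_image) (auto simp: inj_on_def)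
      qed
      have cU: "card ?U = q ^ d - 1" using card_range_ev fin subring_0[OF subring_range_ev] by simp
      have "(\<Prod>y\<in>?U. y) = (\<Prod>y\<in>(*) x ` ?U. y)" by (simp only: im)
      also have "\<dots> = (\<Prod>y\<in>?U. x * y)"
        using False by (subst prod.reindex) (auto simp: inj_on_def)
      also have "\<dots> = x ^ (q ^ d - 1) * (\<Prod>y\<in>?U. y)" by (simp only: prod.distrib prod_constant cU)
      finally have "x ^ (q ^ d - 1) * (\<Prod>y\<in>?U. y) = 1 * (\<Prod>y\<in>?U. y)" by simp
      moreover have "(\<Prod>y\<in>?U. y) \<noteq> 0" using fin by simp
      ultimately have "x ^ (q ^ d - 1) = 1" by (simp only: mult_cancel_right) simp
      then have "x ^ Suc (q ^ d - 1) = x" by simp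
      then show ?thesis using q_ge_2 by (simp add: kk_def)
    qed (use q_ge_2 in \<open>simp add: kk_def\<close>)
  qed
  moreover have "card kk \<le> card (range ev)" "finite kk" 
    unfolding card_range_ev kk_def using frob_fixed_card[OF d_pos] by auto
  ultimately show ?thesis using card_seteq[of kk "range ev"] by blast
qed

lemma kk_subring: "is_subring kk"
  unfolding kk_eq by (rule subring_range_ev)

lemma kk_inverse: "x \<in> kk \<Longrightarrow> inverse x \<in> kk"
  by (simp add: kk_def power_inverse)

lemma Fq_emb_kk: "Fq_emb \<iota> c \<in> kk"
  unfolding kk_eq ev_const[symmetric] by simp

lemma zeta_kk: "\<zeta> \<in> kk"
proof -
  have "ev [:0, 1:] = \<zeta>" by (simp add: ev_def map_poly_pCons)
  then show ?thesis unfolding kk_eq by (metis rangeI)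
qed

lemma card_kk: "card kk = q ^ d"
  by (simp add: kk_eq card_range_ev)

lemma vabs_kk: assumes "x \<in> kk" "x \<noteq> 0" shows "vabs x = 1"
proof -
  have Q: "q ^ d > 1" using q_ge_2 d_pos by (intro one_less_power) auto
  have "vabs x ^ (q ^ d) = vabs x" using assms by (simp add: kk_def flip: vabs_power)
  also have "vabs x ^ (q ^ d) = vabs x * vabs x ^ (q ^ d - 1)" using Q by (metis Suc_diff_1 less_imp_Suc_add less_trans power_Suc zero_less_one zero_less_Suc)
  finally have "vabs x ^ (q ^ d - 1) = 1 ^ (q ^ d - 1)" using assms(2) by simp
  then show ?thesis by (rule power_eq_imp_eq_base) (use Q in auto)
qed

lemma vabs_kk_le: "x \<in> kk \<Longrightarrow> vabs x \<le> 1"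
  using vabs_kk[of x] by (cases "x = 0") auto

text \<open>\<open>kpoly\<close> is k[X] inside the polynomials over the big field and
  \<open>RR\<close> is its image k[\<theta>]; the latter is A[\<zeta>] by
  \<open>RR_eq\<close>.\<close>

definition kpoly :: "'c poly set" where "kpoly = {p. \<forall>i. coeff p i \<in> kk}"
definition RR :: "'c set" where "RR = {poly p \<theta> |p. \<forall>i. coeff p i \<in> kk}"

lemma RR_subring: "is_subring RR"
  unfolding RR_def by (rule is_subring_coeffs[OF kk_subring])

lemma RR_kpoly: "x \<in> RR \<longleftrightarrow> (\<exists>p\<in>kpoly. x = poly p \<theta>)"
  by (auto simp: RR_def kpoly_def)

lemma kpoly_subring: "is_subring kpoly"
  unfolding kpoly_def
  by (rule is_subringI) (auto simp: coeff_1 coeff_mult intro!: subring_0[OF kk_subring]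
      subring_1[OF kk_subring] subring_add[OF kk_subring] subring_mult[OF kk_subring]
      subring_uminus[OF kk_subring] subring_sum[OF kk_subring])

lemma kpoly_pCons: "pCons a p \<in> kpoly \<longleftrightarrow> a \<in> kk \<and> p \<in> kpoly"
proof
  assume *: "pCons a p \<in> kpoly"
  have "coeff (pCons a p) 0 \<in> kk" "coeff (pCons a p) (Suc i) \<in> kk" for i
    using * unfolding kpoly_def by blast+
  then show "a \<in> kk \<and> p \<in> kpoly" by (simp add: kpoly_def)
qed (auto simp: kpoly_def coeff_pCons split: nat.split)

lemma kpoly_0: "0 \<in> kpoly" by (rule subring_0[OF kpoly_subring])

lemma kk_RR: assumes "c \<in> kk" shows "c \<in> RR"
proof -
  have "[:c:] \<in> kpoly" using assms by (simp add: kpoly_pCons kpoly_0)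
  then show ?thesis by (auto simp: RR_kpoly intro: bexI[of _ "[:c:]"])
qed

lemma theta_RR: "\<theta> \<in> RR"
proof -
  have "[:0, 1:] \<in> kpoly"
    using subring_0[OF kk_subring] subring_1[OF kk_subring] by (simp add: kpoly_pCons kpoly_0)
  then show ?thesis unfolding RR_kpoly by (intro bexI[of _ "[:0, 1:]"]) auto
qed

text \<open>Nonzero constants have absolute value 1, so the leading term dominates. In particular
  \<theta> is transcendental over k.\<close>

lemma vabs_poly_theta:
  assumes "p \<in> kpoly" "p \<noteq> 0" shows "vabs (poly p \<theta>) = real q ^ degree p"
proof -
  define n where "n = degree p"
  have ck: "coeff p i \<in> kk" for i using assms by (auto simp: kpoly_def)
  have "poly p \<theta> = (\<Sum>i\<le>n. coeff p i * \<theta> ^ i)" by (simp add: poly_altdef n_def)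
  also have "\<dots> = coeff p n * \<theta> ^ n + (\<Sum>i<n. coeff p i * \<theta> ^ i)"
    by (simp add: add.commute flip: lessThan_Suc_atMost)
  finally have eq: "poly p \<theta> = coeff p n * \<theta> ^ n + (\<Sum>i<n. coeff p i * \<theta> ^ i)" .
  have lead: "vabs (coeff p n * \<theta> ^ n) = real q ^ n"
    using vabs_kk[OF ck[of n]] assms(2) by (simp add: vabs_mult vabs_power vabs_theta n_def)
  have "vabs (\<Sum>i<n. coeff p i * \<theta> ^ i) < real q ^ n"
  proof (cases n)
    case (Suc m)
    have "vabs (\<Sum>i<n. coeff p i * \<theta> ^ i) \<le> real q ^ m"
    proof (rule vabs_sum_le)
      fix i assume "i \<in> {..<n}"
      then have "real q ^ i \<le> real q ^ m" using q_ge_2 Suc by (intro power_increasing) auto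
      then have "vabs (coeff p i) * real q ^ i \<le> 1 * real q ^ m"
        using vabs_kk_le[OF ck[of i]] by (intro mult_mono) auto
      then show "vabs (coeff p i * \<theta> ^ i) \<le> real q ^ m" by (simp add: vabs_mult vabs_power vabs_theta)
    qed auto
    also have "real q ^ m < real q ^ n" using q_ge_2 Suc by (intro power_strict_increasing) auto
    finally show ?thesis .
  qed simp
  then show ?thesis unfolding eq n_def[symmetric] using lead by (subst vabs_add_eq) auto
qed

lemma poly_theta_eq_0: "p \<in> kpoly \<Longrightarrow> poly p \<theta> = 0 \<longleftrightarrow> p = 0"
  using vabs_poly_theta[of p] q_ge_2 by (cases "p = 0") auto

lemma poly_theta_inj:
  assumes "p \<in> kpoly" "p' \<in> kpoly" "poly p \<theta> = poly p' \<theta>" shows "p = p'"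
  using poly_theta_eq_0[OF subring_diff[OF kpoly_subring assms(1,2)]] assms(3) by simp

lemma frob_poly_hom:
  defines "\<phi> \<equiv> map_poly (\<lambda>x::'c. x ^ (q ^ d))"
  shows "\<phi> (a + b) = \<phi> a + \<phi> b" "\<phi> (a * b) = \<phi> a * \<phi> b" "p \<in> kpoly \<longleftrightarrow> \<phi> p = p"
    "degree (\<phi> a) = degree a"
proof -
  have 0: "(0::'c) ^ (q ^ d) = 0" using q_ge_2 by (simp add: power_0_left)
  have c: "coeff (\<phi> p) i = coeff p i ^ (q ^ d)" for p i
    unfolding \<phi>_def using 0 by (simp add: coeff_map_poly)
  have s: "sum f I ^ (q ^ d) = (\<Sum>i\<in>I. f i ^ (q ^ d))" for f :: "nat \<Rightarrow> 'c" and I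
    by (induction I rule: infinite_finite_induct) (simp_all add: frob_pow 0)
  show "\<phi> (a + b) = \<phi> a + \<phi> b" by (rule poly_eqI) (simp add: c frob_pow)
  show "\<phi> (a * b) = \<phi> a * \<phi> b" by (rule poly_eqI) (simp add: c s coeff_mult power_mult_distrib)
  show "p \<in> kpoly \<longleftrightarrow> \<phi> p = p" by (auto simp: poly_eq_iff c kpoly_def kk_def)
  show "degree (\<phi> a) = degree a" unfolding \<phi>_def by (rule degree_map_poly) (simp add: q)
qed

text \<open>Division takes place in the big polynomial ring. The coefficientwise Frobenius fixes
  \<open>p\<close> and \<open>g\<close>, hence also quotient and remainder by their
  uniqueness.\<close>

lemma kpoly_div_mod:
  assumes "p \<in> kpoly" "g \<in> kpoly"
  shows "p div g \<in> kpoly" "p mod g \<in> kpoly"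
proof -
  let ?\<phi> = "map_poly (\<lambda>x::'c. x ^ (q ^ d))"
  have "p div g \<in> kpoly \<and> p mod g \<in> kpoly"
  proof (cases "g = 0")
    case True
    then show ?thesis using assms kpoly_0 by simp
  next
    case False
    have p: "p div g * g + p mod g = p" by simp
    have "?\<phi> (p div g) * g + ?\<phi> (p mod g) = p"
      using frob_poly_hom(1)[of "p div g * g" "p mod g"] frob_poly_hom(2)[of "p div g" g]
        frob_poly_hom(3)[of p] frob_poly_hom(3)[of g] assms p by metis
    then have eq: "(p div g - ?\<phi> (p div g)) * g = ?\<phi> (p mod g) - p mod g"
      using p by (simp add: algebra_simps)
    have "p div g - ?\<phi> (p div g) = 0"
    proof (rule ccontr)
      assume D: "p div g - ?\<phi> (p div g) \<noteq> 0"
      then have nz: "?\<phi> (p mod g) - p mod g \<noteq> 0" using eq False by (metis mult_eq_0_iff)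
      then have m0: "p mod g \<noteq> 0" by auto
      have "degree g \<le> degree ((p div g - ?\<phi> (p div g)) * g)" using D False by (simp add: degree_mult_eq)
      also have "\<dots> \<le> degree (p mod g)" unfolding eq
        using frob_poly_hom(4)[of "p mod g"] by (intro degree_diff_le) auto
      also have "\<dots> < degree g" using degree_mod_less[OF False, of p] m0 by blast
      finally show False by simp
    qed
    moreover from this have "?\<phi> (p mod g) - p mod g = 0" using eq by simp
    ultimately show ?thesis using frob_poly_hom(3)[of "p div g"] frob_poly_hom(3)[of "p mod g"] by simp
  qed
  then show "p div g \<in> kpoly" "p mod g \<in> kpoly" by auto
qed

lemma kpoly_dvdE:
  assumes "p \<in> kpoly" "g \<in> kpoly" "g dvd p"
  obtains h where "h \<in> kpoly" "p = g * h"
  using kpoly_div_mod(1)[OF assms(1,2)] assms(3) by (metis dvd_mult_div_cancel)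

lemma RR_dvd_iff:
  assumes "p \<in> kpoly" "g \<in> kpoly"
  shows "poly p \<theta> \<in> (*) (poly g \<theta>) ` RR \<longleftrightarrow> g dvd p"
proof
  assume "poly p \<theta> \<in> (*) (poly g \<theta>) ` RR"
  then obtain h where h: "h \<in> kpoly" "poly p \<theta> = poly (g * h) \<theta>" by (auto simp: RR_kpoly)
  then have "p = g * h" using assms by (intro poly_theta_inj subring_mult[OF kpoly_subring])
  then show "g dvd p" by simp
next
  assume "g dvd p"
  then obtain h where h: "h \<in> kpoly" "p = g * h" by (rule kpoly_dvdE[OF assms])
  then have "poly h \<theta> \<in> RR" by (auto simp: RR_kpoly)
  then show "poly p \<theta> \<in> (*) (poly g \<theta>) ` RR"
    by (rule image_eqI[rotated]) (simp only: h(2) poly_mult)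
qed

text \<open>The hypothesis \<open>min\<close> makes \<open>g\<close> a prime of k[X]. If the gcd of
  \<open>g\<close> and \<open>p\<close>, written as a Bezout combination, were a constant
  \<open>c\<close>, the Frobenius would make \<open>c ^ q\<close> a multiple of
  \<open>g\<close>.\<close>

lemma kpoly_root_dvd:
  assumes g: "g \<in> kpoly" "degree g > 0"
    and min: "\<And>h. h \<in> kpoly \<Longrightarrow> degree h > 0 \<Longrightarrow> h dvd g \<Longrightarrow> degree g \<le> degree h"
    and x: "x \<in> RR" "x ^ q \<in> (*) (poly g \<theta>) ` RR"
  shows "x \<in> (*) (poly g \<theta>) ` RR"
proof -
  note cl = subring_add[OF kpoly_subring] subring_mult[OF kpoly_subring] subring_diff[OF kpoly_subring]
    subring_0[OF kpoly_subring] subring_1[OF kpoly_subring]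
  obtain p where p: "p \<in> kpoly" "x = poly p \<theta>" using x(1) by (auto simp: RR_kpoly)
  define I where "I = {a * g + b * p |a b. a \<in> kpoly \<and> b \<in> kpoly}"
  have II: "a * g + b * p \<in> I" if "a \<in> kpoly" "b \<in> kpoly" for a b using that by (auto simp: I_def)
  have gI: "g \<in> I" and pI: "p \<in> I" using II[of 1 0] II[of 0 1] cl by auto
  have "g \<noteq> 0" using g by auto
  then obtain h where h: "h \<in> I" "h \<noteq> 0" "\<And>r. r \<in> I \<Longrightarrow> r \<noteq> 0 \<Longrightarrow> degree h \<le> degree r"
    using degree_ideal_generator[OF gI] by blast
  obtain a b where ab: "a \<in> kpoly" "b \<in> kpoly" "h = a * g + b * p" using h(1) by (auto simp: I_def)
  have hk: "h \<in> kpoly" unfolding ab(3) by (intro cl ab g p)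
  have dvd: "h dvd r" if "r \<in> I" "r \<in> kpoly" for r
  proof -
    obtain a' b' where ab': "a' \<in> kpoly" "b' \<in> kpoly" "r = a' * g + b' * p" using \<open>r \<in> I\<close> by (auto simp: I_def)
    let ?c = "r div h"
    have ck: "?c \<in> kpoly" by (rule kpoly_div_mod[OF \<open>r \<in> kpoly\<close> hk])
    have "r mod h = r - ?c * h" by (simp add: minus_div_mult_eq_mod)
    also have "\<dots> = (a' - ?c * a) * g + (b' - ?c * b) * p"
      unfolding ab(3)[symmetric] by (subst ab'(3), subst (2) ab(3)) (simp add: algebra_simps)
    finally have "r mod h \<in> I" using II[of "a' - ?c * a" "b' - ?c * b"] ab ab' ck cl by auto
    then have "r mod h = 0" using h(3)[of "r mod h"] degree_mod_less[OF h(2), of r] by fastforce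
    then show ?thesis by (simp add: mod_eq_0_iff_dvd)
  qed
  have hg: "h dvd g" and hp: "h dvd p" using dvd gI pI g p by auto
  show ?thesis
  proof (cases "degree h > 0")
    case True
    then have le: "degree g \<le> degree h" using min hk hg by blast
    obtain c where c: "g = h * c" using hg by (auto simp: dvd_def)
    then have "degree g = degree h + degree c" using \<open>g \<noteq> 0\<close> by (auto simp: degree_mult_eq)
    then have "degree c = 0" using le by simp
    then have "c dvd 1" using c \<open>g \<noteq> 0\<close> by (metis is_unit_iff_degree mult_zero_right)
    then have "g dvd h" using c by (metis dvd_refl mult_unit_dvd_iff)
    then have "g dvd p" using hp dvd_trans by blast
    then show ?thesis using RR_dvd_iff[OF p(1) g(1)] p(2) by simp
  next
    case False
    then obtain c where c: "h = [:c:]" "c \<noteq> 0" using h(2) by (auto elim: degree_eq_zeroE)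
    have ck: "c \<in> kk" using hk c by (simp add: kpoly_pCons)
    obtain s where s: "s \<in> kpoly" "x ^ q = poly (g * s) \<theta>" using x(2) by (auto simp: RR_kpoly)
    have "c = poly (a * g) \<theta> + poly (b * p) \<theta>"
      using arg_cong[OF ab(3), of "\<lambda>r. poly r \<theta>"] c(1) by simp
    then have "c ^ q = (poly (a * g) \<theta> + poly (b * p) \<theta>) ^ q" by (rule arg_cong)
    also have "\<dots> = poly (a * g) \<theta> ^ q + poly (b * p) \<theta> ^ q" by (rule frob)
    also have "poly (a * g) \<theta> ^ q = poly (a ^ q * g ^ q) \<theta>" by (simp add: power_mult_distrib poly_power)
    also have "poly (b * p) \<theta> ^ q = poly (b ^ q * (g * s)) \<theta>" 
      using s(2) p(2) by (simp add: power_mult_distrib poly_power)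
    finally have "poly [:c ^ q:] \<theta> = poly (a ^ q * g ^ q + b ^ q * (g * s)) \<theta>" by simp
    then have "[:c ^ q:] = a ^ q * g ^ q + b ^ q * (g * s)"
    proof (rule poly_theta_inj[rotated 2])
      show "[:c ^ q:] \<in> kpoly" using subring_power[OF kk_subring ck] by (simp add: kpoly_pCons kpoly_0)
      show "a ^ q * g ^ q + b ^ q * (g * s) \<in> kpoly" by (intro cl subring_power[OF kpoly_subring] ab g s)
    qed
    moreover have "g dvd a ^ q * g ^ q + b ^ q * (g * s)"
      using q_ge_2 by (intro dvd_add dvd_mult[of g "g ^ q"] dvd_mult[of g "g * s"]) (auto intro: dvd_power)
    ultimately have "g dvd [:c ^ q:]" by simp
    then have "degree g \<le> 0" using c(2) dvd_imp_degree_le[of g "[:c ^ q:]"] by simp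
    then show ?thesis using g(2) by simp
  qed
qed

text \<open>Division of \<open>g\<close> by X - a leaves the nonzero constant g(a), so
  \<open>poly g a - poly g \<theta>\<close> is a multiple of \<open>a - \<theta>\<close>.\<close>

lemma RR_unit_mod:
  assumes g: "g \<in> kpoly" and a: "a \<in> kk" "poly g a \<noteq> 0"
  shows "\<exists>v\<in>RR. \<exists>r\<in>RR. (a - \<theta>) * v = 1 + poly g \<theta> * r"
proof -
  note kcl = subring_1[OF kk_subring] subring_uminus[OF kk_subring]
  define c where "c = poly g a"
  have ck: "c \<in> kk" unfolding c_def using g a by (intro subring_poly[OF kk_subring]) (auto simp: kpoly_def)
  let ?l = "[:- a, 1:]"
  have lk: "?l \<in> kpoly" using a kcl by (simp add: kpoly_pCons kpoly_0)
  have "poly (g - [:c:]) a = 0" by (simp add: c_def)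
  then have ld: "?l dvd g - [:c:]" by (simp only: poly_eq_0_iff_dvd)
  have gk: "g - [:c:] \<in> kpoly" using g ck by (intro subring_diff[OF kpoly_subring]) (auto simp: kpoly_pCons kpoly_0)
  obtain s where s: "s \<in> kpoly" "g - [:c:] = ?l * s" by (rule kpoly_dvdE[OF gk lk ld])
  have "poly g \<theta> - c = (\<theta> - a) * poly s \<theta>" using arg_cong[OF s(2), of "\<lambda>p. poly p \<theta>"] by (simp add: algebra_simps)
  then have e: "(a - \<theta>) * poly s \<theta> = c - poly g \<theta>" by (simp add: algebra_simps)
  have "(a - \<theta>) * (poly s \<theta> * inverse c) = 1 + poly g \<theta> * (- inverse c)"
    unfolding mult.assoc[symmetric] e using a(2) by (simp add: c_def left_diff_distrib)
  moreover have "inverse c \<in> RR" by (intro kk_RR kk_inverse ck)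
  moreover have "poly s \<theta> \<in> RR" using s by (auto simp: RR_kpoly)
  ultimately show ?thesis using subring_mult[OF RR_subring] subring_uminus[OF RR_subring] by blast
qed

definition zt :: "nat \<Rightarrow> 'c" where "zt i = \<zeta> ^ (q ^ (i - 1))"

lemma zt_kk: "zt i \<in> kk"
  unfolding zt_def by (rule subring_power[OF kk_subring zeta_kk])

lemma kk_prv:
  assumes b: "b \<in> kk" and i: "i \<in> {1..d}"
  shows "(b ^ (q ^ (prv d i - 1))) ^ q = b ^ (q ^ (i - 1))"
proof (cases "i = 1")
  case True
  have "(b ^ (q ^ (prv d i - 1))) ^ q = b ^ (q ^ Suc (d - 1))"
    using True by (simp add: prv_def pow_q_Suc del: power_Suc)
  also have "\<dots> = b" using b d_pos by (simp add: kk_def)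
  finally show ?thesis using True by simp
next
  case False
  then have "i - 1 = Suc (i - 1 - 1)" using i by auto
  then show ?thesis using False unfolding prv_def by (simp only: if_False pow_q_Suc[symmetric])
qed

lemma zt_prv: "i \<in> {1..d} \<Longrightarrow> zt (prv d i) ^ q = zt i"
  unfolding zt_def by (rule kk_prv[OF zeta_kk])

lemma frob_pow_inj: "(x::'c) ^ (q ^ s) = y ^ (q ^ s) \<Longrightarrow> x = y"
  using frob_pow_diff[of x y s] by simp

text \<open>A power \<open>q ^ s\<close> of the Frobenius fixing \<zeta> would fix all of
  F_q(\<zeta>), giving at least \<open>q ^ d\<close> roots of a polynomial of degree
  \<open>q ^ s\<close>.\<close>

lemma zeta_orbit: assumes "a < b" "b < d" shows "\<zeta> ^ (q ^ a) \<noteq> \<zeta> ^ (q ^ b)"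
proof
  assume eq: "\<zeta> ^ (q ^ a) = \<zeta> ^ (q ^ b)"
  define s where "s = b - a"
  have s: "s > 0" "s < d" using assms by (auto simp: s_def)
  have "\<zeta> ^ (q ^ b) = (\<zeta> ^ (q ^ s)) ^ (q ^ a)"
    using assms by (simp add: s_def flip: power_mult power_add)
  then have zs: "\<zeta> ^ (q ^ s) = \<zeta>" using eq frob_pow_inj[of \<zeta> a "\<zeta> ^ (q ^ s)"] by metis
  have Fs: "Fq_emb \<iota> c ^ (q ^ s) = Fq_emb \<iota> c" for c s
    by (induction s) (simp_all only: pow_q_Suc Fq_emb_frob power_0 power_one_right)
  have "kk \<subseteq> {x. x ^ (q ^ s) = x}"
  proof
    fix x assume "x \<in> kk"
    then obtain f where "x = ev f" unfolding kk_eq by blast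
    moreover have "ev f ^ (q ^ s) = ev f"
      unfolding ev_def
    proof (induction f)
      case 0
      then show ?case using q_ge_2 by (simp add: power_0_left)
    next
      case (pCons c f)
      have "poly (Fp (pCons c f)) \<zeta> = Fq_emb \<iota> c + \<zeta> * poly (Fp f) \<zeta>" 
        using pCons.hyps by (simp add: map_poly_pCons)
      then show ?case using pCons.IH by (simp add: frob_pow power_mult_distrib Fs zs)
    qed
    ultimately show "x \<in> {x. x ^ (q ^ s) = x}" by simp
  qed
  then have "card kk \<le> q ^ s" using frob_fixed_card[OF s(1)] card_mono le_trans by blast
  moreover have "q ^ s < q ^ d" using s q_ge_2 by (intro power_strict_increasing) auto
  ultimately show False by (simp add: card_kk)
qed

lemma zt_inj: "inj_on zt {1..d}"
proof (rule inj_onI)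
  fix i j assume *: "i \<in> {1..d}" "j \<in> {1..d}" "zt i = zt j"
  show "i = j"
  proof (cases i j rule: linorder_cases)
    case less
    then have "i - 1 < j - 1" "j - 1 < d" using * by auto
    then show ?thesis using zeta_orbit *(3) unfolding zt_def by blast
  next
    case greater
    then have "j - 1 < i - 1" "i - 1 < d" using * by auto
    then show ?thesis using zeta_orbit *(3)[symmetric] unfolding zt_def by blast
  qed
qed

section \<open>The embedding of A and the equality of A[\<zeta>] with k[\<theta>]\<close>

lemma A_emb_add: "A_emb \<iota> (a + b) = A_emb \<iota> a + A_emb \<iota> b"
  and A_emb_mult: "A_emb \<iota> (a * b) = A_emb \<iota> a * A_emb \<iota> b"
  and A_emb_const: "A_emb \<iota> [:c:] = Fq_emb \<iota> c"
  and A_emb_theta: "A_emb \<iota> [:0, 1:] = \<theta>"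
  by (simp_all add: A_emb_def Fp_add Fp_mult Fp_const map_poly_pCons)

lemma A_emb_0 [simp]: "A_emb \<iota> 0 = 0" and A_emb_1 [simp]: "A_emb \<iota> 1 = 1"
  by (simp_all add: A_emb_def one_pCons Fp_const)

lemma A_emb_power: "A_emb \<iota> (a ^ n) = A_emb \<iota> a ^ n"
  by (induction n) (auto simp: A_emb_mult)

lemma A_emb_kpoly: "Fp a \<in> kpoly"
  by (simp add: kpoly_def Fq_emb_kk)

lemma A_emb_RR: "A_emb \<iota> a \<in> RR"
  unfolding RR_kpoly A_emb_def using A_emb_kpoly by blast

lemma kk_adjoin: "kk \<subseteq> adjoin (range (A_emb \<iota>)) \<zeta>"
proof
  fix x assume "x \<in> kk"
  then obtain f where f: "x = poly (Fp f) \<zeta>" by (auto simp: kk_eq ev_def)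
  have "range (A_emb \<iota>) \<union> {\<zeta>} \<subseteq> adjoin (range (A_emb \<iota>)) \<zeta>" unfolding adjoin_def by (rule hull_subset)
  then show "x \<in> adjoin (range (A_emb \<iota>)) \<zeta>"
    unfolding f by (intro subring_poly) (auto simp: adjoin_def is_subring_hull simp flip: A_emb_const)
qed

lemma RR_eq: "adjoin (range (A_emb \<iota>)) \<zeta> = RR"
proof (rule antisym)
  show "adjoin (range (A_emb \<iota>)) \<zeta> \<subseteq> RR"
    unfolding adjoin_def using A_emb_RR kk_RR[OF zeta_kk] RR_subring by (intro hull_minimal) auto
  show "RR \<subseteq> adjoin (range (A_emb \<iota>)) \<zeta>"
  proof
    fix x assume "x \<in> RR"
    then obtain p where p: "\<And>i. coeff p i \<in> kk" "x = poly p \<theta>" by (auto simp: RR_def)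
    have "\<theta> \<in> range (A_emb \<iota>)" using A_emb_theta by (metis rangeI)
    then have "\<theta> \<in> adjoin (range (A_emb \<iota>)) \<zeta>" unfolding adjoin_def by (intro hull_inc) auto
    then show "x \<in> adjoin (range (A_emb \<iota>)) \<zeta>" unfolding p(2)
      using p(1) kk_adjoin by (intro subring_poly) (auto simp: adjoin_def is_subring_hull)
  qed
qed

end

section \<open>The tower of rings\<close>

lemma digit_sum_less:
  assumes "\<And>s. s < d \<Longrightarrow> a s < (q::nat)"
  shows "(\<Sum>s<d. a s * q ^ s) < q ^ d"
  using assms
proof (induction d)
  case (Suc d)
  have "(\<Sum>s<d. a s * q ^ s) + a d * q ^ d < q ^ d + a d * q ^ d" using Suc by simp
  also have "\<dots> = (a d + 1) * q ^ d" by simp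
  also have "\<dots> \<le> q * q ^ d" using Suc.prems[of d] by (intro mult_right_mono) auto
  finally show ?case by simp
qed auto

lemma digit_sum_inj:
  assumes "\<And>s. s < d \<Longrightarrow> a s < (q::nat)" "\<And>s. s < d \<Longrightarrow> b s < q"
    "(\<Sum>s<d. a s * q ^ s) = (\<Sum>s<d. b s * q ^ s)" "s < d"
  shows "a s = b s"
  using assms
proof (induction d)
  case (Suc d)
  let ?A = "\<Sum>s<d. a s * q ^ s" and ?B = "\<Sum>s<d. b s * q ^ s"
  have lt: "?A < q ^ d" "?B < q ^ d" using Suc.prems by (auto intro!: digit_sum_less)
  have Q: "q ^ d \<noteq> 0" using lt(1) by (metis not_less_zero)
  have eq: "?A + a d * q ^ d = ?B + b d * q ^ d" using Suc.prems(3) by simp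
  have "(?A + a d * q ^ d) div q ^ d = a d" "(?B + b d * q ^ d) div q ^ d = b d"
    using lt Q by (simp_all only: div_mult_self1 div_less add_0_right not_False_eq_True)
  then have ab: "a d = b d" using eq by metis
  then have "?A = ?B" using eq by simp
  then show ?case using Suc ab by (cases "s = d") auto
qed auto

lemma digit_sum_max: "(\<Sum>s<d. (q - 1) * q ^ s) = q ^ d - (1::nat)"
proof (cases "q = 0")
  case False
  then have "(\<Sum>s<d. (q - 1) * q ^ s) + 1 = q ^ d"
  proof (induction d)
    case (Suc d)
    have "(\<Sum>s<Suc d. (q - 1) * q ^ s) + 1 = q ^ d + (q - 1) * q ^ d" using Suc by simp
    also have "\<dots> = (1 + (q - 1)) * q ^ d" by (simp only: distrib_right mult_1)
    also have "\<dots> = q ^ Suc d" using Suc.prems by simp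
    finally show ?case .
  qed auto
  then show ?thesis by simp
qed (cases d; simp)

context carlitz_prime
begin

text \<open>\<open>Wf n z\<close> is \<omega>^(n)(z), see \<open>hyperderiv_omega\<close>, and
  \<open>W n i\<close> is \<omega>^(n)(\<zeta>_i). The data \<open>u\<close> and \<open>l\<close>
  are the coefficients required by \<open>frob_step\<close>.\<close>

definition Wf :: "nat \<Rightarrow> 'c \<Rightarrow> 'c" where "Wf n z = lam * hyper n z"
definition W :: "nat \<Rightarrow> nat \<Rightarrow> 'c" where "W n i = Wf n (zt i)"
definition u :: "nat \<Rightarrow> 'c" where "u i = zt i - \<theta>"
definition l :: "nat \<Rightarrow> nat \<Rightarrow> 'c" where "l n i = (if n = 0 then 0 else W (n - 1) i)"
definition J :: "nat \<Rightarrow> (nat \<Rightarrow> nat) set" where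
  "J n = (if n = 0 then {..<const_index d (q - 1)} else {..const_index d (q - 1)})"

text \<open>The index is shifted by one: \<open>B (n + 1)\<close> will turn out to be \<open>A\<^sub>n[\<zeta>]\<close>, and \<open>B 0 = A[\<zeta>]\<close>.\<close>

primrec B :: "nat \<Rightarrow> 'c set" where
  "B 0 = RR"
| "B (Suc n) = mspan (B n) (J n) (W n) d"

lemma omega_pow_eq: "omega_pow \<iota> lam \<zeta> d n e = mpow (W n) d e"
  unfolding omega_pow_def mpow_def W_def Wf_def
  using hyperderiv_omega[OF vabs_kk_le[OF zt_kk], of n lam]
  by (simp add: zt_def flip: q)

text \<open>The factor \<open>lam ^ q = - \<theta> * lam\<close> clears the denominator \<theta> in
  \<open>hyper_frob\<close>.\<close>

lemma Wf_frob:
  assumes z: "z \<in> kk"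
  shows "Wf n z ^ q = (z ^ q - \<theta>) * Wf n (z ^ q) + (if n = 0 then 0 else Wf (n - 1) (z ^ q))"
proof -
  let ?H = "hyper n (z ^ q)" and ?H' = "if n = 0 then 0 else hyper (n - 1) (z ^ q)"
  have H': "(if n = 0 then 0 else Wf (n - 1) (z ^ q)) = lam * ?H'" by (simp add: Wf_def)
  have "Wf n z ^ q = - \<theta> * lam * (?H - (z ^ q * ?H + ?H') / \<theta>)"
    unfolding Wf_def power_mult_distrib lam_pow_q using hyper_frob[OF vabs_kk_le[OF z]] by simp
  also have "\<dots> = (- \<theta> * lam * ?H) + lam * (z ^ q * ?H + ?H') * (\<theta> / \<theta>)"
    by (simp only: right_diff_distrib) (simp add: mult_ac)
  also have "\<dots> = (z ^ q - \<theta>) * (lam * ?H) + lam * ?H'"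
    using theta_nz by (simp add: algebra_simps)
  finally show ?thesis unfolding H' by (simp only: Wf_def)
qed

lemma Wf_0_nz: assumes "z \<in> kk" shows "Wf 0 z \<noteq> 0"
proof -
  have "hyper 0 z = twist 0 z" by (simp add: hyper_def twist_def)
  then show ?thesis using twist_0_nz[OF vabs_kk_le[OF assms]] lam_nz by (simp add: Wf_def)
qed

lemma W_rel: "i \<in> {1..d} \<Longrightarrow> W n (prv d i) ^ q = u i * W n i + l n i"
  unfolding W_def l_def u_def using Wf_frob[OF zt_kk[of "prv d i"], of n] zt_prv[of i] by simp

lemma u_RR: "u i \<in> RR"
  unfolding u_def by (intro subring_diff[OF RR_subring] kk_RR zt_kk theta_RR)

text \<open>Since \<open>l 0 = 0\<close>, the product of the relations over all \<open>i\<close>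
  says that the \<open>q\<close>-th power of the product of the \<open>W 0 i\<close> is this product
  times that of the \<open>u i\<close>.\<close>

lemma W0_top: "mpow (W 0) d (const_index d (q - 1)) \<in> RR"
proof -
  let ?P = "\<Prod>i\<in>{1..d}. W 0 i"
  have nz: "?P \<noteq> 0" using Wf_0_nz[OF zt_kk] by (simp add: W_def)
  have "?P ^ q = (\<Prod>i\<in>{1..d}. W 0 (prv d i)) ^ q" by (simp only: prod_prv)
  also have "\<dots> = (\<Prod>i\<in>{1..d}. u i * W 0 i)"
    unfolding prod_power_distrib using W_rel[of _ 0] by (intro prod.cong) (auto simp: l_def)
  also have "\<dots> = (\<Prod>i\<in>{1..d}. u i) * ?P" by (rule prod.distrib)
  finally have "?P ^ Suc (q - 1) = (\<Prod>i\<in>{1..d}. u i) * ?P" using q_ge_2 by simp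
  then have "?P ^ (q - 1) = (\<Prod>i\<in>{1..d}. u i)" using nz by simp
  moreover have "mpow (W 0) d (const_index d (q - 1)) = ?P ^ (q - 1)"
    unfolding mpow_def prod_power_distrib by (intro prod.cong) (auto simp: const_index_def)
  ultimately show ?thesis using u_RR by (auto intro: subring_prod[OF RR_subring])
qed

lemma step_intro:
  assumes "is_subring (B n)" "RR \<subseteq> B n" "\<And>i. i \<in> {1..d} \<Longrightarrow> l n i \<in> B n"
  shows "frob_step (B n) (W n) u (l n) d q (J n)"
proof
  show "J n = {..const_index d (q - 1)} \<or> J n = {..<const_index d (q - 1)} \<and> mpow (W n) d (const_index d (q - 1)) \<in> B n"
    using W0_top assms(2) by (auto simp: J_def)
qed (use assms q_ge_2 d_pos u_RR frob W_rel in auto)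

lemma B_facts: "is_subring (B n) \<and> RR \<subseteq> B n \<and> (\<forall>i\<in>{1..d}. l n i \<in> B n)"
proof (induction n)
  case 0
  then show ?case using RR_subring by (auto simp: l_def subring_0)
next
  case (Suc n)
  then interpret frob_step "B n" "W n" u "l n" d q "J n" by (intro step_intro) auto
  show ?case using subring_T' T_sub Suc Y_in_T' by (auto simp: l_def simp del: atLeastAtMost_iff)
qed

lemma B_subring: "is_subring (B n)" and RR_B: "RR \<subseteq> B n"
  and step: "frob_step (B n) (W n) u (l n) d q (J n)"
  using B_facts[of n] step_intro[of n] by auto

lemma B_Suc: "B n \<subseteq> B (Suc n)"
  using frob_step.T_sub[OF step] by simp

lemma B_mono: "m \<le> n \<Longrightarrow> B m \<subseteq> B n"
  by (rule lift_Suc_mono_le[of B]) (use B_Suc in auto)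

lemma W_B: "i \<in> {1..d} \<Longrightarrow> m \<le> n \<Longrightarrow> W m i \<in> B (Suc n)"
  using frob_step.Y_in_T'[OF step, of i m] B_mono[of "Suc m" "Suc n"] by auto

lemma B_norm:
  "y \<in> B n \<Longrightarrow> y \<noteq> 0 \<Longrightarrow> \<exists>z\<in>B n. y * z \<in> RR \<and> y * z \<noteq> 0"
proof (induction n arbitrary: y)
  case 0
  then show ?case using subring_1[OF RR_subring] by (intro bexI[of _ 1]) auto
next
  case (Suc n)
  obtain z where z: "z \<in> B (Suc n)" "y * z \<in> B n" "y * z \<noteq> 0"
    using frob_step.norm_exists[OF step, of y n] Suc.prems by auto
  obtain z' where z': "z' \<in> B n" "(y * z) * z' \<in> RR" "(y * z) * z' \<noteq> 0" using Suc.IH[OF z(2,3)] by auto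
  have "z * z' \<in> B (Suc n)" using subring_mult[OF B_subring z(1), of z'] z'(1) B_Suc by blast
  then show ?case using z' by (intro bexI[of _ "z * z'"]) (auto simp: mult.assoc)
qed

text \<open>A nonzero polynomial is not divisible by a power of \<open>p\<close> of larger degree
  than its own.\<close>

lemma RR_sep:
  assumes t: "t \<in> RR" and p: "p \<in> kpoly" "degree p > 0" and all: "\<And>s. t \<in> (*) (poly p \<theta> ^ s) ` RR"
  shows "t = 0"
proof (rule ccontr)
  assume "t \<noteq> 0"
  obtain f where f: "f \<in> kpoly" "t = poly f \<theta>" using t by (auto simp: RR_kpoly)
  have "f \<noteq> 0" using f \<open>t \<noteq> 0\<close> by auto
  have "p ^ Suc (degree f) dvd f"
    using all[of "Suc (degree f)"] f p subring_power[OF kpoly_subring p(1)]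
    by (subst RR_dvd_iff[symmetric]) (auto simp: poly_power simp del: power_Suc)
  then have "degree (p ^ Suc (degree f)) \<le> degree f" using \<open>f \<noteq> 0\<close> by (rule dvd_imp_degree_le)
  moreover have "degree (p ^ Suc (degree f)) = Suc (degree f) * degree p"
    using p by (subst degree_power_eq) auto
  moreover have "Suc (degree f) * 1 \<le> Suc (degree f) * degree p" using p by (intro mult_le_mono2) auto
  ultimately show False by simp
qed

end

section \<open>Valuations at the primes above \<open>\<pp>\<close>\<close>

text \<open>The roots of \<open>\<pp>\<close> in order, starting from \<open>\<alpha> = \<zeta>\<^bsub>i0\<^esub>\<close>; \<open>rot i\<close> is the position of \<open>\<zeta>\<^sub>i\<close>.\<close>

locale carlitz_val = carlitz_prime \<iota> q lam \<zeta> \<pp> d + val_ring V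
  for \<iota> :: "'a::{field,finite} fls alg_closure \<Rightarrow> 'c::{nonarch_field,complete_space}"
    and q :: nat and lam \<zeta> :: 'c and \<pp> :: "'a poly" and d :: nat and V :: "'c set" +
  fixes i0 :: nat
  assumes i0: "i0 \<in> {1..d}" and RR_V: "RR \<subseteq> V" and pi_max: "\<theta> - zt i0 \<in> max_ideal"
begin

definition "\<alpha> = zt i0"
definition "\<pi> = \<theta> - \<alpha>"
definition Z :: "nat \<Rightarrow> nat \<Rightarrow> 'c" where "Z n s = Wf n (\<alpha> ^ (q ^ s))"
definition rot :: "nat \<Rightarrow> nat" where "rot i = (if i0 \<le> i then i - i0 else i + d - i0)"
definition unrot :: "nat \<Rightarrow> nat" where "unrot s = (if i0 + s \<le> d then i0 + s else i0 + s - d)"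

lemma rot_less: "i \<in> {1..d} \<Longrightarrow> rot i < d"
  using i0 by (auto simp: rot_def)

lemma sum_rot: "(\<Sum>i\<in>{1..d}. f i (rot i)) = (\<Sum>s<d. f (unrot s) s)"
  by (rule sum.reindex_bij_witness[of _ unrot rot])
    (use i0 in \<open>auto simp: rot_def unrot_def split: if_splits\<close>)

lemma rot_unrot: "s < d \<Longrightarrow> unrot s \<in> {1..d} \<and> rot (unrot s) = s"
    and unrot_rot: "i \<in> {1..d} \<Longrightarrow> unrot (rot i) = i"
  using i0 by (auto simp: rot_def unrot_def split: if_splits)

lemma alpha_kk: "\<alpha> \<in> kk"
  by (simp add: \<alpha>_def zt_kk)

lemma alpha_pow_kk: "\<alpha> ^ (q ^ s) \<in> kk"
  by (rule subring_power[OF kk_subring alpha_kk])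

lemma alpha_pow_d: "\<alpha> ^ (q ^ d) = \<alpha>"
  using alpha_kk by (simp add: kk_def)

lemma alpha_pow: "\<alpha> ^ (q ^ s) = \<zeta> ^ (q ^ (i0 - 1 + s))"
  by (simp add: \<alpha>_def zt_def power_add power_mult)

lemma zt_rot: assumes "i \<in> {1..d}" shows "zt i = \<alpha> ^ (q ^ rot i)"
proof (cases "i0 \<le> i")
  case True
  then have "i0 - 1 + rot i = i - 1" using i0 by (auto simp: rot_def)
  then show ?thesis unfolding alpha_pow zt_def by simp
next
  case False
  then have "i0 - 1 + rot i = d + (i - 1)" using i0 assms by (auto simp: rot_def)
  then have "\<alpha> ^ (q ^ rot i) = (\<zeta> ^ (q ^ d)) ^ (q ^ (i - 1))"
    unfolding alpha_pow by (simp only: power_add power_mult)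
  then show ?thesis using zeta_kk by (simp add: zt_def kk_def)
qed

lemma W_Z: "i \<in> {1..d} \<Longrightarrow> W n i = Z n (rot i)"
  by (simp add: W_def Z_def zt_rot)

lemma alpha_orbit: assumes "0 < s" "s < d" shows "\<alpha> ^ (q ^ s) \<noteq> \<alpha>"
proof
  assume "\<alpha> ^ (q ^ s) = \<alpha>"
  then have "(\<zeta> ^ (q ^ s)) ^ (q ^ (i0 - 1)) = \<zeta> ^ (q ^ (i0 - 1))"
    unfolding alpha_pow by (simp add: \<alpha>_def zt_def add.commute power_add power_mult)
  then have "\<zeta> ^ (q ^ s) = \<zeta>" by (rule frob_pow_inj)
  then show False using zeta_orbit[of 0 s] assms by simp
qed

lemma pi_kpoly: "[:- \<alpha>, 1:] \<in> kpoly" "poly [:- \<alpha>, 1:] \<theta> = \<pi>"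
  using alpha_kk subring_uminus[OF kk_subring] subring_1[OF kk_subring]
  by (auto simp: kpoly_pCons kpoly_0 \<pi>_def)

lemma pi_m: "\<pi> \<in> max_ideal"
  using pi_max by (simp add: \<pi>_def \<alpha>_def)

lemma pi_RR: "\<pi> \<in> RR"
  unfolding RR_kpoly using pi_kpoly by metis

lemma pi_nz: "\<pi> \<noteq> 0"
  using poly_theta_eq_0[OF pi_kpoly(1)] pi_kpoly(2) by auto

lemma kk_unit: assumes "c \<in> kk" "c \<noteq> 0" shows "val_eq c 1"
  using kk_RR[OF assms(1)] kk_RR[OF kk_inverse[OF assms(1)]] RR_V assms(2)
  by (auto simp: val_eq_def inverse_eq_divide)

text \<open>Division by X - \<alpha> gives \<open>x = c + \<pi> * h\<close> with a constant
  \<open>c\<close>, which is nonzero and hence a unit of \<open>V\<close>.\<close>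

lemma RR_unit: assumes "x \<in> RR" "x \<notin> (*) \<pi> ` RR" shows "val_eq x 1"
proof -
  obtain p where p: "p \<in> kpoly" "x = poly p \<theta>" using assms by (auto simp: RR_kpoly)
  define c where "c = poly p \<alpha>"
  have ck: "c \<in> kk" unfolding c_def using p alpha_kk by (intro subring_poly[OF kk_subring]) (auto simp: kpoly_def)
  have "\<not> [:- \<alpha>, 1:] dvd p" using RR_dvd_iff[OF p(1) pi_kpoly(1)] assms(2) p(2) pi_kpoly(2) by simp
  then have c0: "c \<noteq> 0" by (simp only: c_def poly_eq_0_iff_dvd not_False_eq_True)
  have pc: "p - [:c:] \<in> kpoly" using p ck by (intro subring_diff[OF kpoly_subring]) (auto simp: kpoly_pCons kpoly_0)
  have "poly (p - [:c:]) \<alpha> = 0" by (simp add: c_def)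
  then have "[:- \<alpha>, 1:] dvd p - [:c:]" by (simp only: poly_eq_0_iff_dvd)
  then obtain h where h: "h \<in> kpoly" "p - [:c:] = [:- \<alpha>, 1:] * h" by (rule kpoly_dvdE[OF pc pi_kpoly(1)])
  have "x - c = poly (p - [:c:]) \<theta>" using p(2) by simp
  also have "\<dots> = \<pi> * poly h \<theta>" unfolding h(2) by (simp only: poly_mult pi_kpoly(2))
  finally have x: "x = c + \<pi> * poly h \<theta>" by (simp add: algebra_simps)
  have "poly h \<theta> \<in> RR" using h(1) by (auto simp: RR_kpoly)
  then have "poly h \<theta> / c \<in> V"
    using kk_RR[OF kk_inverse[OF ck]] RR_V by (auto simp: divide_inverse intro!: V_closed(4))
  then have "\<pi> * (poly h \<theta> / c) \<in> max_ideal" by (rule max_mult[OF pi_m])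
  then have "val_eq (c + \<pi> * poly h \<theta>) c" by (intro val_eq_add c0) simp
  from val_eq_trans[OF this kk_unit[OF ck c0]] show ?thesis unfolding x .
qed

text \<open>The coefficient of \<open>Z n s\<close> in the Frobenius relation that leads to it.
  Counting from \<alpha>, it is a unit for 0 < s < d, and the only non-unit,
  \<open>us d = - \<pi>\<close>, belongs to the step that closes the cycle.\<close>

definition us :: "nat \<Rightarrow> 'c" where "us s = \<alpha> ^ (q ^ s) - \<theta>"

lemma us_unit: assumes "0 < s" "s < d" shows "val_eq (us s) 1"
proof -
  have c: "\<alpha> ^ (q ^ s) - \<alpha> \<noteq> 0" using alpha_orbit[OF assms] by simp
  have ck: "\<alpha> ^ (q ^ s) - \<alpha> \<in> kk" by (intro subring_diff[OF kk_subring] alpha_pow_kk alpha_kk)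
  have "inverse (\<alpha> ^ (q ^ s) - \<alpha>) \<in> V" using kk_RR[OF kk_inverse[OF ck]] RR_V by auto
  then have "- \<pi> / (\<alpha> ^ (q ^ s) - \<alpha>) \<in> max_ideal"
    unfolding divide_inverse by (intro max_mult max_uminus pi_m)
  then have "val_eq ((\<alpha> ^ (q ^ s) - \<alpha>) + - \<pi>) (\<alpha> ^ (q ^ s) - \<alpha>)" by (rule val_eq_add[OF c])
  then have "val_eq (us s) (\<alpha> ^ (q ^ s) - \<alpha>)" by (simp add: us_def \<pi>_def)
  from val_eq_trans[OF this kk_unit[OF ck c]] show ?thesis .
qed

lemma us_V: "us s \<in> V"
  unfolding us_def by (rule subring_diff[OF subring]) (use kk_RR[OF alpha_pow_kk] theta_RR RR_V in auto)

lemma Z_frob: "Z n s ^ q = us (Suc s) * Z n (Suc s) + (if n = 0 then 0 else Z (n - 1) (Suc s))"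
  unfolding Z_def us_def using Wf_frob[OF alpha_pow_kk, of n s] by (simp only: pow_q_Suc)

lemma us_d: "us d = - \<pi>" and Z_d: "Z n d = Z n 0"
  by (simp_all add: us_def Z_def alpha_pow_d \<pi>_def)

lemma Q_ge_2: "q ^ d \<ge> 2"
  using q_ge_2 self_le_power[of q d] d_pos by linarith

text \<open>As in \<open>integral_in_V\<close>; with \<open>n \<ge> 2\<close> both remaining powers
  of \<open>inverse x\<close> are positive.\<close>

lemma V_root:
  assumes "x ^ n = a * x + b" "a \<in> V" "b \<in> V" "n \<ge> 2" shows "x \<in> V"
proof (rule ccontr)
  assume x: "x \<notin> V"
  then have x0: "x \<noteq> 0" using V_closed by auto
  have y: "inverse x \<in> max_ideal" using x total[of x] by (auto simp: max_ideal_def)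
  have e: "x * inverse x ^ n = inverse x ^ (n - 1)"
    using x0 assms(4) by (cases n) auto
  have "1 = x ^ n * inverse x ^ n" using x0 by (simp add: power_inverse)
  also have "\<dots> = a * inverse x ^ (n - 1) + b * inverse x ^ n"
    unfolding assms(1) distrib_right e[symmetric] by (simp only: mult.assoc)
  also have "\<dots> \<in> max_ideal" using y assms by (intro max_add max_mult2 max_power) auto
  finally show False using one_notin_max by simp
qed

text \<open>After \<open>d\<close> applications of the relation the cycle closes, and Z^(q^d) = a Z
  + b with \<open>a\<close> and \<open>b\<close> in \<open>V\<close>.\<close>

lemma Z_V: "Z n s \<in> V"
proof (induction n arbitrary: s)
  have main: "Z n s \<in> V" if lV: "\<And>s. (if n = 0 then 0 else Z (n - 1) s) \<in> V" for n s
  proof -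
    have "\<exists>a b. a \<in> V \<and> b \<in> V \<and> Z n s ^ (q ^ k) = a * Z n (s + k) + b" for k
    proof (induction k)
      case 0
      show ?case by (intro exI[of _ 1] exI[of _ 0]) (auto simp: V_closed)
    next
      case (Suc k)
      then obtain a b where ab: "a \<in> V" "b \<in> V" "Z n s ^ (q ^ k) = a * Z n (s + k) + b" by auto
      let ?l = "if n = 0 then 0 else Z (n - 1) (Suc (s + k))"
      have "Z n s ^ (q ^ Suc k) = a ^ q * Z n (s + k) ^ q + b ^ q"
        unfolding pow_q_Suc ab(3) frob power_mult_distrib ..
      also have "\<dots> = a ^ q * us (Suc (s + k)) * Z n (s + Suc k) + (a ^ q * ?l + b ^ q)"
        unfolding Z_frob[of n "s + k"] add_Suc_right by (simp only: distrib_left mult.assoc add.assoc)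
      finally show ?case using ab lV[of "Suc (s + k)"]
        by (intro exI[of _ "a ^ q * us (Suc (s + k))"] exI[of _ "a ^ q * ?l + b ^ q"] conjI V_closed us_V) auto
    qed
    then obtain a b where ab: "a \<in> V" "b \<in> V" "Z n s ^ (q ^ d) = a * Z n (s + d) + b" by blast
    have "Z n (s + d) = Z n s" 
      unfolding Z_def add.commute[of s] power_add power_mult alpha_pow_d ..
    then show ?thesis using V_root[of "Z n s" "q ^ d" a b] ab Q_ge_2 by simp
  qed
  case 0
  show ?case by (rule main) (simp add: V_closed)
  case (Suc n)
  show ?case by (rule main) (simp add: Suc)
qed

text \<open>The value of \<pi> in units of the value of \<open>Z n 0\<close>. It is the number of
  units of A/\<pp>^(n+1), the ramification index.\<close>

definition M :: "nat \<Rightarrow> nat" where "M n = (q ^ d - 1) * (q ^ d) ^ n"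

lemma M_pos: "M n > 0" and M_Suc: "M (Suc n) = M n * q ^ d"
  using Q_ge_2 q_ge_2 by (auto simp: M_def)

lemma Z_chain:
  assumes "\<And>s. Suc s < d \<Longrightarrow> val_eq (Z n s ^ q) (Z n (Suc s))" "s < d" and nz: "Z n 0 \<noteq> 0"
  shows "val_eq (Z n s) (Z n 0 ^ (q ^ s))"
  using \<open>s < d\<close>
proof (induction s)
  case 0
  then show ?case using nz by (simp add: val_eq_refl)
next
  case (Suc s)
  have "val_eq (Z n (Suc s)) (Z n s ^ q)" by (rule val_eq_sym[OF assms(1)]) (use Suc in auto)
  also have "val_eq (Z n s ^ q) ((Z n 0 ^ (q ^ s)) ^ q)" using Suc by (intro val_eq_power) auto
  finally show ?case by (simp only: pow_q_Suc)
qed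

text \<open>Along the cycle each \<open>Z n (Suc s)\<close> has \<open>q\<close> times the value of
  \<open>Z n s\<close>. The closing relation fixes the scale: for n = 0 it compares
  \<open>Z 0 0 ^ (q ^ d)\<close> with \<open>\<pi> * Z 0 0\<close>, and for n > 0 the term
  \<open>Z (n - 1) 0\<close> dominates, so its value is that of
  \<open>Z n 0 ^ (q ^ d)\<close>.\<close>

lemma Z_val:
  "Z n 0 \<in> max_ideal \<and> Z n 0 \<noteq> 0 \<and> (\<forall>s<d. val_eq (Z n s) (Z n 0 ^ (q ^ s))) \<and> val_eq \<pi> (Z n 0 ^ M n)
    \<and> (n > 0 \<longrightarrow> val_eq (Z (n - 1) 0) (Z n 0 ^ (q ^ d)))"
proof (induction n)
  case 0
  have nz: "Z 0 s \<noteq> 0" for s unfolding Z_def by (rule Wf_0_nz[OF alpha_pow_kk])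
  have fr: "Z 0 s ^ q = us (Suc s) * Z 0 (Suc s)" for s using Z_frob[of 0 s] by simp
  have ch: "val_eq (Z 0 s ^ q) (Z 0 (Suc s))" if "Suc s < d" for s
    unfolding fr using val_eq_mult[OF us_unit[OF _ that] val_eq_refl[OF nz[of "Suc s"]]] by simp
  have c: "val_eq (Z 0 s) (Z 0 0 ^ (q ^ s))" if "s < d" for s
    by (rule Z_chain[OF ch that nz])
  have Sd: "Suc (d - 1) = d" using d_pos by simp
  have "- \<pi> * Z 0 0 = Z 0 (d - 1) ^ q" unfolding fr Sd us_d Z_d ..
  moreover have "val_eq (Z 0 (d - 1) ^ q) ((Z 0 0 ^ (q ^ (d - 1))) ^ q)"
    using c[of "d - 1"] d_pos by (intro val_eq_power) auto
  ultimately have "val_eq (- \<pi> * Z 0 0) (Z 0 0 ^ (q ^ d))" unfolding pow_q_Suc[symmetric] Sd by simp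
  from val_eq_div[OF this nz[of 0]] have "val_eq (- \<pi>) (Z 0 0 ^ (q ^ d) / Z 0 0)" using nz[of 0] by simp
  also have "Z 0 0 ^ (q ^ d) / Z 0 0 = Z 0 0 ^ M 0"
    using nz[of 0] Q_ge_2 by (simp add: M_def power_diff)
  finally have p: "val_eq (- \<pi>) (Z 0 0 ^ M 0)" .
  have "val_eq \<pi> (- \<pi>)" using pi_nz V_closed by (auto simp: val_eq_def)
  from val_eq_trans[OF this p] have p': "val_eq \<pi> (Z 0 0 ^ M 0)" .
  then have "Z 0 0 ^ M 0 \<in> max_ideal" using val_eq_max[OF val_eq_sym pi_m] by blast
  then have "Z 0 0 \<in> max_ideal" by (rule max_rootD)
  then show ?case using nz c p' by simp
next
  case (Suc n)
  let ?A = "Z n" and ?b = "Z (Suc n)"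
  have A0: "?A 0 \<in> max_ideal" "?A 0 \<noteq> 0" and A: "\<And>s. s < d \<Longrightarrow> val_eq (?A s) (?A 0 ^ (q ^ s))"
    and pA: "val_eq \<pi> (?A 0 ^ M n)" using Suc by auto
  have q0: "q > 0" using q_ge_2 by simp
  have As: "?A s \<in> max_ideal" if "s < d" for s
    using val_eq_max[OF A[OF that] max_power[OF A0(1)]] q0 by simp
  have fr: "?b s ^ q = us (Suc s) * ?b (Suc s) + ?A (Suc s)" for s using Z_frob[of "Suc n" s] by simp
  have Sd: "Suc (d - 1) = d" using d_pos by simp
  have top: "?b (d - 1) ^ q = ?A 0 + - \<pi> * ?b 0"
    using fr[of "d - 1"] unfolding Sd us_d Z_d by (simp only: add.commute)
  have "?b (d - 1) ^ q \<in> max_ideal"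
    unfolding top by (intro max_add A0 max_mult max_uminus pi_m Z_V)
  then have bt: "?b (d - 1) \<in> max_ideal" by (rule max_rootD)
  \<comment> \<open>Non-unit status descends from \<open>d - 1\<close> to 0: in the relation for
    \<open>?b s ^ q\<close> both terms on the right are non-units.\<close>
  have bm: "?b s \<in> max_ideal" if "s < d" for s
  proof -
    have "?b (d - 1 - j) \<in> max_ideal" if "j < d" for j
      using that
    proof (induction j)
      case 0
      then show ?case using bt by simp
    next
      case (Suc j)
      then have e: "Suc (d - 1 - Suc j) = d - 1 - j" by auto
      have "?b (d - 1 - Suc j) ^ q \<in> max_ideal"
        unfolding fr e using Suc by (intro max_add max_mult2 us_V As) auto
      then show ?case by (rule max_rootD)
    qed
    from this[of "d - 1 - s"] show ?thesis using that by simp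
  qed
  \<comment> \<open>\<pi> is a positive power of \<open>?A 0\<close> up to a unit, so
    \<open>\<pi> * ?b 0\<close> is negligible against \<open>?A 0\<close> in the closing relation
    \<open>top\<close>.\<close>
  have "\<pi> / ?A 0 \<in> V"
    using pA A0 M_pos[of n] V_closed(4)[of "\<pi> / ?A 0 ^ M n" "?A 0 ^ (M n - 1)"] max_ideal_V
    by (cases "M n") (auto simp: val_eq_def V_closed)
  then have "?b 0 * (- (\<pi> / ?A 0)) \<in> max_ideal"
    by (intro max_mult bm d_pos V_closed)
  then have "val_eq (?A 0 + - \<pi> * ?b 0) (?A 0)" by (intro val_eq_add A0) (simp add: mult.commute)
  then have bA: "val_eq (?b (d - 1) ^ q) (?A 0)" unfolding top .
  have bnz: "?b (d - 1) \<noteq> 0" using bA q0 by (auto simp: val_eq_def power_0_left)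
  \<comment> \<open>The induction runs downwards from \<open>d - 1\<close>, where the value is known
    from \<open>bA\<close>: the lower layer can be neglected at \<open>s\<close> only once
    \<open>?b (Suc s)\<close> has been compared with \<open>?b (d - 1)\<close>.\<close>
  have down: "?b (d - 1 - j) \<noteq> 0 \<and> val_eq (?b (d - 1)) (?b (d - 1 - j) ^ (q ^ j)) \<and>
      (j > 0 \<longrightarrow> val_eq (?b (d - 1 - j) ^ q) (?b (d - j)))" if "j < d" for j
    using that
  proof (induction j)
    case 0
    then show ?case using bnz by (simp add: val_eq_refl)
  next
    case (Suc j)
    define s where "s = d - 1 - Suc j"
    have s: "Suc s = d - 1 - j" "Suc s = d - Suc j" "Suc s < d" "Suc s + j + 1 = d" using Suc.prems by (auto simp: s_def)
    have nz: "?b (Suc s) \<noteq> 0" and v: "val_eq (?b (d - 1)) (?b (Suc s) ^ (q ^ j))"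
      using Suc unfolding s(1) by auto
    have "val_eq (?A (Suc s)) (?A 0 ^ (q ^ Suc s))" by (rule A[OF s(3)])
    also have "val_eq (?A 0 ^ (q ^ Suc s)) ((?b (d - 1) ^ q) ^ (q ^ Suc s))"
      by (intro val_eq_power val_eq_sym[OF bA])
    also have "val_eq ((?b (d - 1) ^ q) ^ (q ^ Suc s)) (((?b (Suc s) ^ (q ^ j)) ^ q) ^ (q ^ Suc s))"
      by (intro val_eq_power v)
    also have "((?b (Suc s) ^ (q ^ j)) ^ q) ^ (q ^ Suc s) = ?b (Suc s) ^ (q ^ d)"
    proof -
      have "q ^ j * q * q ^ Suc s = q ^ (Suc s + j + 1)" by (simp add: power_add)
      then show ?thesis unfolding s(4) by (simp flip: power_mult add: mult.assoc)
    qed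
    \<comment> \<open>The chain shows that \<open>?A (Suc s)\<close> has the value of
      \<open>?b (Suc s) ^ (q ^ d)\<close>, which exceeds that of \<open>?b (Suc s)\<close>.\<close>
    finally have "?A (Suc s) / ?b (Suc s) ^ 1 \<in> max_ideal"
      using Q_ge_2 by (intro div_power_max[of _ _ "q ^ d"] bm s nz) auto
    then have m: "?A (Suc s) / ?b (Suc s) \<in> max_ideal" by simp
    have un: "val_eq (us (Suc s)) 1" by (rule us_unit) (use s in auto)
    then have "1 / us (Suc s) \<in> V" "us (Suc s) \<noteq> 0" by (auto simp: val_eq_def)
    then have "?A (Suc s) / ?b (Suc s) * (1 / us (Suc s)) \<in> max_ideal" by (intro max_mult m)
    then have "?A (Suc s) / (us (Suc s) * ?b (Suc s)) \<in> max_ideal" by (simp add: mult.commute)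
    then have "val_eq (?b s ^ q) (us (Suc s) * ?b (Suc s))"
      unfolding fr using nz \<open>us (Suc s) \<noteq> 0\<close> by (intro val_eq_add) auto
    also have "val_eq (us (Suc s) * ?b (Suc s)) (1 * ?b (Suc s))" by (intro val_eq_mult un val_eq_refl nz)
    finally have bs: "val_eq (?b s ^ q) (?b (Suc s))" by simp
    have "?b s \<noteq> 0" using bs q0 by (auto simp: val_eq_def power_0_left)
    have "val_eq (?b (d - 1)) ((?b s ^ q) ^ (q ^ j))"
      by (rule val_eq_trans[OF v]) (intro val_eq_power val_eq_sym[OF bs])
    then have "val_eq (?b (d - 1)) (?b s ^ (q ^ Suc j))" by (simp flip: power_mult)
    then show ?case using \<open>?b s \<noteq> 0\<close> bs unfolding s_def[symmetric] s(2)[symmetric] by simp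
  qed
  have ch: "val_eq (?b s ^ q) (?b (Suc s))" if "Suc s < d" for s
  proof -
    have "d - 1 - (d - 1 - s) = s" "d - (d - 1 - s) = Suc s" "d - 1 - s < d" "d - 1 - s > 0" using that by auto
    then show ?thesis using down[of "d - 1 - s"] by simp
  qed
  have b0: "?b 0 \<noteq> 0" using down[of "d - 1"] d_pos by simp
  have c: "val_eq (?b s) (?b 0 ^ (q ^ s))" if "s < d" for s by (rule Z_chain[OF ch that b0])
  have "val_eq (?A 0) (?b (d - 1) ^ q)" by (rule val_eq_sym[OF bA])
  also have "val_eq (?b (d - 1) ^ q) ((?b 0 ^ (q ^ (d - 1))) ^ q)" using c[of "d - 1"] d_pos by (intro val_eq_power) auto
  finally have Ab: "val_eq (?A 0) (?b 0 ^ (q ^ d))" unfolding pow_q_Suc[symmetric] Sd .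
  from val_eq_trans[OF pA val_eq_power[OF Ab]]
  have "val_eq \<pi> (?b 0 ^ M (Suc n))" by (simp add: M_Suc mult.commute flip: power_mult)
  then show ?case using bm[OF d_pos] b0 c Ab by simp
qed

text \<open>The value of a monomial in units of the value of \<open>Z n 0\<close>: the digit
  \<open>e i\<close> sits at place \<open>rot i\<close> because \<open>W n i\<close> has the value
  of \<open>Z n 0 ^ (q ^ rot i)\<close>.\<close>

definition weight :: "(nat \<Rightarrow> nat) \<Rightarrow> nat" where "weight e = (\<Sum>i\<in>{1..d}. e i * q ^ rot i)"

lemma weight_alt: "weight e = (\<Sum>s<d. e (unrot s) * q ^ s)"
  unfolding weight_def by (rule sum_rot)

lemma digit_less: "e \<le> const_index d (q - 1) \<Longrightarrow> e i < q"
proof -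
  assume e: "e \<le> const_index d (q - 1)"
  then have "e i \<le> q - 1" unfolding le_const_index by (cases "i \<in> {1..d}") auto
  then show ?thesis using q_ge_2 by linarith
qed

lemma weight_inj: "inj_on weight {..const_index d (q - 1)}"
proof (rule inj_onI)
  fix e f assume "e \<in> {..const_index d (q - 1)}" "f \<in> {..const_index d (q - 1)}" and eq: "weight e = weight f"
  then have e: "e \<le> const_index d (q - 1)" and f: "f \<le> const_index d (q - 1)" by auto
  show "e = f"
  proof
    fix i
    show "e i = f i"
    proof (cases "i \<in> {1..d}")
      case True
      have "e (unrot (rot i)) = f (unrot (rot i))"
        by (rule digit_sum_inj[of d "\<lambda>s. e (unrot s)" q "\<lambda>s. f (unrot s)"])
          (use eq digit_less e f rot_less[OF True] in \<open>auto simp: weight_alt\<close>)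
      then show ?thesis using unrot_rot[OF True] by simp
    next
      case False
      then show ?thesis using e f unfolding le_const_index by auto
    qed
  qed
qed

text \<open>\<open>D n\<close> is the number of exponents in \<open>J n\<close>. \<open>v n\<close>
  measures the values in the ring \<open>B n\<close> below layer \<open>n\<close>: those of elements
  not divisible by \<pi> are the multiples of its value by numbers below \<open>N n\<close>, while
  \<pi> has the value of \<open>v n ^ N n\<close>.\<close>

definition D :: "nat \<Rightarrow> nat" where "D n = (if n = 0 then q ^ d - 1 else q ^ d)"
definition v :: "nat \<Rightarrow> 'c" where "v n = (if n = 0 then \<pi> else Z (n - 1) 0)"
definition N :: "nat \<Rightarrow> nat" where "N n = (if n = 0 then 1 else M (n - 1))"

text \<open>At the bottom layer the excluded top exponent is exactly the one of weight
  \<open>q ^ d - 1\<close>.\<close>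

lemma weight_less: assumes "e \<in> J n" shows "weight e < D n"
proof -
  have le: "e \<le> const_index d (q - 1)" using frob_step.J_le[OF step] assms by blast
  have lt: "weight e < q ^ d" unfolding weight_alt by (rule digit_sum_less) (rule digit_less[OF le])
  have "weight e < q ^ d - 1" if "n = 0"
  proof -
    let ?c = "const_index d (q - 1)"
    have "weight ?c = (\<Sum>s<d. (q - 1) * q ^ s)"
      unfolding weight_alt using rot_unrot by (intro sum.cong) (auto simp: const_index_def)
    then have "weight ?c = q ^ d - 1" by (simp only: digit_sum_max)
    moreover have "e \<noteq> ?c" using assms that by (auto simp: J_def)
    then have "weight e \<noteq> weight ?c" using inj_onD[OF weight_inj, of e ?c] le by auto
    ultimately show ?thesis using lt by linarith
  qed
  then show ?thesis using lt by (simp add: D_def)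
qed

lemma mpow_val: "val_eq (mpow (W n) d e) (Z n 0 ^ weight e)"
proof -
  have "val_eq (\<Prod>i\<in>{1..d}. W n i ^ e i) (\<Prod>i\<in>{1..d}. (Z n 0 ^ (q ^ rot i)) ^ e i)"
    using Z_val[of n] rot_less by (intro val_eq_prod val_eq_power) (auto simp: W_Z)
  also have "(\<Prod>i\<in>{1..d}. (Z n 0 ^ (q ^ rot i)) ^ e i) = Z n 0 ^ weight e"
    unfolding weight_def power_sum by (simp add: mult.commute flip: power_mult)
  finally show ?thesis by (simp only: mpow_def)
qed

lemma v_facts: "v n \<in> max_ideal" "v n \<noteq> 0" "val_eq (v n) (Z n 0 ^ D n)" "val_eq \<pi> (v n ^ N n)" "N (Suc n) = N n * D n"
proof -
  have M0: "M 0 = q ^ d - 1" by (simp add: M_def)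
  show "v n \<in> max_ideal" "v n \<noteq> 0" using Z_val[of "n - 1"] pi_m pi_nz by (auto simp: v_def)
  show "val_eq (v n) (Z n 0 ^ D n)" using Z_val[of n] by (auto simp: v_def D_def M0)
  show "val_eq \<pi> (v n ^ N n)" using Z_val[of "n - 1"] val_eq_refl[OF pi_nz] by (auto simp: v_def N_def)
  show "N (Suc n) = N n * D n" using M_Suc[of "n - 1"] by (cases n) (auto simp: N_def D_def M0)
qed

lemma B_V: "B n \<subseteq> V"
proof (induction n)
  case (Suc n)
  show ?case unfolding B.simps
    by (rule mspan_subset[OF subring Suc]) (simp add: W_Z Z_V del: atLeastAtMost_iff)
qed (use RR_V in simp)

lemma span_step:
  assumes IH: "\<And>t. t \<in> B n \<Longrightarrow> t \<in> (*) \<pi> ` B n \<or> (\<exists>k<N n. val_eq t (v n ^ k))"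
    and t: "\<And>e. e \<in> J n \<Longrightarrow> t e \<in> B n" "\<exists>e\<in>J n. t e \<notin> (*) \<pi> ` B n"
  shows "\<exists>k<N n * D n. val_eq (\<Sum>e\<in>J n. t e * mpow (W n) d e) (Z n 0 ^ k)"
proof (rule span_value[OF B_subring B_V _ _ v_facts(3,4) IH _ _ weight_less mpow_val t])
  show "Z n 0 \<in> max_ideal" "Z n 0 \<noteq> 0" using Z_val[of n] by auto
  show "finite (J n)" by (rule frob_step.J_finite[OF step])
  show "inj_on weight (J n)" by (rule inj_on_subset[OF weight_inj frob_step.J_le[OF step]])
qed auto

text \<open>Either \<pi> divides every coefficient and can be pulled out of the sum, or
  \<open>span_value\<close> applies.\<close>

lemma B_val: "t \<in> B n \<Longrightarrow> t \<in> (*) \<pi> ` B n \<or> (\<exists>k<N n. val_eq t (v n ^ k))"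
proof (induction n arbitrary: t)
  case 0
  then show ?case using RR_unit[of t] by (auto simp: N_def)
next
  case (Suc n)
  obtain c where c: "\<And>e. e \<in> J n \<Longrightarrow> c e \<in> B n" "t = (\<Sum>e\<in>J n. c e * mpow (W n) d e)"
    using Suc.prems unfolding B.simps by (rule mspanE) blast
  show ?case
  proof (cases "\<exists>e\<in>J n. c e \<notin> (*) \<pi> ` B n")
    case True
    from span_step[OF Suc.IH c(1) True] show ?thesis unfolding c(2)[symmetric]
      by (simp add: v_facts(5) v_def)
  next
    case False
    then have "\<forall>e\<in>J n. \<exists>r\<in>B n. c e = \<pi> * r" by (auto simp: image_iff)
    then obtain r where r: "\<And>e. e \<in> J n \<Longrightarrow> r e \<in> B n \<and> c e = \<pi> * r e" by metis
    have "t = \<pi> * (\<Sum>e\<in>J n. r e * mpow (W n) d e)"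
      unfolding c(2) sum_distrib_left using r by (intro sum.cong) (auto simp: mult.assoc)
    moreover have "(\<Sum>e\<in>J n. r e * mpow (W n) d e) \<in> B (Suc n)" unfolding B.simps using r by (intro mspanI) auto
    ultimately show ?thesis by blast
  qed
qed

text \<open>By \<open>B_val\<close>, an element outside \<pi> \<open>B n\<close> has strictly
  smaller value than \<pi>. This is integral closedness localized at \<theta> - \<zeta>_i0.\<close>

lemma B_div_pi:
  assumes "y \<in> B n" "y / \<pi> \<in> V" shows "y \<in> (*) \<pi> ` B n"
proof (rule ccontr)
  assume "y \<notin> (*) \<pi> ` B n"
  then obtain k where k: "k < N n" "val_eq y (v n ^ k)" using B_val[OF assms(1)] by auto
  have "\<pi> / v n ^ k \<in> max_ideal" by (rule div_power_max[OF v_facts(1,2,4) k(1)])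
  moreover have "v n ^ k / y \<in> V" "y \<noteq> 0" using k(2) by (auto simp: val_eq_def)
  ultimately have "\<pi> / v n ^ k * (v n ^ k / y) \<in> max_ideal" by (intro max_mult)
  then have "\<pi> / y \<in> max_ideal" using v_facts(2) by simp
  from max_mult[OF this assms(2)] have "1 \<in> max_ideal" using \<open>y \<noteq> 0\<close> pi_nz by simp
  then show False using one_notin_max by simp
qed

text \<open>The two claims support each other: separatedness at level \<open>n\<close> feeds the
  descent that proves independence, and independence lifts separatedness to level n + 1. A relation
  with a coefficient not divisible by \<pi> is impossible, as its sum would have a value.\<close>

lemma B_indep: "mindep (B n) (J n) (W n) d \<and> (\<forall>t\<in>B n. (\<forall>s. t \<in> (*) (\<pi> ^ s) ` B n) \<longrightarrow> t = 0)"
proof (induction n)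
  have ind: "mindep (B n) (J n) (W n) d" if sep: "\<forall>t\<in>B n. (\<forall>s. t \<in> (*) (\<pi> ^ s) ` B n) \<longrightarrow> t = 0" for n
  proof (rule mindepI_descent[OF pi_nz])
    fix t assume t: "\<And>e. e \<in> J n \<Longrightarrow> t e \<in> B n" "(\<Sum>e\<in>J n. t e * mpow (W n) d e) = 0"
    show "\<forall>e\<in>J n. t e \<in> (*) \<pi> ` B n"
    proof (rule ccontr)
      assume "\<not> ?thesis"
      then have "\<exists>k<N n * D n. val_eq (\<Sum>e\<in>J n. t e * mpow (W n) d e) (Z n 0 ^ k)"
        by (intro span_step t B_val) auto
      then show False using t(2) by (auto simp: val_eq_def)
    qed
  qed (use sep in blast)
  case 0
  have s0: "\<forall>t\<in>B 0. (\<forall>s. t \<in> (*) (\<pi> ^ s) ` B 0) \<longrightarrow> t = 0"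
    using RR_sep[OF _ pi_kpoly(1)] pi_kpoly(2) by auto
  show ?case by (intro conjI ind[OF s0] s0)
  case (Suc n)
  have s1: "\<forall>t\<in>B (Suc n). (\<forall>s. t \<in> (*) (\<pi> ^ s) ` B (Suc n)) \<longrightarrow> t = 0"
  proof (intro ballI impI)
    fix t assume t: "t \<in> B (Suc n)" "\<forall>s. t \<in> (*) (\<pi> ^ s) ` B (Suc n)"
    show "t = 0"
    proof (rule mindep_sep[OF _ B_subring])
      show "mindep (B n) (J n) (W n) d" using Suc by blast
      show "\<pi> \<in> B n" using pi_RR RR_B by blast
      show "x = 0" if "x \<in> B n" "\<And>s. x \<in> (*) (\<pi> ^ s) ` B n" for x using Suc that by blast
      show "t \<in> mspan (B n) (J n) (W n) d" using t(1) by simp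
      show "t \<in> (*) (\<pi> ^ s) ` mspan (B n) (J n) (W n) d" for s using t(2) by simp
    qed
  qed
  show ?case by (intro conjI ind[OF s1] s1)
qed

end

section \<open>The rings in the tower are integrally closed\<close>

context carlitz_prime
begin

lemma val_exists:
  assumes i: "i0 \<in> {1..d}"
  obtains V where "carlitz_val \<iota> q lam \<zeta> \<pp> d V i0"
proof -
  let ?g = "[:- zt i0, 1:]"
  have g: "?g \<in> kpoly"
    using zt_kk subring_uminus[OF kk_subring] subring_1[OF kk_subring] by (simp add: kpoly_pCons kpoly_0)
  have pg: "poly ?g \<theta> = \<theta> - zt i0" by simp
  have nu: "(\<theta> - zt i0) * s \<noteq> 1" if "s \<in> RR" for s
  proof
    assume "(\<theta> - zt i0) * s = 1"
    then have "poly 1 \<theta> \<in> (*) (poly ?g \<theta>) ` RR" unfolding pg using that by (metis image_eqI poly_1)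
    then have "?g dvd 1" using RR_dvd_iff[OF subring_1[OF kpoly_subring] g] by blast
    then have "degree ?g \<le> degree (1 :: 'c poly)" by (rule dvd_imp_degree_le) simp
    then show False by simp
  qed
  have "\<theta> - zt i0 \<in> RR" using g pg by (metis RR_kpoly)
  then obtain V where V: "val_ring V" "RR \<subseteq> V" "\<theta> - zt i0 \<in> val_ring.max_ideal V"
    using chevalley[OF RR_subring _ nu] by blast
  have "carlitz_val \<iota> q lam \<zeta> \<pp> d V i0"
    using i V carlitz_prime_axioms by (intro carlitz_val.intro carlitz_val_axioms.intro)
  then show ?thesis by (rule that)
qed

lemma one_index: "1 \<in> {1..d}"
  using d_pos by auto

text \<open>Independence needs a valuation at only one of the primes, here the one of
  \<zeta>_1.\<close>

lemma W_indep: "mindep (B n) (J n) (W n) d"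
proof -
  obtain V where "carlitz_val \<iota> q lam \<zeta> \<pp> d V 1" by (rule val_exists[OF one_index])
  then interpret carlitz_val \<iota> q lam \<zeta> \<pp> d V 1 .
  show ?thesis using B_indep by blast
qed

lemma B_root:
  assumes g: "g \<in> kpoly" "degree g > 0"
    and min: "\<And>h. h \<in> kpoly \<Longrightarrow> degree h > 0 \<Longrightarrow> h dvd g \<Longrightarrow> degree g \<le> degree h"
    and nz: "\<And>i. i \<in> {1..d} \<Longrightarrow> poly g (zt i) \<noteq> 0"
  shows "y \<in> B n \<Longrightarrow> y ^ q \<in> (*) (poly g \<theta>) ` B n \<Longrightarrow> y \<in> (*) (poly g \<theta>) ` B n"
proof (induction n arbitrary: y)
  case 0
  then show ?case using kpoly_root_dvd[OF g min] by simp
next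
  case (Suc n)
  have gR: "poly g \<theta> \<in> RR" using g by (auto simp: RR_kpoly)
  show ?case unfolding B.simps
  proof (rule frob_step.root_divides[OF step W_indep])
    show "poly g \<theta> \<in> B n" using gR RR_B by blast
    show "\<exists>v\<in>B n. \<exists>r\<in>B n. u i * v = 1 + poly g \<theta> * r" if "i \<in> {1..d}" for i
      using RR_unit_mod[OF g(1) zt_kk nz[OF that]] RR_B[of n] unfolding u_def by blast
  qed (use Suc in auto)
qed

lemma B_root_pow:
  assumes g: "g \<in> kpoly" "degree g > 0"
    and min: "\<And>h. h \<in> kpoly \<Longrightarrow> degree h > 0 \<Longrightarrow> h dvd g \<Longrightarrow> degree g \<le> degree h"
    and nz: "\<And>i. i \<in> {1..d} \<Longrightarrow> poly g (zt i) \<noteq> 0"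
    and y: "y \<in> B n"
  shows "y ^ (q ^ s) \<in> (*) (poly g \<theta>) ` B n \<Longrightarrow> y \<in> (*) (poly g \<theta>) ` B n"
proof (induction s)
  case (Suc s)
  have "y ^ (q ^ s) \<in> B n" by (rule subring_power[OF B_subring y])
  moreover have "(y ^ (q ^ s)) ^ q \<in> (*) (poly g \<theta>) ` B n" using Suc.prems by (simp only: pow_q_Suc)
  ultimately show ?case using B_root[OF g min nz] Suc.IH by blast
qed simp

lemma B_mult_RR: "x \<in> RR \<Longrightarrow> y \<in> B n \<Longrightarrow> x * y \<in> B n"
  using subring_mult[OF B_subring] RR_B by blast

text \<open>Multiply the monic equation of \<open>x\<close> by \<open>F ^ m\<close>, where m is its
  degree: every lower term keeps a factor \<open>F\<close> beyond the powers of
  \<open>F * x\<close>.\<close>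

lemma integral_power_dvd:
  assumes p: "lead_coeff p = 1" "\<And>i. coeff p i \<in> RR" "poly p x = 0"
    and f: "F \<in> RR" "F * x \<in> B n"
  shows "(F * x) ^ degree p \<in> (*) F ` B n"
proof -
  define m where "m = degree p"
  have "m \<noteq> 0" 
  proof
    assume "m = 0"
    then obtain c where "p = [:c:]" unfolding m_def by (rule degree_eq_zeroE)
    then show False using p by simp
  qed
  have "0 = (\<Sum>i\<le>m. coeff p i * x ^ i)" using p(3) by (simp add: poly_altdef m_def)
  also have "\<dots> = (\<Sum>i<m. coeff p i * x ^ i) + x ^ m"
    using p(1) by (simp add: m_def flip: lessThan_Suc_atMost)
  finally have "x ^ m = - (\<Sum>i<m. coeff p i * x ^ i)"
    by (metis add.commute minus_unique minus_minus)
  then have "(F * x) ^ m = - (\<Sum>i<m. F ^ m * (coeff p i * x ^ i))"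
    by (simp add: power_mult_distrib sum_distrib_left)
  also have "(\<Sum>i<m. F ^ m * (coeff p i * x ^ i)) = (\<Sum>i<m. F * (F ^ (m - 1 - i) * coeff p i * (F * x) ^ i))"
  proof (rule sum.cong)
    fix i assume "i \<in> {..<m}"
    then have "m = Suc (m - 1 - i + i)" by auto
    then have "F ^ m = F * (F ^ (m - 1 - i) * F ^ i)" by (metis power_Suc power_add)
    then show "F ^ m * (coeff p i * x ^ i) = F * (F ^ (m - 1 - i) * coeff p i * (F * x) ^ i)"
      by (simp only: power_mult_distrib mult_ac)
  qed simp
  also have "- \<dots> = F * (- (\<Sum>i<m. F ^ (m - 1 - i) * coeff p i * (F * x) ^ i))"
    by (simp add: sum_distrib_left)
  finally have eq: "(F * x) ^ m = F * (- (\<Sum>i<m. F ^ (m - 1 - i) * coeff p i * (F * x) ^ i))" .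
  have "F ^ (m - 1 - i) * coeff p i \<in> RR" for i
    by (rule subring_mult[OF RR_subring subring_power[OF RR_subring f(1)] p(2)])
  then have "- (\<Sum>i<m. F ^ (m - 1 - i) * coeff p i * (F * x) ^ i) \<in> B n"
    by (intro subring_uminus[OF B_subring] subring_sum[OF B_subring] B_mult_RR
        subring_power[OF B_subring f(2)])
  then show ?thesis unfolding m_def[symmetric] eq by blast
qed

text \<open>Take a denominator \<open>f\<close> of \<open>x\<close> of least degree. A root \<open>\<zeta>\<^sub>i\<close> of \<open>f\<close> can be cancelled by the
  valuation at \<open>\<theta> - \<zeta>\<^sub>i\<close>; a prime divisor of \<open>f\<close> without such roots can be cancelled because a power
  of \<open>f x\<close> is divisible by it and \<open>q\<close>-th roots preserve this.\<close>

lemma integral_in_B: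
  assumes f0: "f0 \<in> kpoly" "f0 \<noteq> 0" "poly f0 \<theta> * x \<in> B n"
    and p: "lead_coeff p = 1" "\<And>i. coeff p i \<in> RR" "poly p x = 0"
  shows "x \<in> B n"
proof -
  define I where "I = {f \<in> kpoly. poly f \<theta> * x \<in> B n}"
  have f0I: "f0 \<in> I" using f0 by (simp add: I_def)
  obtain f where f: "f \<in> I" "f \<noteq> 0" "\<And>h. h \<in> I \<Longrightarrow> h \<noteq> 0 \<Longrightarrow> degree f \<le> degree h"
    using degree_ideal_generator[OF f0I f0(2)] by blast
  have fk: "f \<in> kpoly" and fx: "poly f \<theta> * x \<in> B n" using f(1) by (auto simp: I_def)
  \<comment> \<open>If \<open>g\<close> could be cancelled from \<open>poly f \<theta> * x\<close>,
    the cofactor \<open>h\<close> would be a denominator of smaller degree than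
    \<open>f\<close>.\<close>
  have cancel: False if g: "g \<in> kpoly" "degree g > 0" and h: "h \<in> kpoly" "f = g * h"
    and y: "poly f \<theta> * x \<in> (*) (poly g \<theta>) ` B n" for g h
  proof -
    have g0: "g \<noteq> 0" "h \<noteq> 0" using h f(2) by auto
    obtain b where b: "b \<in> B n" "poly g \<theta> * (poly h \<theta> * x) = poly g \<theta> * b"
      using y unfolding h(2) by (auto simp: mult.assoc)
    then have "poly h \<theta> * x = b" using poly_theta_eq_0[OF g(1)] g0 by simp
    then have "h \<in> I" using h b by (simp add: I_def)
    then have "degree f \<le> degree h" using f(3) g0 by blast
    then show False unfolding h(2) using degree_mult_eq[OF g0] g(2) by simp
  qed
  show ?thesis
  proof (cases "degree f = 0")
    case True
    then obtain c where c: "f = [:c:]" by (rule degree_eq_zeroE)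
    then have "c \<in> kk" "c \<noteq> 0" using fk f(2) by (auto simp: kpoly_pCons)
    moreover have "c * x \<in> B n" using fx c by simp
    ultimately have "inverse c * (c * x) \<in> B n" using B_mult_RR[OF kk_RR[OF kk_inverse]] by blast
    moreover have "inverse c * (c * x) = x" using \<open>c \<noteq> 0\<close> by (simp flip: mult.assoc)
    ultimately show ?thesis by simp
  next
    case False
    show ?thesis
    proof (cases "\<exists>i\<in>{1..d}. poly f (zt i) = 0")
      case True
      then obtain i1 where i1: "i1 \<in> {1..d}" "poly f (zt i1) = 0" by blast
      obtain V where "carlitz_val \<iota> q lam \<zeta> \<pp> d V i1" by (rule val_exists[OF i1(1)])
      then interpret carlitz_val \<iota> q lam \<zeta> \<pp> d V i1 .
      have "[:- \<alpha>, 1:] dvd f" using i1(2) by (simp only: poly_eq_0_iff_dvd \<alpha>_def)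
      then obtain h where h: "h \<in> kpoly" "f = [:- \<alpha>, 1:] * h" by (rule kpoly_dvdE[OF fk pi_kpoly(1)])
      \<comment> \<open>Valuation rings are integrally closed, so the quotient by \<pi> of the
        numerator stays in \<open>V\<close>.\<close>
      have "x \<in> V" by (rule integral_in_V[OF p(1) _ p(3)]) (use p(2) RR_V in blast)
      moreover have "poly h \<theta> \<in> RR" unfolding RR_kpoly using h(1) by blast
      then have "poly h \<theta> \<in> V" using RR_V by blast
      ultimately have "poly h \<theta> * x \<in> V" by (rule V_closed(4)[rotated])
      moreover have "poly f \<theta> * x / \<pi> = poly h \<theta> * x"
        unfolding h(2) poly_mult pi_kpoly(2) using pi_nz by simp
      ultimately have "poly f \<theta> * x / \<pi> \<in> V" by (simp only:)
      then have "poly f \<theta> * x \<in> (*) \<pi> ` B n" by (rule B_div_pi[OF fx])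
      then show ?thesis using cancel[OF pi_kpoly(1) _ h] unfolding pi_kpoly(2) by simp
    next
      case no_root: False
      \<comment> \<open>A nonconstant divisor of least degree is a prime divisor.\<close>
      define G where "G = {g \<in> kpoly. degree g > 0 \<and> g dvd f}"
      have "f \<in> G" using fk False by (simp add: G_def)
      then obtain g where g: "g \<in> G" "\<And>h. h \<in> G \<Longrightarrow> h \<noteq> 0 \<Longrightarrow> degree g \<le> degree h"
        using degree_ideal_generator[of f G] f(2) by blast
      have gk: "g \<in> kpoly" "degree g > 0" "g dvd f" using g(1) by (auto simp: G_def)
      obtain h where h: "h \<in> kpoly" "f = g * h" by (rule kpoly_dvdE[OF fk gk(1,3)])
      have min: "degree g \<le> degree r" if "r \<in> kpoly" "degree r > 0" "r dvd g" for r
        using that gk(3) by (intro g(2)) (auto simp: G_def intro: dvd_trans)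
      have nz: "poly g (zt i) \<noteq> 0" if "i \<in> {1..d}" for i
        using no_root that unfolding h(2) by auto
      define m where "m = degree p"
      have "poly f \<theta> \<in> RR" using fk by (auto simp: RR_kpoly)
      then have "(poly f \<theta> * x) ^ m \<in> (*) (poly f \<theta>) ` B n"
        unfolding m_def by (rule integral_power_dvd[OF p _ fx])
      then obtain b where b: "b \<in> B n" "(poly f \<theta> * x) ^ m = poly f \<theta> * b" by auto
      have hR: "poly h \<theta> \<in> RR" using h by (auto simp: RR_kpoly)
      \<comment> \<open>The exponent is raised from \<open>m\<close> to a power of \<open>q\<close>,
        so that only \<open>q\<close>-th roots have to be extracted afterwards.\<close>
      have "m \<le> q ^ m" using suc_le_q_pow[of m] by linarith
      define y where "y = (poly f \<theta> * x) ^ (q ^ m - m)"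
      have y: "y \<in> B n" unfolding y_def by (rule subring_power[OF B_subring fx])
      have fg: "poly f \<theta> = poly g \<theta> * poly h \<theta>" by (simp only: h(2) poly_mult)
      have "(poly f \<theta> * x) ^ (q ^ m) = (poly f \<theta> * x) ^ m * y"
        unfolding y_def using \<open>m \<le> q ^ m\<close> by (simp flip: power_add)
      also have "\<dots> = poly g \<theta> * (poly h \<theta> * (b * y))"
        unfolding b(2) by (simp only: fg mult.assoc)
      finally have pow: "(poly f \<theta> * x) ^ (q ^ m) \<in> (*) (poly g \<theta>) ` B n"
        using B_mult_RR[OF hR subring_mult[OF B_subring b(1) y]] by blast
      have "poly f \<theta> * x \<in> (*) (poly g \<theta>) ` B n"
      proof (rule B_root_pow[OF gk(1,2) _ _ fx pow])
        show "degree g \<le> degree r" if "r \<in> kpoly" "degree r > 0" "r dvd g" for r by (rule min[OF that])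
        show "poly g (zt i) \<noteq> 0" if "i \<in> {1..d}" for i by (rule nz[OF that])
      qed
      then show ?thesis using cancel[OF gk(1,2) h] by blast
    qed
  qed
qed

text \<open>The fraction field of \<open>B n\<close>. Denominators from k[\<theta>] suffice because
  \<open>B_norm\<close> turns any nonzero denominator into one of these.\<close>

definition Frac :: "nat \<Rightarrow> 'c set" where "Frac n = {x. \<exists>F\<in>RR. F \<noteq> 0 \<and> F * x \<in> B n}"

lemma B_Frac: "B n \<subseteq> Frac n"
  unfolding Frac_def using subring_1[OF RR_subring] by (auto intro!: bexI[of _ 1])

lemma Frac_subfield: "is_subfield (Frac n)"
  unfolding is_subfield_def
proof (intro conjI ballI is_subringI)
  show "0 \<in> Frac n" "1 \<in> Frac n"
    using B_Frac subring_0[OF B_subring] subring_1[OF B_subring] by auto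
  fix x assume "x \<in> Frac n"
  then obtain F where F: "F \<in> RR" "F \<noteq> 0" "F * x \<in> B n" by (auto simp: Frac_def)
  have "F * (- x) \<in> B n" using subring_uminus[OF B_subring F(3)] by simp
  then show "- x \<in> Frac n" using F by (auto simp: Frac_def)
  show "inverse x \<in> Frac n"
  proof (cases "x = 0")
    case True
    then show ?thesis using \<open>0 \<in> Frac n\<close> by simp
  next
    case False
    then obtain z where z: "z \<in> B n" "(F * x) * z \<in> RR" "(F * x) * z \<noteq> 0" using B_norm[OF F(3)] F by auto
    have "(F * x * z) * inverse x = F * z" using False by simp
    also have "\<dots> \<in> B n" using B_mult_RR F z by blast
    finally show ?thesis using z unfolding Frac_def by blast
  qed
  fix y assume "y \<in> Frac n"
  then obtain F' where F': "F' \<in> RR" "F' \<noteq> 0" "F' * y \<in> B n" by (auto simp: Frac_def)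
  have FF: "F * F' \<in> RR" "F * F' \<noteq> 0" using F F' subring_mult[OF RR_subring] by auto
  have "F * F' * (x + y) = F' * (F * x) + F * (F' * y)" by (simp add: algebra_simps)
  also have "\<dots> \<in> B n" by (rule subring_add[OF B_subring B_mult_RR[OF F'(1) F(3)] B_mult_RR[OF F(1) F'(3)]])
  finally show "x + y \<in> Frac n" using FF unfolding Frac_def by blast
  have "F * F' * (x * y) = (F * x) * (F' * y)" by (simp add: mult_ac)
  also have "\<dots> \<in> B n" by (rule subring_mult[OF B_subring F(3) F'(3)])
  finally show "x * y \<in> Frac n" using FF unfolding Frac_def by blast
qed

lemma integral_closure_B:
  assumes "S \<subseteq> RR" "F \<subseteq> Frac n"
  shows "integral_closure S F \<subseteq> B n"
proof
  fix x assume "x \<in> integral_closure S F"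
  then obtain p where p: "x \<in> F" "lead_coeff p = 1" "\<And>i. coeff p i \<in> S" "poly p x = 0"
    by (auto simp: integral_closure_def)
  have "x \<in> Frac n" using assms(2) p(1) by blast
  then obtain c where c: "c \<in> RR" "c \<noteq> 0" "c * x \<in> B n" by (auto simp: Frac_def)
  obtain f where "f \<in> kpoly" "c = poly f \<theta>" using c(1) unfolding RR_kpoly by blast
  then have f: "f \<in> kpoly" "poly f \<theta> \<noteq> 0" "poly f \<theta> * x \<in> B n" using c by simp_all
  show "x \<in> B n"
    by (rule integral_in_B[OF f(1) _ f(3) p(2) _ p(4)]) (use f(2) p(3) assms(1) in auto)
qed

end

section \<open>Torsion of the Carlitz module\<close>

text \<open>The summand of least value dominates, and distinct exponents make it unique.\<close>

lemma (in val_ring) val_sum_nz: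
  assumes w: "w \<in> max_ideal" "w \<noteq> 0" and I: "finite I" "I \<noteq> {}" "inj_on h I"
    and x: "\<And>i. i \<in> I \<Longrightarrow> val_eq (x i) (w ^ h i)"
  shows "sum x I \<noteq> 0"
proof -
  obtain i0 where i0: "i0 \<in> I" "\<And>i. i \<in> I \<Longrightarrow> h i0 \<le> h i"
    using ex_is_arg_min_if_finite[OF I(1,2), of h] by (auto simp: is_arg_min_def not_less)
  have x0: "x i0 \<noteq> 0" "w ^ h i0 / x i0 \<in> V" using x[OF i0(1)] by (auto simp: val_eq_def)
  have "x i / w ^ h i0 \<in> max_ideal" if "i \<in> I - {i0}" for i
    using i0 that inj_onD[OF I(3), of i i0] x[of i] by (intro div_power_max[OF w, of _ "h i"]) force+
  then have "sum x (I - {i0}) / w ^ h i0 \<in> max_ideal" unfolding sum_divide_distrib by (rule max_sum)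
  from max_mult[OF this x0(2)] have "sum x (I - {i0}) / x i0 \<in> max_ideal" using w(2) by simp
  then have "val_eq (x i0 + sum x (I - {i0})) (x i0)" by (rule val_eq_add[OF x0(1)])
  then show ?thesis using sum.remove[OF I(1) i0(1), of x] by (simp add: val_eq_def)
qed

context carlitz_prime
begin

text \<open>The Carlitz actions of \<theta> and of \<open>a\<close> as plain functions on the field;
  \<open>carlitz_torsion_eq\<close> ties them to the twisted polynomials.\<close>

definition C :: "'c \<Rightarrow> 'c" where "C x = \<theta> * x + x ^ q"
definition Ca :: "'a poly \<Rightarrow> 'c \<Rightarrow> 'c" where
  "Ca a x = (\<Sum>k\<le>degree a. Fq_emb \<iota> (coeff a k) * (C ^^ k) x)"

lemma C_add: "C (x + y) = C x + C y"
  by (simp add: C_def frob algebra_simps)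

lemma C_0: "C 0 = 0"
  by (simp add: C_def zero_pow_q)

lemma C_sum: "C (sum f I) = (\<Sum>i\<in>I. C (f i))"
  by (induction I rule: infinite_finite_induct) (auto simp: C_add C_0)

lemma C_smult: "C (Fq_emb \<iota> c * x) = Fq_emb \<iota> c * C x"
  by (simp add: C_def power_mult_distrib Fq_emb_frob algebra_simps)

lemma Ca_ext: "degree a \<le> N \<Longrightarrow> Ca a x = (\<Sum>k\<le>N. Fq_emb \<iota> (coeff a k) * (C ^^ k) x)"
  unfolding Ca_def by (intro sum.mono_neutral_left) (auto simp: coeff_eq_0)

lemma Ca_pCons: "Ca (pCons c a) x = Fq_emb \<iota> c * x + C (Ca a x)"
proof -
  have "Ca (pCons c a) x = (\<Sum>k\<le>Suc (degree a). Fq_emb \<iota> (coeff (pCons c a) k) * (C ^^ k) x)"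
    by (rule Ca_ext) (rule degree_pCons_le)
  also have "\<dots> = Fq_emb \<iota> c * x + (\<Sum>k\<le>degree a. Fq_emb \<iota> (coeff a k) * (C ^^ Suc k) x)"
    by (subst sum.atMost_Suc_shift) simp
  also have "(\<Sum>k\<le>degree a. Fq_emb \<iota> (coeff a k) * (C ^^ Suc k) x) = C (Ca a x)"
    by (simp add: Ca_def C_sum C_smult)
  finally show ?thesis .
qed

lemma Ca_0: "Ca 0 x = 0"
  by (simp add: Ca_def)

lemma Ca_add: "Ca a (x + y) = Ca a x + Ca a y"
  by (induction a) (simp_all add: Ca_0 Ca_pCons C_add algebra_simps)

lemma Ca_zero: "Ca a 0 = 0"
  by (induction a) (simp_all add: Ca_0 Ca_pCons C_0)

lemma Ca_sum: "Ca a (sum f I) = (\<Sum>i\<in>I. Ca a (f i))"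
  by (induction I rule: infinite_finite_induct) (auto simp: Ca_add Ca_zero)

lemma Ca_poly_add: "Ca (a + b) x = Ca a x + Ca b x"
proof -
  let ?N = "max (degree a) (degree b)"
  have "Ca (a + b) x = (\<Sum>k\<le>?N. Fq_emb \<iota> (coeff (a + b) k) * (C ^^ k) x)"
    by (rule Ca_ext) (rule degree_add_le_max)
  then show ?thesis using Ca_ext[of a ?N x] Ca_ext[of b ?N x]
    by (simp add: Fq_emb_add distrib_right sum.distrib)
qed

lemma Ca_poly_smult: "Ca (smult c a) x = Fq_emb \<iota> c * Ca a x"
  using Ca_ext[of "smult c a" "degree a" x] degree_smult_le[of c a]
  by (simp add: Ca_def Fq_emb_mult sum_distrib_left mult.assoc)

lemma Ca_mult: "Ca (a * b) x = Ca a (Ca b x)"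
proof (induction a)
  case 0
  then show ?case by (simp add: Ca_0)
next
  case (pCons c a)
  have "Ca (pCons c a * b) x = Ca (smult c b) x + Ca (pCons 0 (a * b)) x"
    unfolding mult_pCons_left by (rule Ca_poly_add)
  then show ?case using pCons by (simp add: Ca_poly_smult Ca_pCons)
qed

lemma twisted_eval_ext:
  "degree P \<le> N \<Longrightarrow> twisted_eval \<iota> P x = (\<Sum>i\<le>N. A_emb \<iota> (coeff P i) * x ^ (q ^ i))"
  unfolding twisted_eval_def q[symmetric] by (intro sum.mono_neutral_left) (auto simp: coeff_eq_0)

lemma twisted_eval_add: "twisted_eval \<iota> (P + P') x = twisted_eval \<iota> P x + twisted_eval \<iota> P' x"
proof -
  let ?N = "max (degree P) (degree P')"
  have "twisted_eval \<iota> (P + P') x = (\<Sum>i\<le>?N. A_emb \<iota> (coeff (P + P') i) * x ^ (q ^ i))"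
    by (rule twisted_eval_ext) (rule degree_add_le_max)
  then show ?thesis using twisted_eval_ext[of P ?N x] twisted_eval_ext[of P' ?N x]
    by (simp add: A_emb_add distrib_right sum.distrib)
qed

lemma twisted_eval_0: "twisted_eval \<iota> 0 x = 0"
  by (simp add: twisted_eval_def)

lemma twisted_eval_sum: "twisted_eval \<iota> (sum f I) x = (\<Sum>i\<in>I. twisted_eval \<iota> (f i) x)"
  by (induction I rule: infinite_finite_induct) (auto simp: twisted_eval_add twisted_eval_0)

lemma twisted_eval_smult: "twisted_eval \<iota> (smult c P) x = A_emb \<iota> c * twisted_eval \<iota> P x"
  using twisted_eval_ext[of "smult c P" "degree P" x] twisted_eval_ext[of P "degree P" x] degree_smult_le[of c P]
  by (simp add: A_emb_mult sum_distrib_left mult.assoc)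

lemma twisted_eval_monom: "twisted_eval \<iota> (monom c n) x = A_emb \<iota> c * x ^ (q ^ n)"
proof -
  have "twisted_eval \<iota> (monom c n) x = (\<Sum>i\<le>n. A_emb \<iota> (coeff (monom c n) i) * x ^ (q ^ i))"
    by (rule twisted_eval_ext) (rule degree_monom_le)
  also have "\<dots> = (\<Sum>i\<le>n. if i = n then A_emb \<iota> c * x ^ (q ^ i) else 0)" by (intro sum.cong) auto
  finally show ?thesis by simp
qed

lemma frob_pow_sum: "(sum f I :: 'c) ^ (q ^ s) = (\<Sum>i\<in>I. f i ^ (q ^ s))"
proof -
  have "(0::'c) ^ (q ^ s) = 0" using q_ge_2 by (simp add: power_0_left)
  then show ?thesis by (induction I rule: infinite_finite_induct) (simp_all add: frob_pow)
qed

lemma twisted_eval_mult: "twisted_eval \<iota> (twisted_mult P P') x = twisted_eval \<iota> P (twisted_eval \<iota> P' x)"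
proof -
  have "twisted_eval \<iota> (twisted_mult P P') x =
    (\<Sum>i\<le>degree P. \<Sum>j\<le>degree P'. A_emb \<iota> (coeff P i * coeff P' j ^ (q ^ i)) * x ^ (q ^ (i + j)))"
    unfolding twisted_mult_def q[symmetric] twisted_eval_sum twisted_eval_monom ..
  also have "\<dots> = (\<Sum>i\<le>degree P. A_emb \<iota> (coeff P i) * twisted_eval \<iota> P' x ^ (q ^ i))"
  proof (rule sum.cong)
    fix i
    have "A_emb \<iota> (coeff P i * coeff P' j ^ (q ^ i)) * x ^ (q ^ (i + j)) =
      A_emb \<iota> (coeff P i) * (A_emb \<iota> (coeff P' j) * x ^ (q ^ j)) ^ (q ^ i)" for j
    proof -
      have "x ^ (q ^ (i + j)) = (x ^ (q ^ j)) ^ (q ^ i)" by (simp add: power_add mult.commute flip: power_mult)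
      then show ?thesis by (simp only: A_emb_mult A_emb_power power_mult_distrib mult.assoc)
    qed
    then show "(\<Sum>j\<le>degree P'. A_emb \<iota> (coeff P i * coeff P' j ^ (q ^ i)) * x ^ (q ^ (i + j))) =
      A_emb \<iota> (coeff P i) * twisted_eval \<iota> P' x ^ (q ^ i)"
      unfolding twisted_eval_def[of \<iota> P'] q[symmetric] frob_pow_sum by (simp only: sum_distrib_left)
  qed simp
  finally show ?thesis unfolding twisted_eval_def[of \<iota> P] q[symmetric] .
qed

lemma twisted_eval_theta_tau: "twisted_eval \<iota> [:[:0, 1:], 1:] x = C x"
  using twisted_eval_ext[of "[:[:0, 1:], 1:]" 1 x] by (simp add: A_emb_theta C_def)

lemma twisted_eval_power: "twisted_eval \<iota> (twisted_power P k) x = (twisted_eval \<iota> P ^^ k) x"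
proof (induction k)
  case 0
  show ?case using twisted_eval_ext[of 1 0 x] by (simp add: twisted_power_def)
next
  case (Suc k)
  have "twisted_power P (Suc k) = twisted_mult P (twisted_power P k)" by (simp add: twisted_power_def)
  then show ?case using Suc by (simp add: twisted_eval_mult)
qed

lemma carlitz_torsion_eq: "carlitz_torsion \<iota> a = {x. Ca a x = 0}"
proof -
  have "twisted_eval \<iota> [:[:0, 1:], 1:] = C" using twisted_eval_theta_tau by blast
  then have "twisted_eval \<iota> (carlitz a) x = Ca a x" for x
    unfolding carlitz_def Ca_def by (simp add: twisted_eval_sum twisted_eval_smult twisted_eval_power A_emb_const)
  then show ?thesis by (simp add: carlitz_torsion_def)
qed

lemma A_subring: "is_subring (range (A_emb \<iota>))"
proof (rule is_subringI)
  show "0 \<in> range (A_emb \<iota>)" "1 \<in> range (A_emb \<iota>)" using A_emb_0 A_emb_1 by (metis rangeI)+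
  fix x y assume "x \<in> range (A_emb \<iota>)" "y \<in> range (A_emb \<iota>)"
  then show "x + y \<in> range (A_emb \<iota>)" "x * y \<in> range (A_emb \<iota>)"
    by (auto simp flip: A_emb_add A_emb_mult)
next
  fix x assume "x \<in> range (A_emb \<iota>)"
  then obtain a where a: "x = A_emb \<iota> a" by blast
  have "A_emb \<iota> a + A_emb \<iota> (- a) = 0" by (simp flip: A_emb_add)
  then have "- x = A_emb \<iota> (- a)" unfolding a by (rule minus_unique)
  then show "- x \<in> range (A_emb \<iota>)" by simp
qed

section \<open>Torsion points as roots of monic polynomials over A\<close>

definition Apoly :: "'c poly set" where "Apoly = {p. \<forall>i. coeff p i \<in> range (A_emb \<iota>)}"

lemma Apoly_subring: "is_subring Apoly"
  unfolding Apoly_def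
  by (rule is_subringI) (auto simp: coeff_1 coeff_mult simp del: image_iff intro!: subring_0[OF A_subring]
      subring_1[OF A_subring] subring_add[OF A_subring] subring_mult[OF A_subring]
      subring_uminus[OF A_subring] subring_sum[OF A_subring])

text \<open>\<open>C ^^ k\<close> as an honest polynomial, monic of degree \<open>q ^ k\<close>.
  This bounds the number of torsion points and shows that they are integral over A.\<close>

definition Cpol :: "nat \<Rightarrow> 'c poly" where "Cpol k = ((\<lambda>f. [:\<theta>:] * f + f ^ q) ^^ k) [:0, 1:]"

lemma Cpol_Suc: "Cpol (Suc k) = [:\<theta>:] * Cpol k + Cpol k ^ q"
  by (simp add: Cpol_def)

lemma poly_Cpol: "poly (Cpol k) x = (C ^^ k) x"
proof (induction k)
  case (Suc k)
  then show ?case unfolding Cpol_Suc by (simp add: C_def poly_power)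
qed (simp add: Cpol_def)

lemma const_Apoly: "c \<in> range (A_emb \<iota>) \<Longrightarrow> [:c:] \<in> Apoly"
  using subring_0[OF A_subring] by (auto simp: Apoly_def coeff_pCons simp del: image_iff split: nat.split)

lemma Cpol_Apoly: "Cpol k \<in> Apoly"
proof (induction k)
  case 0
  show ?case using subring_0[OF A_subring] subring_1[OF A_subring]
    by (auto simp: Cpol_def Apoly_def coeff_pCons simp del: image_iff split: nat.split)
next
  case (Suc k)
  have "[:\<theta>:] \<in> Apoly" by (rule const_Apoly) (metis A_emb_theta rangeI)
  then show ?case unfolding Cpol_Suc using Suc
    by (intro subring_add[OF Apoly_subring] subring_mult[OF Apoly_subring] subring_power[OF Apoly_subring])
qed

lemma Cpol_degree: "degree (Cpol k) = q ^ k \<and> lead_coeff (Cpol k) = 1"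
proof (induction k)
  case 0
  show ?case by (simp add: Cpol_def)
next
  case (Suc k)
  then have d: "degree (Cpol k) = q ^ k" and c: "lead_coeff (Cpol k) = 1" by auto
  have nz: "Cpol k \<noteq> 0" using c by auto
  have dq: "degree (Cpol k ^ q) = q ^ Suc k" using nz d by (simp add: degree_power_eq)
  have "degree ([:\<theta>:] * Cpol k) \<le> q ^ k" using d by simp
  also have "q ^ k < q ^ Suc k" using q_ge_2 by (intro power_strict_increasing) auto
  finally have lt: "degree ([:\<theta>:] * Cpol k) < degree (Cpol k ^ q)" unfolding dq .
  show ?case unfolding Cpol_Suc
  proof
    show "degree ([:\<theta>:] * Cpol k + Cpol k ^ q) = q ^ Suc k" by (simp only: degree_add_eq_right[OF lt] dq)
    show "lead_coeff ([:\<theta>:] * Cpol k + Cpol k ^ q) = 1"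
      by (simp only: lead_coeff_add_le[OF lt] lead_coeff_power c power_one)
  qed
qed

definition Tpol :: "'a poly \<Rightarrow> 'c poly" where
  "Tpol a = (\<Sum>k\<le>degree a. [:Fq_emb \<iota> (coeff a k):] * Cpol k)"

lemma poly_Tpol: "poly (Tpol a) x = Ca a x"
  by (simp add: Tpol_def Ca_def poly_sum poly_Cpol)

lemma Tpol_Apoly: "Tpol a \<in> Apoly"
  unfolding Tpol_def
  by (intro subring_sum[OF Apoly_subring] subring_mult[OF Apoly_subring] const_Apoly Cpol_Apoly)
    (simp flip: A_emb_const)

lemma Tpol_degree:
  assumes "lead_coeff a = 1"
  shows "degree (Tpol a) = q ^ degree a" "lead_coeff (Tpol a) = 1"
proof -
  define n where "n = degree a"
  have split: "Tpol a = (\<Sum>k<n. [:Fq_emb \<iota> (coeff a k):] * Cpol k) + Cpol n"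
    using assms by (simp add: Tpol_def n_def one_pCons[symmetric] flip: lessThan_Suc_atMost)
  have "degree (\<Sum>k<n. [:Fq_emb \<iota> (coeff a k):] * Cpol k) < q ^ n"
  proof (rule degree_sum_less)
    show "0 < q ^ n" using q_ge_2 by simp
    fix k assume "k \<in> {..<n}"
    have "degree ([:Fq_emb \<iota> (coeff a k):] * Cpol k) \<le> q ^ k" using Cpol_degree[of k] by simp
    also have "\<dots> < q ^ n" using q_ge_2 \<open>k \<in> {..<n}\<close> by (intro power_strict_increasing) auto
    finally show "degree ([:Fq_emb \<iota> (coeff a k):] * Cpol k) < q ^ n" .
  qed
  then have lt: "degree (\<Sum>k<n. [:Fq_emb \<iota> (coeff a k):] * Cpol k) < degree (Cpol n)"
    using Cpol_degree[of n] by simp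
  show "degree (Tpol a) = q ^ degree a"
    unfolding split degree_add_eq_right[OF lt] using Cpol_degree[of n] by (simp only: n_def)
  show "lead_coeff (Tpol a) = 1"
    unfolding split lead_coeff_add_le[OF lt] using Cpol_degree[of n] by blast
qed

lemma torsion_finite:
  assumes "lead_coeff a = 1"
  shows "finite (carlitz_torsion \<iota> a)" "card (carlitz_torsion \<iota> a) \<le> q ^ degree a"
proof -
  have eq: "carlitz_torsion \<iota> a = {x. poly (Tpol a) x = 0}" by (simp add: carlitz_torsion_eq poly_Tpol)
  have nz: "Tpol a \<noteq> 0" using Tpol_degree(2)[OF assms] by auto
  show "finite (carlitz_torsion \<iota> a)" "card (carlitz_torsion \<iota> a) \<le> q ^ degree a"
    unfolding eq using poly_roots_finite[OF nz] card_poly_roots_bound[OF nz] Tpol_degree(1)[OF assms] by auto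
qed

text \<open>The trace of \<open>b \<omega>\<^bsup>(s)\<^esup>(\<zeta>)\<close>: Carlitz multiplication by \<open>\<theta>\<close> acts on these elements as
  multiplication of \<open>b\<close> by \<open>\<zeta>\<close> plus a shift of \<open>s\<close>, so \<open>\<pp>\<close> acts nilpotently.\<close>

definition tr :: "nat \<Rightarrow> 'c \<Rightarrow> 'c" where "tr s b = (\<Sum>i\<in>{1..d}. b ^ (q ^ (i - 1)) * W s i)"

lemma tr_add: "tr s (b + b') = tr s b + tr s b'"
  by (simp add: tr_def frob_pow distrib_right sum.distrib)

lemma tr_0: "tr s 0 = 0"
proof -
  have "tr s (0 + 0) = tr s 0 + tr s 0" by (rule tr_add)
  then show ?thesis by (metis add.right_neutral add_cancel_right_right)
qed

lemma Fq_emb_frob_pow: "Fq_emb \<iota> c ^ (q ^ s) = Fq_emb \<iota> c"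
  by (induction s) (simp_all only: pow_q_Suc Fq_emb_frob power_0 power_one_right)

lemma tr_smult: "tr s (Fq_emb \<iota> c * b) = Fq_emb \<iota> c * tr s b"
  by (simp add: tr_def power_mult_distrib Fq_emb_frob_pow sum_distrib_left mult.assoc)

text \<open>The Frobenius permutes the summands cyclically. The term
  \<open>- \<theta> * tr s b\<close> coming from \<open>u\<close> cancels against the linear part of
  \<open>C\<close>.\<close>

lemma C_tr:
  assumes b: "b \<in> kk"
  shows "C (tr s b) = tr s (\<zeta> * b) + (if s = 0 then 0 else tr (s - 1) b)"
proof -
  have "tr s b ^ q = (\<Sum>i\<in>{1..d}. (b ^ (q ^ (i - 1))) ^ q * W s i ^ q)"
    by (simp only: tr_def frob_sum power_mult_distrib)
  also have "\<dots> = (\<Sum>i\<in>{1..d}. (b ^ (q ^ (prv d i - 1))) ^ q * W s (prv d i) ^ q)"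
    by (rule sum_prv[symmetric])
  also have "\<dots> = (\<Sum>i\<in>{1..d}. (\<zeta> * b) ^ (q ^ (i - 1)) * W s i - \<theta> * (b ^ (q ^ (i - 1)) * W s i) + b ^ (q ^ (i - 1)) * l s i)"
  proof (rule sum.cong)
    fix i assume i: "i \<in> {1..d}"
    show "(b ^ (q ^ (prv d i - 1))) ^ q * W s (prv d i) ^ q =
      (\<zeta> * b) ^ (q ^ (i - 1)) * W s i - \<theta> * (b ^ (q ^ (i - 1)) * W s i) + b ^ (q ^ (i - 1)) * l s i"
      unfolding kk_prv[OF b i] W_rel[OF i] by (simp add: u_def zt_def power_mult_distrib algebra_simps)
  qed simp
  also have "\<dots> = tr s (\<zeta> * b) - \<theta> * tr s b + (\<Sum>i\<in>{1..d}. b ^ (q ^ (i - 1)) * l s i)"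
    by (simp only: tr_def sum.distrib sum_subtractf sum_distrib_left)
  also have "(\<Sum>i\<in>{1..d}. b ^ (q ^ (i - 1)) * l s i) = (if s = 0 then 0 else tr (s - 1) b)"
    by (simp add: l_def tr_def)
  finally show ?thesis by (simp add: C_def)
qed

text \<open>This will be the \<pp>^n-torsion, filtered by the order of the hyperderivatives.\<close>

definition Tr :: "nat \<Rightarrow> 'c set" where "Tr n = {\<Sum>s<n. tr s (b s) |b. \<forall>s. b s \<in> kk}"

lemma TrI: "(\<And>s. b s \<in> kk) \<Longrightarrow> (\<Sum>s<n. tr s (b s)) \<in> Tr n"
  by (auto simp: Tr_def)

lemma Tr_0: "Tr 0 = {0}"
  using subring_0[OF kk_subring] by (auto simp: Tr_def)

lemma Tr_zero: "0 \<in> Tr n"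
  using TrI[of "\<lambda>_. 0" n] subring_0[OF kk_subring] by (simp add: tr_0)

lemma Tr_add: assumes "x \<in> Tr n" "y \<in> Tr n" shows "x + y \<in> Tr n"
proof -
  obtain b b' where b: "\<And>s. b s \<in> kk" "x = (\<Sum>s<n. tr s (b s))" and b': "\<And>s. b' s \<in> kk" "y = (\<Sum>s<n. tr s (b' s))"
    using assms unfolding Tr_def by blast
  have "x + y = (\<Sum>s<n. tr s (b s + b' s))" by (simp add: b b' tr_add sum.distrib)
  then show ?thesis using TrI[of "\<lambda>s. b s + b' s"] subring_add[OF kk_subring] b b' by simp
qed

lemma Tr_sum: "(\<And>i. i \<in> I \<Longrightarrow> f i \<in> Tr n) \<Longrightarrow> sum f I \<in> Tr n"
  by (induction I rule: infinite_finite_induct) (auto simp: Tr_zero Tr_add)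

lemma tr_Tr: assumes "b \<in> kk" "s < n" shows "tr s b \<in> Tr n"
proof -
  have "(\<Sum>j<n. tr j (if j = s then b else 0)) = (\<Sum>j<n. if j = s then tr s b else 0)"
    by (intro sum.cong) (auto simp: tr_0)
  also have "\<dots> = tr s b" using assms by simp
  finally show ?thesis
    using TrI[of "\<lambda>j. if j = s then b else 0" n] assms subring_0[OF kk_subring] by (auto split: if_splits)
qed

lemma Tr_mono: "m \<le> n \<Longrightarrow> x \<in> Tr m \<Longrightarrow> x \<in> Tr n"
  unfolding Tr_def[of m] using Tr_sum[of "{..<m}" _ n] tr_Tr[of _ _ n] by auto

lemma C_Tr: assumes "x \<in> Tr n" shows "C x \<in> Tr n"
proof -
  obtain b where b: "\<And>s. b s \<in> kk" "x = (\<Sum>s<n. tr s (b s))" using assms unfolding Tr_def by blast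
  show ?thesis unfolding b(2) C_sum C_tr[OF b(1)]
    using b(1) subring_mult[OF kk_subring zeta_kk] by (intro Tr_sum Tr_add) (auto intro: tr_Tr Tr_zero)
qed

lemma ev_pCons: "ev (pCons c a) = Fq_emb \<iota> c + \<zeta> * ev a"
  unfolding ev_def by (cases "c = 0 \<and> a = 0") (auto simp: map_poly_pCons)

lemma ev_kk: "ev a \<in> kk"
  by (simp add: kk_eq)

text \<open>Modulo traces of lower order, \<open>a\<close> acts as multiplication of
  \<open>b\<close> by a(\<zeta>). For \<pp> this factor vanishes, so \<pp> lowers the order.\<close>

lemma Ca_tr: assumes b: "b \<in> kk" shows "\<exists>g\<in>Tr s. Ca a (tr s b) = tr s (ev a * b) + g"
proof (induction a)
  case 0
  have "ev 0 = 0" by (simp add: ev_def)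
  then show ?case using Tr_zero by (auto simp: Ca_0 tr_0)
next
  case (pCons c a)
  then obtain g where g: "g \<in> Tr s" "Ca a (tr s b) = tr s (ev a * b) + g" by auto
  have k: "ev a * b \<in> kk" by (rule subring_mult[OF kk_subring ev_kk b])
  let ?h = "(if s = 0 then 0 else tr (s - 1) (ev a * b)) + C g"
  have "Ca (pCons c a) (tr s b) = tr s (Fq_emb \<iota> c * b) + (tr s (\<zeta> * (ev a * b)) + ?h)"
    unfolding Ca_pCons g(2) C_add C_tr[OF k] tr_smult by (simp only: add.assoc)
  also have "\<dots> = tr s (ev (pCons c a) * b) + ?h"
    unfolding ev_pCons distrib_right mult.assoc tr_add by (simp only: add.assoc)
  finally show ?case using g(1) k by (intro bexI[of _ ?h]) (auto intro!: Tr_add C_Tr tr_Tr Tr_zero)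
qed

lemma Ca_pp_Tr: assumes "x \<in> Tr (Suc n)" shows "Ca \<pp> x \<in> Tr n"
proof -
  obtain b where b: "\<And>s. b s \<in> kk" "x = (\<Sum>s<Suc n. tr s (b s))" using assms unfolding Tr_def by blast
  show ?thesis unfolding b(2) Ca_sum
  proof (rule Tr_sum)
    fix s assume "s \<in> {..<Suc n}"
    moreover obtain g where "g \<in> Tr s" "Ca \<pp> (tr s (b s)) = tr s (ev \<pp> * b s) + g" using Ca_tr[OF b(1)] by blast
    ultimately show "Ca \<pp> (tr s (b s)) \<in> Tr n" using Tr_mono[of s n g] by (simp add: ev_pp tr_0)
  qed
qed

lemma Tr_torsion: "x \<in> Tr n \<Longrightarrow> Ca (\<pp> ^ n) x = 0"
proof (induction n arbitrary: x)
  case 0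
  then show ?case by (simp add: Tr_0 Ca_zero)
next
  case (Suc n)
  then show ?case using Ca_pp_Tr[of x n] by (simp only: power_Suc2 Ca_mult)
qed

text \<open>All nonzero summands over all orders and conjugates have distinct values, so they cannot
  cancel.\<close>

lemma tr_sum_nz:
  assumes b: "\<And>s. b s \<in> kk" and s0: "s0 < n" "b s0 \<noteq> 0"
  shows "(\<Sum>s<n. tr s (b s)) \<noteq> 0"
proof -
  obtain V where "carlitz_val \<iota> q lam \<zeta> \<pp> d V 1" by (rule val_exists[OF one_index])
  then interpret carlitz_val \<iota> q lam \<zeta> \<pp> d V 1 .
  let ?w = "Z (n - 1) 0"
  have w: "?w \<in> max_ideal" "?w \<noteq> 0" using Z_val[of "n - 1"] by auto
  \<comment> \<open>Every layer is measured by the topmost element: going down one layer multiplies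
    the value by \<open>q ^ d\<close>. As \<open>rot i < d\<close>, the exponents
    \<open>d * (n - 1 - s) + rot i\<close> of \<open>q\<close> below are distinct.\<close>
  have Zs: "val_eq (Z s 0) (?w ^ (q ^ (d * (n - 1 - s))))" if "s < n" for s
  proof -
    have "val_eq (Z (n - 1 - j) 0) (?w ^ (q ^ (d * j)))" if "j < n" for j
      using that
    proof (induction j)
      case 0
      then show ?case using w by (simp add: val_eq_refl)
    next
      case (Suc j)
      have e: "n - 1 - Suc j = n - 1 - j - 1" "n - 1 - j > 0" using Suc.prems by auto
      have "val_eq (Z (n - 1 - Suc j) 0) (Z (n - 1 - j) 0 ^ (q ^ d))"
        unfolding e(1) using Z_val[of "n - 1 - j"] e(2) by blast
      also have "val_eq (Z (n - 1 - j) 0 ^ (q ^ d)) ((?w ^ (q ^ (d * j))) ^ (q ^ d))"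
        using Suc by (intro val_eq_power) auto
      also have "(?w ^ (q ^ (d * j))) ^ (q ^ d) = ?w ^ (q ^ (d * Suc j))"
        by (simp add: power_add mult.commute flip: power_mult)
      finally show ?case .
    qed
    from this[of "n - 1 - s"] that show ?thesis by simp
  qed
  define I where "I = {s. s < n \<and> b s \<noteq> 0} \<times> {1..d}"
  define x where "x = (\<lambda>(s, i). b s ^ (q ^ (i - 1)) * W s i)"
  define h where "h = (\<lambda>(s, i). q ^ (d * (n - 1 - s) + rot i))"
  have "(\<Sum>s<n. tr s (b s)) = (\<Sum>s\<in>{s. s < n \<and> b s \<noteq> 0}. tr s (b s))"
    by (intro sum.mono_neutral_right) (auto simp: tr_0)
  also have "\<dots> = sum x I"
    unfolding tr_def I_def x_def by (subst sum.cartesian_product[symmetric]) simp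
  also have "sum x I \<noteq> 0"
  proof (rule val_sum_nz[OF w, where h = h])
    show "finite I" "I \<noteq> {}" using s0 one_index by (auto simp: I_def)
    show "inj_on h I"
    proof (rule inj_onI)
      fix a a' assume a: "a \<in> I" "a' \<in> I" "h a = h a'"
      obtain s i s' i' where si: "a = (s, i)" "a' = (s', i')" by fastforce
      have i: "i \<in> {1..d}" "i' \<in> {1..d}" "s < n" "s' < n" using a si by (auto simp: I_def)
      have eq: "d * (n - 1 - s) + rot i = d * (n - 1 - s') + rot i'"
        using a(3) q_ge_2 unfolding si h_def by simp
      have "(d * (n - 1 - s) + rot i) div d = n - 1 - s" "(d * (n - 1 - s') + rot i') div d = n - 1 - s'"
        using rot_less[OF i(1)] rot_less[OF i(2)] by simp_all
      then have "n - 1 - s = n - 1 - s'" using eq by metis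
      moreover from this have "rot i = rot i'" using eq by simp
      ultimately show "a = a'" using i si unrot_rot[OF i(1)] unrot_rot[OF i(2)] by simp
    qed
    fix a assume a: "a \<in> I"
    obtain s i where si: "a = (s, i)" by fastforce
    have i: "s < n" "b s \<noteq> 0" "i \<in> {1..d}" using a si by (auto simp: I_def)
    have "val_eq (b s ^ (q ^ (i - 1))) 1"
      using i by (intro kk_unit subring_power[OF kk_subring b]) auto
    moreover have "val_eq (W s i) ((?w ^ (q ^ (d * (n - 1 - s)))) ^ (q ^ rot i))"
      unfolding W_Z[OF i(3)] using Z_val[of s] rot_less[OF i(3)] val_eq_trans[OF _ val_eq_power[OF Zs[OF i(1)]]] by blast
    ultimately have "val_eq (b s ^ (q ^ (i - 1)) * W s i) (1 * (?w ^ (q ^ (d * (n - 1 - s)))) ^ (q ^ rot i))"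
      by (rule val_eq_mult)
    then show "val_eq (x a) (?w ^ h a)" unfolding si x_def h_def by (simp add: power_add flip: power_mult)
  qed
  finally show ?thesis .
qed

text \<open>The \<open>q ^ (n * d)\<close> coefficient vectors give distinct torsion points, which
  exhaust the possible roots.\<close>

lemma torsion_eq_Tr: "carlitz_torsion \<iota> (\<pp> ^ n) = Tr n"
proof -
  have lead: "lead_coeff (\<pp> ^ n) = 1" by (simp add: lead_coeff_power monic)
  have "degree (\<pp> ^ n) = n * d" using monic by (subst degree_power_eq) (auto simp: d_def)
  then have le: "card (carlitz_torsion \<iota> (\<pp> ^ n)) \<le> q ^ (n * d)" using torsion_finite(2)[OF lead] by simp
  let ?E = "PiE {..<n} (\<lambda>_. kk)" and ?\<psi> = "\<lambda>b. \<Sum>s<n. tr s (b s)"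
  have "inj_on ?\<psi> ?E"
  proof (rule inj_onI)
    fix b b' assume b: "b \<in> ?E" "b' \<in> ?E" "?\<psi> b = ?\<psi> b'"
    \<comment> \<open>The value 0 beyond \<open>n\<close> is set by hand, since elements of
      \<open>PiE\<close> are undefined there while the coefficients must lie in \<open>kk\<close>
      everywhere.\<close>
    define c where "c s = (if s < n then b s - b' s else 0)" for s
    have ck: "c s \<in> kk" for s
      using b subring_diff[OF kk_subring] subring_0[OF kk_subring] by (auto simp: c_def)
    have "(\<Sum>s<n. tr s (c s)) + ?\<psi> b' = ?\<psi> b"
      unfolding sum.distrib[symmetric] tr_add[symmetric] by (intro sum.cong) (auto simp: c_def)
    then have "(\<Sum>s<n. tr s (c s)) = 0" using b(3) by simp
    then have "c s = 0" if "s < n" for s using tr_sum_nz[where b = c, OF ck that] by blast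
    then have "b s = b' s" if "s < n" for s using that by (auto simp: c_def)
    then show "b = b'" using b by (intro PiE_ext[OF b(1,2)]) auto
  qed
  then have "card (?\<psi> ` ?E) = q ^ (n * d)"
    by (simp add: card_image card_PiE card_kk mult.commute flip: power_mult)
  moreover have sub: "?\<psi> ` ?E \<subseteq> Tr n"
  proof clarify
    fix b assume b: "b \<in> ?E"
    have k: "(if s < n then b s else 0) \<in> kk" for s
      using b subring_0[OF kk_subring] by (auto simp: PiE_def Pi_def)
    have "?\<psi> b = (\<Sum>s<n. tr s (if s < n then b s else 0))" by (intro sum.cong) auto
    also have "\<dots> \<in> Tr n" by (rule TrI) (rule k)
    finally show "?\<psi> b \<in> Tr n" .
  qed
  moreover have tt: "Tr n \<subseteq> carlitz_torsion \<iota> (\<pp> ^ n)" using Tr_torsion by (auto simp: carlitz_torsion_eq)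
  ultimately have "?\<psi> ` ?E = carlitz_torsion \<iota> (\<pp> ^ n)"
    using torsion_finite(1)[OF lead] le by (intro card_seteq) auto
  then show ?thesis using sub tt by blast
qed

lemma Tr_B: "Tr (Suc n) \<subseteq> B (Suc n)"
proof
  fix x assume "x \<in> Tr (Suc n)"
  then obtain b where b: "\<And>s. b s \<in> kk" "x = (\<Sum>s<Suc n. tr s (b s))" unfolding Tr_def by blast
  have "b s ^ (q ^ (i - 1)) \<in> RR" for s i by (intro kk_RR subring_power[OF kk_subring] b)
  then show "x \<in> B (Suc n)" unfolding b(2) tr_def
    by (intro subring_sum[OF B_subring] B_mult_RR W_B) auto
qed

lemma Lagrange:
  assumes i: "i \<in> {1..d}"
  shows "\<exists>p\<in>kpoly. \<forall>j\<in>{1..d}. poly p (zt j) = (if j = i then 1 else 0)"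
proof -
  define p where "p = (\<Prod>j\<in>{1..d}-{i}. [:- zt j, 1:])"
  define c where "c = poly p (zt i)"
  have lin: "[:- zt j, 1:] \<in> kpoly" for j
    using zt_kk subring_uminus[OF kk_subring] subring_1[OF kk_subring] by (simp add: kpoly_pCons kpoly_0)
  have pk: "p \<in> kpoly" unfolding p_def by (intro subring_prod[OF kpoly_subring] lin)
  have ck: "c \<in> kk" unfolding c_def using pk zt_kk by (intro subring_poly[OF kk_subring]) (auto simp: kpoly_def)
  have "zt i \<noteq> zt j" if "j \<in> {1..d} - {i}" for j using inj_onD[OF zt_inj, of i j] i that by blast
  then have c0: "c \<noteq> 0" by (auto simp: c_def p_def poly_prod)
  moreover have "poly p (zt j) = 0" if "j \<in> {1..d} - {i}" for j
    unfolding p_def poly_prod using that by (intro prod_zero) auto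
  moreover have "poly ([:inverse c:] * p) (zt i) = 1" using c0 by (simp add: c_def)
  ultimately have "\<forall>j\<in>{1..d}. poly ([:inverse c:] * p) (zt j) = (if j = i then 1 else 0)" by auto
  moreover have "[:inverse c:] * p \<in> kpoly"
    using kk_inverse[OF ck] by (intro subring_mult[OF kpoly_subring] pk) (simp add: kpoly_pCons kpoly_0)
  ultimately show ?thesis by blast
qed

text \<open>Inverts the trace: the coefficients of the Lagrange polynomial for \<zeta>_i combine the
  traces of the powers of \<zeta> so that only the \<open>i\<close>-th conjugate survives.\<close>

lemma W_tr:
  assumes i: "i \<in> {1..d}"
  shows "\<exists>c D. (\<forall>k. c k \<in> kk) \<and> W s i = (\<Sum>k\<le>D. c k * tr s (\<zeta> ^ k))"
proof -
  obtain p where p: "p \<in> kpoly" "\<And>j. j \<in> {1..d} \<Longrightarrow> poly p (zt j) = (if j = i then 1 else 0)"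
    using Lagrange[OF i] by blast
  have "(\<Sum>k\<le>degree p. coeff p k * tr s (\<zeta> ^ k)) = (\<Sum>k\<le>degree p. \<Sum>j\<in>{1..d}. coeff p k * zt j ^ k * W s j)"
    unfolding tr_def sum_distrib_left
  proof (intro sum.cong refl)
    fix k j
    have "(\<zeta> ^ k) ^ (q ^ (j - 1)) = zt j ^ k" unfolding zt_def by (metis power_mult mult.commute)
    then show "coeff p k * ((\<zeta> ^ k) ^ (q ^ (j - 1)) * W s j) = coeff p k * zt j ^ k * W s j"
      by (simp only: mult.assoc)
  qed
  also have "\<dots> = (\<Sum>j\<in>{1..d}. poly p (zt j) * W s j)"
    unfolding poly_altdef sum_distrib_right by (rule sum.swap)
  also have "\<dots> = (\<Sum>j\<in>{1..d}. if j = i then W s j else 0)" using p(2) by (intro sum.cong) auto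
  also have "\<dots> = W s i" using i by (simp only: sum.delta finite_atLeastAtMost if_True)
  finally have "W s i = (\<Sum>k\<le>degree p. coeff p k * tr s (\<zeta> ^ k))" by (rule sym)
  moreover have "\<forall>k. coeff p k \<in> kk" using p(1) by (simp add: kpoly_def)
  ultimately show ?thesis by (intro exI[of _ "coeff p"] exI[of _ "degree p"] conjI)
qed

section \<open>Comparison of the tower with the rings of integers\<close>

lemma K_field_RR: "range (A_emb \<iota>) \<subseteq> K_field \<iota>"
  unfolding K_field_def by (rule hull_subset)

lemma A_A_ext: "range (A_emb \<iota>) \<subseteq> A_ext \<iota> \<pp> n"
proof
  fix x assume x: "x \<in> range (A_emb \<iota>)"
  have "x \<in> K_ext \<iota> \<pp> n" unfolding K_ext_def using x K_field_RR by (intro hull_inc) auto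
  moreover have "\<forall>i. coeff [:- x, 1:] i \<in> range (A_emb \<iota>)"
    using x subring_uminus[OF A_subring x] subring_0[OF A_subring] subring_1[OF A_subring]
    by (auto simp: coeff_pCons simp del: image_iff split: nat.split)
  ultimately show "x \<in> A_ext \<iota> \<pp> n"
    unfolding A_ext_def integral_closure_def by (auto intro!: exI[of _ "[:- x, 1:]"] simp del: image_iff)
qed

lemma torsion_A_ext: "carlitz_torsion \<iota> (\<pp> ^ (n + 1)) \<subseteq> A_ext \<iota> \<pp> n"
proof
  fix x assume x: "x \<in> carlitz_torsion \<iota> (\<pp> ^ (n + 1))"
  have "x \<in> K_ext \<iota> \<pp> n" unfolding K_ext_def using x by (intro hull_inc) auto
  moreover have "poly (Tpol (\<pp> ^ (n + 1))) x = 0" using x by (simp add: poly_Tpol carlitz_torsion_eq)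
  moreover have "lead_coeff (Tpol (\<pp> ^ (n + 1))) = 1"
    by (rule Tpol_degree(2)) (simp only: lead_coeff_power monic power_one)
  moreover have "\<forall>i. coeff (Tpol (\<pp> ^ (n + 1))) i \<in> range (A_emb \<iota>)" using Tpol_Apoly unfolding Apoly_def by blast
  ultimately show "x \<in> A_ext \<iota> \<pp> n" unfolding A_ext_def integral_closure_def by blast
qed

lemma K_ext_Frac: "K_ext \<iota> \<pp> n \<subseteq> Frac (Suc n)"
  unfolding K_ext_def
proof (rule hull_minimal)
  have "carlitz_torsion \<iota> (\<pp> ^ (n + 1)) \<subseteq> Frac (Suc n)"
    using torsion_eq_Tr[of "n + 1"] Tr_B[of n] B_Frac[of "Suc n"] by auto
  moreover have "K_field \<iota> \<subseteq> Frac (Suc n)"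
    unfolding K_field_def
  proof (rule hull_minimal)
    show "range (A_emb \<iota>) \<subseteq> Frac (Suc n)" using A_emb_RR RR_B[of "Suc n"] B_Frac[of "Suc n"] by blast
  qed (rule Frac_subfield)
  ultimately show "K_field \<iota> \<union> carlitz_torsion \<iota> (\<pp> ^ (n + 1)) \<subseteq> Frac (Suc n)" by blast
qed (rule Frac_subfield)

text \<open>\<open>A_ext\<close> lies in \<open>B (Suc n)\<close> because the latter is integrally
  closed and \<open>Frac (Suc n)\<close> contains \<open>K_ext\<close>. Conversely, torsion points
  are integral over A, and every generator \<open>W s i\<close> with \<open>s \<le> n\<close> is a
  combination of them with coefficients in k.\<close>

lemma adjoin_A_ext: "adjoin (A_ext \<iota> \<pp> n) \<zeta> = B (Suc n)"
proof (rule antisym)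
  have "A_ext \<iota> \<pp> n \<subseteq> B (Suc n)"
    unfolding A_ext_def by (rule integral_closure_B[OF _ K_ext_Frac]) (use A_emb_RR in blast)
  moreover have "\<zeta> \<in> B (Suc n)" using kk_RR[OF zeta_kk] RR_B by blast
  ultimately have "A_ext \<iota> \<pp> n \<union> {\<zeta>} \<subseteq> B (Suc n)" by blast
  then show "adjoin (A_ext \<iota> \<pp> n) \<zeta> \<subseteq> B (Suc n)"
    unfolding adjoin_def by (rule hull_minimal) (rule B_subring)
  let ?H = "adjoin (A_ext \<iota> \<pp> n) \<zeta>"
  have H: "is_subring ?H" unfolding adjoin_def by (rule is_subring_hull)
  have AH: "A_ext \<iota> \<pp> n \<subseteq> ?H" unfolding adjoin_def using hull_subset[of "A_ext \<iota> \<pp> n \<union> {\<zeta>}" is_subring] by blast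
  have RH: "RR \<subseteq> ?H"
    unfolding RR_eq[symmetric] adjoin_def using A_A_ext[of n] by (intro hull_mono) auto
  have WH: "W s i \<in> ?H" if "i \<in> {1..d}" "s \<le> n" for s i
  proof -
    obtain c D where c: "\<And>k. c k \<in> kk" "W s i = (\<Sum>k\<le>D. c k * tr s (\<zeta> ^ k))" using W_tr[OF \<open>i \<in> {1..d}\<close>, of s] by blast
    have "tr s (\<zeta> ^ k) \<in> ?H" for k
    proof -
      have "tr s (\<zeta> ^ k) \<in> Tr (n + 1)" using that by (intro tr_Tr subring_power[OF kk_subring zeta_kk]) auto
      then show ?thesis using torsion_eq_Tr[of "n + 1"] torsion_A_ext[of n] AH by blast
    qed
    then show ?thesis unfolding c(2) using kk_RR[OF c(1)] RH
      by (intro subring_sum[OF H] subring_mult[OF H]) auto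
  qed
  have "B m \<subseteq> ?H" if "m \<le> Suc n" for m
    using that
  proof (induction m)
    case 0
    then show ?case using RH by simp
  next
    case (Suc m)
    then show ?case unfolding B.simps by (intro mspan_subset[OF H]) (auto intro!: WH simp del: atLeastAtMost_iff)
  qed
  then show "B (Suc n) \<subseteq> ?H" by blast
qed

lemma basis_step: "integral_basis (B n) (B (Suc n)) (J n) (\<lambda>e. mpow (W n) d e)"
  using frob_step.J_finite[OF step, of n] W_indep[of n]
  unfolding integral_basis_def B.simps mspan_def mindep_def by blast

end

section \<open>Bases in towers\<close>

lemma integral_basis_reindex:
  assumes b: "integral_basis R M I b" and \<phi>: "bij_betw \<phi> K I" and c: "\<And>k. k \<in> K \<Longrightarrow> c k = b (\<phi> k)"
  shows "integral_basis R M K c"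
proof -
  have fin: "finite K" using b \<phi> by (auto simp: integral_basis_def bij_betw_finite)
  have M: "M = {\<Sum>i\<in>I. r i * b i |r. \<forall>i\<in>I. r i \<in> R}"
    and bI: "\<And>r. \<forall>i\<in>I. r i \<in> R \<Longrightarrow> (\<Sum>i\<in>I. r i * b i) = 0 \<Longrightarrow> \<forall>i\<in>I. r i = 0"
    using b by (auto simp: integral_basis_def)
  have sum1: "(\<Sum>k\<in>K. r (\<phi> k) * c k) = (\<Sum>i\<in>I. r i * b i)" for r
    using sum.reindex_bij_betw[OF \<phi>, of "\<lambda>i. r i * b i"] c by simp
  define \<psi> where "\<psi> = the_inv_into K \<phi>"
  have \<psi>: "\<psi> (\<phi> k) = k" if "k \<in> K" for k
    using that \<phi> by (simp add: \<psi>_def bij_betw_def the_inv_into_f_f)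
  have \<psi>K: "\<psi> i \<in> K" if "i \<in> I" for i using that \<phi> \<psi> by (auto simp: bij_betw_def)
  have \<phi>I: "\<phi> k \<in> I" if "k \<in> K" for k using that \<phi> by (auto simp: bij_betw_def)
  have sum2: "(\<Sum>k\<in>K. r k * c k) = (\<Sum>i\<in>I. r (\<psi> i) * b i)" for r
    unfolding sum1[symmetric] using \<psi> by (intro sum.cong) auto
  have "{\<Sum>k\<in>K. r k * c k |r. \<forall>k\<in>K. r k \<in> R} = {\<Sum>i\<in>I. r i * b i |r. \<forall>i\<in>I. r i \<in> R}"
  proof (intro equalityI subsetI)
    fix x assume "x \<in> {\<Sum>k\<in>K. r k * c k |r. \<forall>k\<in>K. r k \<in> R}"
    then obtain r where r: "\<forall>k\<in>K. r k \<in> R" "x = (\<Sum>k\<in>K. r k * c k)" by blast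
    then have "x = (\<Sum>i\<in>I. r (\<psi> i) * b i)" "\<forall>i\<in>I. r (\<psi> i) \<in> R" using sum2 \<psi>K by auto
    then show "x \<in> {\<Sum>i\<in>I. r i * b i |r. \<forall>i\<in>I. r i \<in> R}"
      by (intro CollectI exI[of _ "\<lambda>i. r (\<psi> i)"] conjI)
  next
    fix x assume "x \<in> {\<Sum>i\<in>I. r i * b i |r. \<forall>i\<in>I. r i \<in> R}"
    then obtain r where r: "\<forall>i\<in>I. r i \<in> R" "x = (\<Sum>i\<in>I. r i * b i)" by blast
    then have "x = (\<Sum>k\<in>K. r (\<phi> k) * c k)" "\<forall>k\<in>K. r (\<phi> k) \<in> R" using sum1 \<phi>I by auto
    then show "x \<in> {\<Sum>k\<in>K. r k * c k |r. \<forall>k\<in>K. r k \<in> R}"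
      by (intro CollectI exI[of _ "\<lambda>k. r (\<phi> k)"] conjI)
  qed
  moreover have "\<forall>k\<in>K. r k = 0" if "\<forall>k\<in>K. r k \<in> R" "(\<Sum>k\<in>K. r k * c k) = 0" for r
  proof -
    have "(\<Sum>i\<in>I. r (\<psi> i) * b i) = 0" using that(2) by (simp only: sum2)
    moreover have "\<forall>i\<in>I. r (\<psi> i) \<in> R" using that(1) \<psi>K by blast
    ultimately have "\<forall>i\<in>I. r (\<psi> i) = 0" by (rule bI[rotated])
    then show ?thesis using \<psi> \<phi>I by metis
  qed
  ultimately show ?thesis unfolding integral_basis_def M using fin by (intro conjI allI impI) (simp_all only:)
qed

lemma integral_basis_tower:
  assumes b: "integral_basis R M I b" and c: "integral_basis M N K c"
  shows "integral_basis R N (I \<times> K) (\<lambda>(i, k). b i * c k)"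
proof -
  have fin: "finite I" "finite K" using b c by (auto simp: integral_basis_def)
  have M: "M = {\<Sum>i\<in>I. r i * b i |r. \<forall>i\<in>I. r i \<in> R}" and N: "N = {\<Sum>k\<in>K. r k * c k |r. \<forall>k\<in>K. r k \<in> M}"
    and bI: "\<And>r. \<forall>i\<in>I. r i \<in> R \<Longrightarrow> (\<Sum>i\<in>I. r i * b i) = 0 \<Longrightarrow> \<forall>i\<in>I. r i = 0"
    and cI: "\<And>r. \<forall>k\<in>K. r k \<in> M \<Longrightarrow> (\<Sum>k\<in>K. r k * c k) = 0 \<Longrightarrow> \<forall>k\<in>K. r k = 0"
    using b c by (auto simp: integral_basis_def)
  have sum: "(\<Sum>z\<in>I \<times> K. r z * (\<lambda>(i, k). b i * c k) z) = (\<Sum>k\<in>K. (\<Sum>i\<in>I. r (i, k) * b i) * c k)" for r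
  proof -
    have "(\<Sum>z\<in>I \<times> K. r z * (\<lambda>(i, k). b i * c k) z) = (\<Sum>i\<in>I. \<Sum>k\<in>K. r (i, k) * (b i * c k))"
      by (subst sum.cartesian_product) (auto intro!: sum.cong)
    also have "\<dots> = (\<Sum>k\<in>K. \<Sum>i\<in>I. r (i, k) * (b i * c k))" by (rule sum.swap)
    finally show ?thesis by (simp only: sum_distrib_right mult.assoc)
  qed
  have inM: "(\<Sum>i\<in>I. r (i, k) * b i) \<in> M" if "\<forall>z\<in>I \<times> K. r z \<in> R" "k \<in> K" for r k
    unfolding M using that by (auto intro!: exI[of _ "\<lambda>i. r (i, k)"])
  have "N = {\<Sum>z\<in>I \<times> K. r z * (\<lambda>(i, k). b i * c k) z |r. \<forall>z\<in>I \<times> K. r z \<in> R}"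
  proof (intro equalityI subsetI)
    fix x assume "x \<in> N"
    then obtain s where s: "\<forall>k\<in>K. s k \<in> M" "x = (\<Sum>k\<in>K. s k * c k)" unfolding N by blast
    have "\<forall>k\<in>K. \<exists>r. (\<forall>i\<in>I. r i \<in> R) \<and> s k = (\<Sum>i\<in>I. r i * b i)" using s(1) unfolding M by auto
    then obtain r where r: "\<And>k. k \<in> K \<Longrightarrow> (\<forall>i\<in>I. r k i \<in> R) \<and> s k = (\<Sum>i\<in>I. r k i * b i)" by metis
    have "x = (\<Sum>z\<in>I \<times> K. (\<lambda>(i, k). r k i) z * (\<lambda>(i, k). b i * c k) z)"
      unfolding sum s(2) using r by (intro sum.cong) auto
    moreover have "\<forall>z\<in>I \<times> K. (\<lambda>(i, k). r k i) z \<in> R" using r by auto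
    ultimately show "x \<in> {\<Sum>z\<in>I \<times> K. r z * (\<lambda>(i, k). b i * c k) z |r. \<forall>z\<in>I \<times> K. r z \<in> R}"
      by (intro CollectI exI[of _ "\<lambda>(i, k). r k i"] conjI)
  next
    fix x assume "x \<in> {\<Sum>z\<in>I \<times> K. r z * (\<lambda>(i, k). b i * c k) z |r. \<forall>z\<in>I \<times> K. r z \<in> R}"
    then obtain r where r: "\<forall>z\<in>I \<times> K. r z \<in> R" "x = (\<Sum>k\<in>K. (\<Sum>i\<in>I. r (i, k) * b i) * c k)" unfolding sum by blast
    then show "x \<in> N" unfolding N using inM[OF r(1)]
      by (intro CollectI exI[of _ "\<lambda>k. \<Sum>i\<in>I. r (i, k) * b i"] conjI ballI)
  qed
  moreover have "\<forall>z\<in>I \<times> K. r z = 0"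
    if r: "\<forall>z\<in>I \<times> K. r z \<in> R" "(\<Sum>z\<in>I \<times> K. r z * (\<lambda>(i, k). b i * c k) z) = 0" for r
  proof -
    have "\<forall>k\<in>K. (\<Sum>i\<in>I. r (i, k) * b i) \<in> M" using inM[OF r(1)] by (intro ballI)
    moreover have "(\<Sum>k\<in>K. (\<Sum>i\<in>I. r (i, k) * b i) * c k) = 0" using r(2) by (simp only: sum)
    ultimately have z: "\<forall>k\<in>K. (\<Sum>i\<in>I. r (i, k) * b i) = 0" by (rule cI)
    have "\<forall>i\<in>I. r (i, k) = 0" if k: "k \<in> K" for k
    proof (rule bI)
      show "\<forall>i\<in>I. r (i, k) \<in> R" using r(1) k by blast
      show "(\<Sum>i\<in>I. r (i, k) * b i) = 0" using z k by (rule bspec)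
    qed
    then show ?thesis by auto
  qed
  moreover have "finite (I \<times> K)" using fin by simp
  ultimately show ?thesis unfolding integral_basis_def by (intro conjI allI impI) assumption+
qed

context carlitz_prime
begin

lemma basis_tower:
  "integral_basis RR (B (Suc n)) (PiE {0..n} J) (\<lambda>e. \<Prod>j\<in>{0..n}. mpow (W j) d (e j))"
proof (induction n)
  case 0
  have "bij_betw (\<lambda>e. e 0) (PiE {0..0::nat} J) (J 0)"
    by (rule bij_betw_byWitness[where f' = "\<lambda>x. \<lambda>j\<in>{0..0}. x"])
      (auto simp: fun_eq_iff PiE_def extensional_def)
  from integral_basis_reindex[OF basis_step[of 0] this] show ?case by simp
next
  case (Suc n)
  \<comment> \<open>Splits off the exponent of the top layer. The restriction keeps the remaining
    function undefined beyond \<open>n\<close>, as membership in \<open>PiE\<close> demands.\<close>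
  have bij: "bij_betw (\<lambda>e. (restrict e {0..n}, e (Suc n))) (PiE {0..Suc n} J) (PiE {0..n} J \<times> J (Suc n))"
  proof (rule bij_betw_byWitness[where f' = "\<lambda>(f, x). f(Suc n := x)"])
    show "\<forall>e\<in>PiE {0..Suc n} J. (\<lambda>(f, x). f(Suc n := x)) (restrict e {0..n}, e (Suc n)) = e"
      by (auto simp: fun_eq_iff PiE_def extensional_def)
    show "\<forall>z\<in>PiE {0..n} J \<times> J (Suc n). (\<lambda>e. (restrict e {0..n}, e (Suc n))) ((\<lambda>(f, x). f(Suc n := x)) z) = z"
      by (auto simp: fun_eq_iff PiE_def extensional_def)
    show "(\<lambda>e. (restrict e {0..n}, e (Suc n))) ` PiE {0..Suc n} J \<subseteq> PiE {0..n} J \<times> J (Suc n)"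
      by (auto simp: PiE_def Pi_def)
    show "(\<lambda>(f, x). f(Suc n := x)) ` (PiE {0..n} J \<times> J (Suc n)) \<subseteq> PiE {0..Suc n} J"
      by (auto simp: PiE_def Pi_def extensional_def le_Suc_eq)
  qed
  show ?case
  proof (rule integral_basis_reindex[OF integral_basis_tower[OF Suc basis_step] bij])
    fix e
    have "(\<Prod>j\<in>{0..n}. mpow (W j) d (e j)) = (\<Prod>j\<in>{0..n}. mpow (W j) d (restrict e {0..n} j))"
      by (intro prod.cong) auto
    then show "(\<Prod>j\<in>{0..Suc n}. mpow (W j) d (e j)) =
      (\<lambda>(i, k). (\<Prod>j\<in>{0..n}. mpow (W j) d (i j)) * mpow (W (Suc n)) d k) (restrict e {0..n}, e (Suc n))"
      by (simp add: prod.atLeast0_atMost_Suc)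
  qed
qed

end

theorem mainTheorem9:
  fixes \<iota> :: "'a::{field,finite} fls alg_closure \<Rightarrow> 'c::{nonarch_field,complete_space}"
    and lam \<zeta> :: 'c
    and \<pp> :: "'a poly"
    and q d :: nat
  assumes "C_infinity \<iota>"
    and "q = CARD('a)"
    and "lam ^ (q - 1) = - theta \<iota>"
    and "irreducible \<pp>" and "lead_coeff \<pp> = 1" and "d = degree \<pp>"
    and "poly (map_poly (Fq_emb \<iota>) \<pp>) \<zeta> = 0"
  shows
    "integral_basis (adjoin (range (A_emb \<iota>)) \<zeta>) (adjoin (A_ext \<iota> \<pp> 0) \<zeta>)
       {..<const_index d (q - 1)} (omega_pow \<iota> lam \<zeta> d 0)
     \<and> (\<forall>n>0. integral_basis (adjoin (A_ext \<iota> \<pp> (n - 1)) \<zeta>) (adjoin (A_ext \<iota> \<pp> n) \<zeta>)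
       {..const_index d (q - 1)} (omega_pow \<iota> lam \<zeta> d n))
     \<and> (\<forall>n. integral_basis (adjoin (range (A_emb \<iota>)) \<zeta>) (adjoin (A_ext \<iota> \<pp> n) \<zeta>)
       (\<Pi>\<^sub>E j\<in>{0..n}. if j = 0 then {..<const_index d (q - 1)} else {..const_index d (q - 1)})
       (\<lambda>e. \<Prod>j\<in>{0..n}. omega_pow \<iota> lam \<zeta> d j (e j)))"
proof -
  interpret carlitz_prime \<iota> q lam \<zeta> \<pp> d
    using assms by (intro carlitz_prime.intro carlitz_prime_axioms.intro carlitz_field.intro carlitz_field_axioms.intro)
  have om: "omega_pow \<iota> lam \<zeta> d n = (\<lambda>e. mpow (W n) d e)" for n
    by (rule ext) (rule omega_pow_eq)
  show ?thesis
  proof (intro conjI allI impI)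
    show "integral_basis (adjoin (range (A_emb \<iota>)) \<zeta>) (adjoin (A_ext \<iota> \<pp> 0) \<zeta>)
       {..<const_index d (q - 1)} (omega_pow \<iota> lam \<zeta> d 0)"
      using basis_step[of 0] unfolding om RR_eq adjoin_A_ext by (simp add: J_def)
    show "integral_basis (adjoin (A_ext \<iota> \<pp> (n - 1)) \<zeta>) (adjoin (A_ext \<iota> \<pp> n) \<zeta>)
       {..const_index d (q - 1)} (omega_pow \<iota> lam \<zeta> d n)" if "n > 0" for n
      using basis_step[of n] that unfolding om adjoin_A_ext by (simp add: J_def)
    show "integral_basis (adjoin (range (A_emb \<iota>)) \<zeta>) (adjoin (A_ext \<iota> \<pp> n) \<zeta>)
       (\<Pi>\<^sub>E j\<in>{0..n}. if j = 0 then {..<const_index d (q - 1)} else {..const_index d (q - 1)})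
       (\<lambda>e. \<Prod>j\<in>{0..n}. omega_pow \<iota> lam \<zeta> d j (e j))" for n
      using basis_tower[of n] unfolding om RR_eq adjoin_A_ext J_def .
  qed
qed

end
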